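(* Let $\mathcal{C}$ be a smooth, projective, geometrically connected curve of genus $g$ over the finite field $\mathbb{F}_q$, let $K=\mathbb{F}_q(\mathcal{C})$ be its function field, let $\infty$ be a fixed closed point of $\mathcal{C}$, of degree $d_\infty$ over $\mathbb{F}_q$, and let $n\geq 1$ be an integer. Then, for integers $r\to\infty$, the number of $K$-rational points of height $r$ on projective $n$-space satisfies \[ \#\{x\in \mathbb{P}^n(K): \mathrm{ht}(x) = r\} = \kappa\, q^{(n+1)r} + \begin{cases} O\left(q^r\log(q^r)\right) & \text{ if } n=d_\infty=1,\\ O\left(q^{r(n+1-1/d_\infty)}\right) & \text{ otherwise, } \end{cases} \] where the leading coefficient is \[ \kappa=\frac{h_K\, q^{(n+1)(1-g)}}{\zeta_K(n+1)(q-1)}. \]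
   Context: Height: for each closed point (place) $v$ of $\mathcal{C}$, let $v(\cdot)$ also denote the corresponding normalized discrete valuation of $K$ (with $v(0)=+\infty$) and let $\deg(v)$ be the degree over $\mathbb{F}_q$ of the residue field at $v$. The (logarithmic) height of $x=[x_0:\cdots:x_n]\in\mathbb{P}^n(K)$ is \[ \mathrm{ht}(x):=-\sum_{v}\deg(v)\min_{0\le i\le n} v(x_i), \] the sum being over all places $v$ of $K$ (including $\infty$). Equivalently, $\mathrm{ht}(x)=-\deg(\inf_i(x_i))$, where $\inf_i(x_i)$ is the greatest divisor $D$ with $D\le \mathrm{div}(x_i)$ for all $i$. Class number: $h_K=\#\mathrm{Pic}^0_{\mathcal{C}}(\mathbb{F}_q)$ is the class number of $K$ (the number of degree zero divisor classes of $\mathcal{C}$). Zeta function: $\zeta_K(s)=\zeta_{\mathcal{C}}(s)=Z(\mathcal{C},q^{-s})$, where \[ Z(\mathcal{C},t)=\exp\left(\sum_{d=1}^\infty \#\mathcal{C}(\mathbb{F}_{q^d})\frac{t^d}{d}\right)=\sum_{D\ge 0} t^{\deg(D)}, \] the last sum being over all effective divisors $D$ of $\mathcal{C}$. *)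

theory Defs
  imports
    "HOL-Analysis.Analysis"
    "HOL-Computational_Algebra.Polynomial"
    "HOL-Library.Landau_Symbols"
    "HOL-Library.FuncSet"
begin

text \<open>
  A smooth, projective, geometrically connected curve over a finite field is represented by its
  function field (the standard equivalence of categories).  The finite field is the type
  \<^typ>\<open>'f\<close>, so $q$ is \<open>CARD('f)\<close>; the function field is the type \<^typ>\<open>'k\<close>; and \<open>emb\<close> is the
  structure map.  All dimensions over the constant field are taken with respect to
  the scaling \<open>\<lambda>c x. emb c * x\<close>.
\<close>

definition algebraic_over :: "('f::field \<Rightarrow> 'k::field) \<Rightarrow> 'k \<Rightarrow> bool" where
  "algebraic_over emb x \<longleftrightarrow> (\<exists>p :: 'f poly. p \<noteq> 0 \<and> poly (map_poly emb p) x = 0)"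

text \<open>The subfield generated by the constants and \<open>x\<close>, for \<open>x\<close> transcendental (otherwise
  denominators may vanish).\<close>

definition rational_subfield :: "('f::field \<Rightarrow> 'k::field) \<Rightarrow> 'k \<Rightarrow> 'k set" where
  "rational_subfield emb x =
     {poly (map_poly emb a) x / poly (map_poly emb b) x | a b :: 'f poly. b \<noteq> 0}"

text \<open>The last assumption, that the constants are algebraically closed in the function field,
  is geometric connectedness of the curve.\<close>

locale function_field =
  fixes emb :: "'f::{field,finite} \<Rightarrow> 'k::field"
  assumes emb_one: "emb 1 = 1"
    and emb_add: "emb (a + b) = emb a + emb b"
    and emb_mult: "emb (a * b) = emb a * emb b"
    and one_variable:
      "\<exists>x. \<not> algebraic_over emb x \<and>
         (\<exists>B. finite B \<and>
           (\<forall>y. \<exists>c. (\<forall>b\<in>B. c b \<in> rational_subfield emb x) \<and> y = (\<Sum>b\<in>B. c b * b)))"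
    and constants_closed: "algebraic_over emb x \<Longrightarrow> x \<in> range emb"

text \<open>
  Closed points of the curve are identified with the normalized discrete valuations of the
  function field that are trivial on the constants.  The convention $v(0) = +\infty$ is not part of
  the integer-valued function: \<open>v 0\<close> is fixed to be \<open>0\<close> (so that each valuation is a unique
  function), and every definition below treats zero separately, as if \<open>v 0\<close> were infinite.
\<close>

definition places :: "('f::field \<Rightarrow> 'k::field) \<Rightarrow> ('k \<Rightarrow> int) set" where
  "places emb = {v.
     v 0 = 0 \<and>
     (\<forall>x y. x \<noteq> 0 \<longrightarrow> y \<noteq> 0 \<longrightarrow> v (x * y) = v x + v y) \<and>
     (\<forall>x y. x \<noteq> 0 \<longrightarrow> y \<noteq> 0 \<longrightarrow> x + y \<noteq> 0 \<longrightarrow> min (v x) (v y) \<le> v (x + y)) \<and>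
     (\<forall>c. c \<noteq> 0 \<longrightarrow> v (emb c) = 0) \<and>
     (\<exists>x. x \<noteq> 0 \<and> v x = 1)}"

definition valuation_ring :: "('k::field \<Rightarrow> int) \<Rightarrow> 'k set" where
  "valuation_ring v = {x. x = 0 \<or> 0 \<le> v x}"

definition valuation_ideal :: "('k::field \<Rightarrow> int) \<Rightarrow> 'k set" where
  "valuation_ideal v = {x. x = 0 \<or> 0 < v x}"

text \<open>\<open>B\<close> consists of representatives of a basis of the residue field
  \<open>valuation_ring v / valuation_ideal v\<close> as a vector space over the constants.\<close>

definition residue_basis :: "('f::field \<Rightarrow> 'k::field) \<Rightarrow> ('k \<Rightarrow> int) \<Rightarrow> 'k set \<Rightarrow> bool" where
  "residue_basis emb v B \<longleftrightarrow> finite B \<and> B \<subseteq> valuation_ring v \<and>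
     (\<forall>x\<in>valuation_ring v. \<exists>!c. c \<in> B \<rightarrow>\<^sub>E (UNIV :: 'f set) \<and>
        x - (\<Sum>b\<in>B. emb (c b) * b) \<in> valuation_ideal v)"

definition place_degree :: "('f::field \<Rightarrow> 'k::field) \<Rightarrow> ('k \<Rightarrow> int) \<Rightarrow> nat" where
  "place_degree emb v = (THE d. \<exists>B. residue_basis emb v B \<and> card B = d)"

type_synonym 'k divisor = "('k \<Rightarrow> int) \<Rightarrow> int"

definition divisors :: "('f::field \<Rightarrow> 'k::field) \<Rightarrow> 'k divisor set" where
  "divisors emb = {D. finite {v. D v \<noteq> 0} \<and> {v. D v \<noteq> 0} \<subseteq> places emb}"

definition divisor_degree :: "('f::field \<Rightarrow> 'k::field) \<Rightarrow> 'k divisor \<Rightarrow> int" where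
  "divisor_degree emb D = (\<Sum>v | D v \<noteq> 0. int (place_degree emb v) * D v)"

definition effective_divisors :: "('f::field \<Rightarrow> 'k::field) \<Rightarrow> 'k divisor set" where
  "effective_divisors emb = {D \<in> divisors emb. \<forall>v. 0 \<le> D v}"

definition principal_divisor :: "('f::field \<Rightarrow> 'k::field) \<Rightarrow> 'k \<Rightarrow> 'k divisor" where
  "principal_divisor emb f = (\<lambda>v. if v \<in> places emb then v f else 0)"

definition divisors_degree_zero :: "('f::field \<Rightarrow> 'k::field) \<Rightarrow> 'k divisor set" where
  "divisors_degree_zero emb = {D \<in> divisors emb. divisor_degree emb D = 0}"

definition linear_equivalence ::
    "('f::field \<Rightarrow> 'k::field) \<Rightarrow> ('k divisor \<times> 'k divisor) set" where
  "linear_equivalence emb =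
     {(D, E). \<exists>f. f \<noteq> 0 \<and> (\<forall>v. D v - E v = principal_divisor emb f v)}"

text \<open>Principal divisors have degree zero, so the classes below, which range over
  all divisors linearly equivalent to a given one, stay within degree zero.\<close>

definition class_number :: "('f::field \<Rightarrow> 'k::field) \<Rightarrow> nat" where
  "class_number emb = card (divisors_degree_zero emb // linear_equivalence emb)"

definition riemann_roch_space :: "('f::field \<Rightarrow> 'k::field) \<Rightarrow> 'k divisor \<Rightarrow> 'k set" where
  "riemann_roch_space emb D = {f. f = 0 \<or> (\<forall>v\<in>places emb. 0 \<le> v f + D v)}"

definition riemann_roch_dim :: "('f::field \<Rightarrow> 'k::field) \<Rightarrow> 'k divisor \<Rightarrow> nat" where
  "riemann_roch_dim emb D =
     vector_space.dim (\<lambda>c x. emb c * x) (riemann_roch_space emb D)"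

text \<open>The genus of a function field in the sense of Stichtenoth's
  ``Algebraic Function Fields and Codes'': the maximum of \<open>deg D - l(D) + 1\<close> over all divisors.\<close>

definition genus :: "('f::field \<Rightarrow> 'k::field) \<Rightarrow> int" where
  "genus emb = (GREATEST g. \<exists>D\<in>divisors emb.
     g = divisor_degree emb D - int (riemann_roch_dim emb D) + 1)"

definition Z_function :: "('f::field \<Rightarrow> 'k::field) \<Rightarrow> real \<Rightarrow> real" where
  "Z_function emb t = (\<Sum>\<^sub>\<infinity>D\<in>effective_divisors emb. t ^ nat (divisor_degree emb D))"

definition zeta_function :: "('f::{field,finite} \<Rightarrow> 'k::field) \<Rightarrow> real \<Rightarrow> real" where
  "zeta_function emb s = Z_function emb (real CARD('f) powr (- s))"

text \<open>Homogeneous coordinate vectors are functions on \<open>{..n}\<close> (extensional, so that each vector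
  is represented once).\<close>

definition coordinate_vectors :: "nat \<Rightarrow> (nat \<Rightarrow> 'k::field) set" where
  "coordinate_vectors n = {x \<in> {..n} \<rightarrow>\<^sub>E UNIV. \<exists>i\<le>n. x i \<noteq> 0}"

definition proportional :: "nat \<Rightarrow> ((nat \<Rightarrow> 'k::field) \<times> (nat \<Rightarrow> 'k)) set" where
  "proportional n = {(x, y). x \<in> coordinate_vectors n \<and> y \<in> coordinate_vectors n \<and>
     (\<exists>c. c \<noteq> 0 \<and> (\<forall>i\<le>n. y i = c * x i))}"

definition projective_space :: "nat \<Rightarrow> (nat \<Rightarrow> 'k::field) set set" where
  "projective_space n = coordinate_vectors n // proportional n"

text \<open>Leaving out the zero coordinates amounts to $v(0) = +\infty$.\<close>

definition min_valuation :: "nat \<Rightarrow> ('k::field \<Rightarrow> int) \<Rightarrow> (nat \<Rightarrow> 'k) \<Rightarrow> int" where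
  "min_valuation n v x = Min {v (x i) | i. i \<le> n \<and> x i \<noteq> 0}"

definition vector_height :: "('f::field \<Rightarrow> 'k::field) \<Rightarrow> nat \<Rightarrow> (nat \<Rightarrow> 'k) \<Rightarrow> int" where
  "vector_height emb n x =
     - (\<Sum>v | v \<in> places emb \<and> min_valuation n v x \<noteq> 0.
          int (place_degree emb v) * min_valuation n v x)"

text \<open>By the product formula the choice of homogeneous coordinates is immaterial.\<close>

definition height :: "('f::field \<Rightarrow> 'k::field) \<Rightarrow> nat \<Rightarrow> (nat \<Rightarrow> 'k) set \<Rightarrow> int" where
  "height emb n P = vector_height emb n (SOME x. x \<in> P)"

end

theory Submission
  imports "HOL-Algebra.Algebraic_Closure_Type" "HOL-Number_Theory.Residues" Defs
begin

text \<open>A point of height \<open>r\<close> is a vector \<open>x\<close>, up to constants, whose divisor \<open>- inf (div (x i))\<close> is one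
  of \<open>h\<close> representatives of the divisor classes of degree \<open>r\<close>.  Moebius inversion over finite sets of
  places expresses the number of these vectors through the numbers \<open>q ^ ((n + 1) l(D)) - 1\<close> of nonzero
  vectors with coordinates in \<open>L(D)\<close>.  By Riemann's theorem \<open>l(D) = deg D + 1 - g\<close> for large degrees,
  and the Moebius sums of a given degree are the coefficients of \<open>1 / Z\<close>; this gives the main term with
  an error \<open>O(q ^ r)\<close>, which is within both error terms of the theorem.

  The classes of degree \<open>r\<close> exist by F. K. Schmidt's theorem that there is a divisor of degree one.
  Otherwise a prime \<open>l\<close> divides all degrees, every place splits in the constant extension of degree \<open>l\<close>,
  and the bound for the number of effective divisors of that extension allows only \<open>O(q ^ N)\<close> pairs of
  effective divisors of total degree \<open>N\<close>, whereas there are at least of the order of \<open>N q ^ N\<close>.\<close>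

section \<open>Independence over a rational subfield\<close>

text \<open>Heights are degrees of divisors, so without a divisor of degree one most values of
  \<open>r\<close> would not occur at all and the formula would fail for them; this is why Schmidt's
  theorem is unavoidable. Its classical proof compares pole orders: if \<open>l\<close> divided all
  degrees, the zeta function of the constant extension of degree \<open>l\<close> would become the
  \<open>l\<close>-th power of that of \<open>K\<close>, with a pole of order \<open>l\<close>,
  while class counting allows only a simple one. Counting pairs is the elementary form of this with
  two of the \<open>l\<close> factors. The extension is not built as a function field: its functions
  are polynomials over \<open>K\<close>, and values above a place are taken in \<open>K\<close>
  itself, at approximate roots. The error is uniform because Riemann's equality fails only for a
  bounded range of degrees, in which all quantities are bounded. Each set of places of degree
  \<open>d\<close> thus contributes a bounded error, and there are \<open>O(q ^ d)\<close> of them;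
  the tail of the series of \<open>1 / Z\<close> has the same order. As the constants are finite,
  field degrees, residue degrees and dimensions are compared by counting finite sets and
  cosets.\<close>

lemma finite_polys_degree_le [simp]: "finite {p :: 'a::{field,finite} poly. degree p \<le> k}"
  and card_polys_degree_le: "card {p :: 'a::{field,finite} poly. degree p \<le> k} = CARD('a) ^ (k + 1)"
proof -
  let ?S = "{p :: 'a poly. degree p \<le> k}" and ?T = "{xs :: 'a list. set xs \<subseteq> UNIV \<and> length xs = k + 1}"
  have "bij_betw (\<lambda>p. map (coeff p) [0..<k + 1]) ?S ?T"
  proof (rule bij_betw_byWitness[where f' = Poly])
    have "nth_default 0 (map (coeff p) [0..<k + 1]) i = coeff p i" if "degree p \<le> k" for p :: "'a poly" and i
      using that coeff_eq_0[of p i] by (auto simp: nth_default_def simp del: upt_Suc)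
    then show "\<forall>p\<in>?S. Poly (map (coeff p) [0..<k + 1]) = p"
      by (auto simp: poly_eq_iff simp del: upt_Suc)
    show "\<forall>xs\<in>?T. map (coeff (Poly xs)) [0..<k + 1] = xs"
      by (auto intro!: nth_equalityI simp: nth_default_def simp del: upt_Suc)
    show "Poly ` ?T \<subseteq> ?S"
    proof clarify
      fix xs :: "'a list" assume "length xs = k + 1"
      then show "degree (Poly xs) \<le> k"
        by (intro degree_le) (auto simp: nth_default_def)
    qed
  qed auto
  moreover have "finite ?T" "card ?T = CARD('a) ^ (k + 1)"
    using finite_lists_length_eq[of "UNIV :: 'a set" "k + 1"]
      card_lists_length_eq[of "UNIV :: 'a set" "k + 1"] by auto
  ultimately show "finite ?S" "card ?S = CARD('a) ^ (k + 1)"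
    using bij_betw_finite[of _ ?S ?T] bij_betw_same_card[of _ ?S ?T] by auto
qed

context function_field
begin

text \<open>A term in \<open>emb\<close>, so that \<open>q\<close> needs no type argument for the
  constant field; \<open>CARD_eq_q\<close> gives the usual meaning.\<close>

definition q :: nat where "q = card (range emb)"

lemma emb_0 [simp]: "emb 0 = 0"
  using emb_add[of 0 0] by (simp only: add_0_left add_cancel_right_right)

lemmas emb_1 [simp] = emb_one

lemma emb_uminus: "emb (- a) = - emb a"
  using emb_add[of "- a" a] by (simp add: eq_neg_iff_add_eq_0)

lemma emb_diff: "emb (a - b) = emb a - emb b"
  using emb_add[of a "- b"] by (simp add: emb_uminus)

lemma emb_eq_0_iff [simp]: "emb a = 0 \<longleftrightarrow> a = 0"
proof
  assume "emb a = 0"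
  then show "a = 0" using emb_mult[of a "inverse a"] by (cases "a = 0") auto
qed simp

lemma emb_eq_iff [simp]: "emb a = emb b \<longleftrightarrow> a = b"
  using emb_eq_0_iff[of "a - b"] by (simp only: emb_diff right_minus_eq)

lemma CARD_eq_q [simp]: "CARD('f) = q"
  by (simp add: q_def card_image inj_on_def)

lemma q_ge_2: "q \<ge> 2"
proof -
  have "card {0, 1 :: 'f} \<le> CARD('f)" by (rule card_mono) auto
  then show ?thesis by simp
qed

lemma emb_inverse: "emb (inverse a) = inverse (emb a)"
  using emb_mult[of a "inverse a"] by (cases "a = 0") (auto simp: inverse_unique)

section \<open>Evaluation of polynomials with constant coefficients\<close>

definition ev :: "'k \<Rightarrow> 'f poly \<Rightarrow> 'k" where
  "ev x p = poly (map_poly emb p) x"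

lemma ev_pCons [simp]: "ev x (pCons a p) = emb a + x * ev x p"
  by (cases "a = 0 \<and> p = 0") (auto simp: ev_def map_poly_pCons)

lemma ev_0 [simp]: "ev x 0 = 0" by (simp add: ev_def)

lemma ev_1 [simp]: "ev x 1 = 1"
  using ev_pCons[of x 1 0] by (simp del: ev_pCons add: one_pCons[symmetric])

lemma ev_add [simp]: "ev x (p + r) = ev x p + ev x r"
  by (induction p r rule: poly_induct2) (simp_all add: emb_add algebra_simps)

lemma ev_smult [simp]: "ev x (smult a p) = emb a * ev x p"
  by (induction p) (simp_all add: emb_mult algebra_simps)

lemma ev_mult [simp]: "ev x (p * r) = ev x p * ev x r"
  by (induction p) (simp_all add: algebra_simps)

lemma ev_uminus [simp]: "ev x (- p) = - ev x p"
  by (induction p) (simp_all add: emb_uminus)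

lemma ev_diff [simp]: "ev x (p - r) = ev x p - ev x r"
  using ev_add[of x p "- r"] by simp

lemma ev_power [simp]: "ev x (p ^ n) = ev x p ^ n"
  by (induction n) simp_all

lemma ev_sum: "ev x (sum f A) = (\<Sum>a\<in>A. ev x (f a))"
  by (induction A rule: infinite_finite_induct) simp_all

lemma ev_monom [simp]: "ev x (monom a n) = emb a * x ^ n"
  by (induction n) (simp_all add: monom_0 monom_Suc algebra_simps)

lemma algebraic_iff: "algebraic_over emb x \<longleftrightarrow> (\<exists>p. p \<noteq> 0 \<and> ev x p = 0)"
  by (simp add: algebraic_over_def ev_def)

lemma not_algebraic_nonzero:
  assumes "\<not> algebraic_over emb z" shows "z \<noteq> 0"
proof
  assume "z = 0"
  then have "ev z [:0, 1:] = 0" by simp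
  then have "[:0, 1:] = (0 :: 'f poly)" using assms unfolding algebraic_iff by blast
  then show False by simp
qed

sublocale vs: vector_space "\<lambda>c x. emb c * x"
  by unfold_locales (simp_all add: emb_add emb_mult algebra_simps)

text \<open>Polynomial coefficients suffice: denominators can be cleared.\<close>

definition indep_over :: "'k \<Rightarrow> 'k set \<Rightarrow> bool" where
  "indep_over z Y \<longleftrightarrow> finite Y \<and> (\<forall>P. (\<Sum>y\<in>Y. ev z (P y) * y) = 0 \<longrightarrow> (\<forall>y\<in>Y. P y = 0))"

lemma indep_overD:
  "indep_over z Y \<Longrightarrow> (\<Sum>y\<in>Y. ev z (P y) * y) = 0 \<Longrightarrow> y \<in> Y \<Longrightarrow> P y = 0"
  by (auto simp: indep_over_def)

text \<open>If every relation has vanishing constant coefficients, all its polynomials are divisible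
  by the variable. Cancelling \<open>z\<close> leaves a relation of smaller degree, and induction
  ends at zero. Independence over the rational subfield is thus tested by reduction modulo
  \<open>z\<close>.\<close>

lemma indep_overI:
  assumes z: "z \<noteq> 0" and Y: "finite Y"
    and c0: "\<And>P. (\<Sum>y\<in>Y. ev z (P y) * y) = 0 \<Longrightarrow> \<forall>y\<in>Y. coeff (P y) 0 = 0"
  shows "indep_over z Y"
proof -
  have *: "\<forall>y\<in>Y. P y = 0" if "(\<Sum>y\<in>Y. ev z (P y) * y) = 0" "\<forall>y\<in>Y. degree (P y) \<le> d" for P d
    using that
  proof (induction d arbitrary: P)
    case 0
    show ?case
    proof
      fix y assume "y \<in> Y"
      then have "lead_coeff (P y) = 0" using c0[OF 0(1)] 0(2) by simp
      then show "P y = 0" by simp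
    qed
  next
    case (Suc d)
    define \<psi> where "\<psi> y = poly_shift 1 (P y)" for y
    have P: "P y = pCons 0 (\<psi> y)" if "y \<in> Y" for y
      using c0[OF Suc.prems(1)] that
      by (auto simp: \<psi>_def poly_eq_iff coeff_pCons coeff_poly_shift split: nat.split)
    have "degree (\<psi> y) \<le> d" if "y \<in> Y" for y
      using Suc.prems(2) P[OF that] that by (cases "\<psi> y = 0") auto
    moreover have "z * (\<Sum>y\<in>Y. ev z (\<psi> y) * y) = 0"
      using Suc.prems(1) P by (simp add: sum_distrib_left mult.assoc)
    then have "(\<Sum>y\<in>Y. ev z (\<psi> y) * y) = 0" using z by simp
    ultimately have "\<forall>y\<in>Y. \<psi> y = 0" using Suc.IH by blast
    then show ?case using P by auto
  qed
  show ?thesis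
    unfolding indep_over_def
  proof (intro conjI allI impI)
    fix P assume "(\<Sum>y\<in>Y. ev z (P y) * y) = 0"
    then show "\<forall>y\<in>Y. P y = 0"
      by (rule *[where d = "\<Sum>y\<in>Y. degree (P y)"]) (use Y in \<open>auto intro!: member_le_sum\<close>)
  qed (use Y in simp)
qed

text \<open>Compare the number of combinations of \<open>Y\<close> with coefficients of degree at most \<open>J\<close> in \<open>z\<close>
  with the number of elements of a space spanned over the constants by \<open>x ^ i * b\<close>, after
  multiplication by a common denominator, and let \<open>J\<close> tend to infinity.\<close>

lemma indep_over_bounded: "\<exists>m. \<forall>Y. indep_over z Y \<longrightarrow> card Y \<le> m"
proof -
  obtain x B where tr: "\<not> algebraic_over emb x" and B: "finite B"
    and span: "\<And>y. \<exists>c. (\<forall>b\<in>B. c b \<in> rational_subfield emb x) \<and> y = (\<Sum>b\<in>B. c b * b)"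
    using one_variable by blast
  have inj: "ev x s \<noteq> 0" if "s \<noteq> 0" for s
    using tr that by (auto simp: algebraic_iff)
  define W where "W k = (\<lambda>p. \<Sum>b\<in>B. ev x (p b) * b) ` (B \<rightarrow>\<^sub>E {p. degree p \<le> k})" for k
  have W_I: "(\<Sum>b\<in>B. ev x (p b) * b) \<in> W k" if "\<forall>b\<in>B. degree (p b) \<le> k" for p k
    unfolding W_def by (rule image_eqI[of _ _ "restrict p B"]) (use that in \<open>auto intro!: sum.cong\<close>)
  have W_E: "\<exists>p. (\<forall>b\<in>B. degree (p b) \<le> k) \<and> w = (\<Sum>b\<in>B. ev x (p b) * b)" if "w \<in> W k" for w k
    using that unfolding W_def by (auto simp: PiE_iff)
  have W_fin: "finite (W k)" and W_card: "card (W k) \<le> q ^ ((k + 1) * card B)" for k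
  proof -
    show "finite (W k)" unfolding W_def using B by (intro finite_imageI finite_PiE) auto
    have "card (W k) \<le> card (B \<rightarrow>\<^sub>E {p :: 'f poly. degree p \<le> k})"
      unfolding W_def using B by (intro card_image_le finite_PiE) auto
    also have "\<dots> = q ^ ((k + 1) * card B)"
      using B by (simp only: card_PiE card_polys_degree_le prod_constant power_mult CARD_eq_q)
    finally show "card (W k) \<le> q ^ ((k + 1) * card B)" .
  qed
  have W_mono: "w \<in> W k'" if "w \<in> W k" "k \<le> k'" for w k k'
    using W_E[OF that(1)] that(2) by (metis W_I order_trans)
  have W_0: "0 \<in> W k" for k using W_I[of "\<lambda>_. 0" k] by simp
  have W_add: "w + w' \<in> W k" if "w \<in> W k" "w' \<in> W k" for w w' k
  proof -
    obtain p p' where p: "\<forall>b\<in>B. degree (p b) \<le> k" "w = (\<Sum>b\<in>B. ev x (p b) * b)"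
      "\<forall>b\<in>B. degree (p' b) \<le> k" "w' = (\<Sum>b\<in>B. ev x (p' b) * b)"
      using W_E[OF \<open>w \<in> W k\<close>] W_E[OF \<open>w' \<in> W k\<close>] by blast
    have "w + w' = (\<Sum>b\<in>B. ev x (p b + p' b) * b)"
      by (simp add: p(2,4) sum.distrib distrib_right)
    also have "\<dots> \<in> W k" by (rule W_I) (use p in \<open>auto intro: degree_add_le\<close>)
    finally show ?thesis .
  qed
  have W_sum: "sum f A \<in> W k" if "\<And>a. a \<in> A \<Longrightarrow> f a \<in> W k" for f :: "'k \<Rightarrow> 'k" and A k
    using that by (induction A rule: infinite_finite_induct) (auto intro: W_0 W_add)
  have W_mult: "ev x s * w \<in> W (k + degree s)" if "w \<in> W k" for w s k
  proof -
    obtain p where p: "\<forall>b\<in>B. degree (p b) \<le> k" "w = (\<Sum>b\<in>B. ev x (p b) * b)"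
      using W_E[OF \<open>w \<in> W k\<close>] by blast
    have "ev x s * w = (\<Sum>b\<in>B. ev x (s * p b) * b)"
      by (simp add: p(2) sum_distrib_left algebra_simps)
    also have "\<dots> \<in> W (k + degree s)"
      by (rule W_I) (use p in \<open>auto intro!: order_trans[OF degree_mult_le]\<close>)
    finally show ?thesis .
  qed
  have denom1: "\<exists>s k. s \<noteq> 0 \<and> ev x s * y \<in> W k" for y
  proof -
    obtain c where c: "\<forall>b\<in>B. c b \<in> rational_subfield emb x" "y = (\<Sum>b\<in>B. c b * b)"
      using span by blast
    have "\<forall>b\<in>B. \<exists>a d. d \<noteq> 0 \<and> c b = ev x a / ev x d"
      using c(1) unfolding rational_subfield_def ev_def by blast
    then obtain a d where ad: "\<And>b. b \<in> B \<Longrightarrow> d b \<noteq> 0 \<and> c b = ev x (a b) / ev x (d b)" by metis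
    define s where "s = prod d B"
    define p where "p b = a b * prod d (B - {b})" for b
    have "ev x s * c b = ev x (p b)" if "b \<in> B" for b
    proof -
      have "ev x s = ev x (d b) * ev x (prod d (B - {b}))"
        using that B by (simp add: s_def prod.remove)
      then show ?thesis using ad[OF that] inj[of "d b"] by (simp add: p_def field_simps)
    qed
    then have "ev x s * y = (\<Sum>b\<in>B. ev x (p b) * b)"
      by (simp add: c(2) sum_distrib_left mult.assoc[symmetric])
    also have "\<dots> \<in> W (\<Sum>b\<in>B. degree (p b))"
      by (rule W_I) (use B in \<open>auto intro!: member_le_sum\<close>)
    finally show ?thesis using ad B by (intro exI[of _ s] exI) (auto simp: s_def)
  qed
  have denom: "\<exists>s k. s \<noteq> 0 \<and> (\<forall>y\<in>Y. ev x s * y \<in> W k)" if "finite Y" for Y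
    using that
  proof (induction Y)
    case (insert y Y)
    obtain s k s' k' where s: "s \<noteq> 0" "\<forall>y\<in>Y. ev x s * y \<in> W k" "s' \<noteq> 0" "ev x s' * y \<in> W k'"
      using insert.IH denom1 by blast
    have "ev x (s * s') * u \<in> W (k + degree s' + (k' + degree s))" if "u \<in> insert y Y" for u
      using that
    proof
      assume "u = y"
      then have "ev x (s * s') * u = ev x s * (ev x s' * y)" by (simp only: ev_mult mult.assoc)
      also have "\<dots> \<in> W (k + degree s' + (k' + degree s))"
        by (rule W_mono[OF W_mult[OF s(4)]]) simp
      finally show ?thesis .
    next
      assume "u \<in> Y"
      have "ev x (s * s') * u = ev x s' * (ev x s * u)" by (simp only: ev_mult mult_ac)
      also have "\<dots> \<in> W (k + degree s' + (k' + degree s))"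
        by (rule W_mono[OF W_mult[OF s(2)[rule_format, OF \<open>u \<in> Y\<close>]]]) simp
      finally show ?thesis .
    qed
    moreover have "s * s' \<noteq> 0" using s by simp
    ultimately show ?case by blast
  qed (auto intro: exI[of _ 1])
  \<comment> \<open>\<open>s\<close> clears the denominators of multiplication by \<open>z\<close>
    on the generators: each application of \<open>ev x s * z\<close> raises the degree bound by the
    same \<open>k\<close>.\<close>
  obtain s k where s: "s \<noteq> 0" "\<forall>y\<in>(*) z ` B. ev x s * y \<in> W k"
    using denom[of "(*) z ` B"] B by auto
  have W_z: "ev x s * z * w \<in> W (j + k)" if "w \<in> W j" for w j
  proof -
    obtain p where p: "\<forall>b\<in>B. degree (p b) \<le> j" "w = (\<Sum>b\<in>B. ev x (p b) * b)"
      using W_E[OF \<open>w \<in> W j\<close>] by blast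
    have "ev x s * z * w = (\<Sum>b\<in>B. ev x (p b) * (ev x s * (z * b)))"
      by (simp add: p(2) sum_distrib_left algebra_simps)
    also have "\<dots> \<in> W (j + k)"
      by (rule W_sum, rule W_mono[OF W_mult[of _ k]]) (use p s in auto)
    finally show ?thesis .
  qed
  have W_zpow: "(ev x s * z) ^ i * w \<in> W (j + i * k)" if "w \<in> W j" for w i j
  proof (induction i)
    case (Suc i)
    have "(ev x s * z) ^ Suc i * w = ev x s * z * ((ev x s * z) ^ i * w)"
      by (simp only: power_Suc mult.assoc)
    then show ?case using W_z[OF Suc] by (simp only: mult_Suc add_ac)
  qed (use that in simp)
  \<comment> \<open>Cost per power of \<open>z\<close>: multiplication by
    \<open>ev x s ^ J * z ^ i\<close> with \<open>i \<le> J\<close> raises the degree bound by at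
    most \<open>J * c\<close>.\<close>
  define c where "c = k + degree s"
  have "card Y \<le> c * card B" if Y: "indep_over z Y" for Y
  proof (rule ccontr)
    assume "\<not> card Y \<le> c * card B"
    have finY: "finite Y" using Y by (simp add: indep_over_def)
    obtain s' k' where s': "s' \<noteq> 0" "\<forall>y\<in>Y. ev x s' * y \<in> W k'" using denom[OF finY] by blast
    have main: "(J + 1) * card Y \<le> (k' + J * c + 1) * card B" for J
    proof -
      define \<Theta> where "\<Theta> P = ev x s ^ J * ev x s' * (\<Sum>y\<in>Y. ev z (P y) * y)" for P
      let ?D = "Y \<rightarrow>\<^sub>E {p :: 'f poly. degree p \<le> J}"
      have "inj_on \<Theta> ?D"
      proof (rule inj_onI)
        fix P Q assume P: "P \<in> ?D" and Q: "Q \<in> ?D" and "\<Theta> P = \<Theta> Q"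
        then have "(\<Sum>y\<in>Y. ev z (P y) * y) = (\<Sum>y\<in>Y. ev z (Q y) * y)"
          using inj[OF s(1)] inj[OF s'(1)] by (simp add: \<Theta>_def)
        then have "(\<Sum>y\<in>Y. ev z (P y - Q y) * y) = 0"
          by (simp add: left_diff_distrib sum_subtractf)
        then have "P y = Q y" if "y \<in> Y" for y
          using indep_overD[OF Y _ that, of "\<lambda>y. P y - Q y"] by simp
        then show "P = Q" using P Q by (intro PiE_ext)
      qed
      moreover have "\<Theta> ` ?D \<subseteq> W (k' + J * c)"
      proof clarify
        fix P assume P: "P \<in> ?D"
        have step: "ev x s ^ J * (z ^ i * w) \<in> W (k' + J * c)" if "i \<le> J" "w \<in> W k'" for i w
        proof -
          have "ev x s ^ J * (z ^ i * w) = ev x (s ^ (J - i)) * ((ev x s * z) ^ i * w)"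
            using that(1) by (simp add: power_mult_distrib power_add[symmetric] mult.assoc[symmetric])
          also have "\<dots> \<in> W (k' + i * k + degree (s ^ (J - i)))"
            by (intro W_mult W_zpow that)
          finally show ?thesis
          proof (rule W_mono)
            have "degree (s ^ (J - i)) \<le> J * degree s"
              using degree_power_le[of s "J - i"]
              by (metis diff_le_self mult.commute mult_le_mono1 order_trans)
            moreover have "i * k \<le> J * k" using that(1) by (rule mult_le_mono1)
            ultimately show "k' + i * k + degree (s ^ (J - i)) \<le> k' + J * c"
              unfolding c_def add_mult_distrib2 by linarith
          qed
        qed
        have W_const: "emb a * w \<in> W j" if "w \<in> W j" for a w j
          using W_mult[OF that, of "[:a:]"] by simp
        have "\<Theta> P = (\<Sum>y\<in>Y. \<Sum>i\<le>J. emb (coeff (P y) i) * (ev x s ^ J * (z ^ i * (ev x s' * y))))"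
        proof -
          have "ev z (P y) = (\<Sum>i\<le>J. emb (coeff (P y) i) * z ^ i)" if "y \<in> Y" for y
          proof -
            have "P y = (\<Sum>i\<le>J. monom (coeff (P y) i) i)"
              using P that by (intro poly_as_sum_of_monoms'[symmetric]) auto
            then have "ev z (P y) = ev z (\<Sum>i\<le>J. monom (coeff (P y) i) i)" by simp
            then show ?thesis by (simp add: ev_sum)
          qed
          then show ?thesis
            by (simp add: \<Theta>_def sum_distrib_left sum_distrib_right mult_ac)
        qed
        also have "\<dots> \<in> W (k' + J * c)"
        proof (intro W_sum)
          fix y assume y: "y \<in> Y"
          have "(\<Sum>i\<in>A. emb (coeff (P y) i) * (ev x s ^ J * (z ^ i * (ev x s' * y)))) \<in> W (k' + J * c)"
            if "A \<subseteq> {..J}" for A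
            using finite_subset[OF that] that
            by (induction A) (auto intro!: W_0 W_add W_const step s'(2)[rule_format] y)
          then show "(\<Sum>i\<le>J. emb (coeff (P y) i) * (ev x s ^ J * (z ^ i * (ev x s' * y)))) \<in> W (k' + J * c)"
            by blast
        qed
        finally show "\<Theta> P \<in> W (k' + J * c)" .
      qed
      ultimately have "card ?D \<le> card (W (k' + J * c))"
        using W_fin by (rule card_inj_on_le)
      also have "\<dots> \<le> q ^ ((k' + J * c + 1) * card B)" by (rule W_card)
      finally have "q ^ ((J + 1) * card Y) \<le> q ^ ((k' + J * c + 1) * card B)"
        using finY by (simp only: card_PiE card_polys_degree_le prod_constant power_mult CARD_eq_q)
      then show ?thesis using q_ge_2 by (simp add: power_increasing_iff)
    qed
    have "(J + 1) * (c * card B + 1) \<le> (k' + J * c + 1) * card B" for J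
    proof -
      have "(J + 1) * (c * card B + 1) \<le> (J + 1) * card Y"
        by (rule mult_le_mono2) (use \<open>\<not> card Y \<le> c * card B\<close> in simp)
      then show ?thesis using main[of J] by linarith
    qed
    \<comment> \<open>As functions of \<open>J\<close> the left side has slope
      \<open>c * card B + 1\<close> and the right side \<open>c * card B\<close>; this
      \<open>J\<close> outweighs the constant terms.\<close>
    from this[of "(k' + 1) * card B"] show False by (simp add: algebra_simps)
  qed
  then show ?thesis by blast
qed

section \<open>Existence of places\<close>

definition is_subring :: "'k set \<Rightarrow> bool" where
  "is_subring R \<longleftrightarrow> range emb \<subseteq> R \<and> (\<forall>x\<in>R. \<forall>y\<in>R. x + y \<in> R \<and> x * y \<in> R)"

lemma subringD:
  assumes "is_subring R"
  shows "emb c \<in> R" "0 \<in> R" "1 \<in> R" "x \<in> R \<Longrightarrow> y \<in> R \<Longrightarrow> x + y \<in> R"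
    "x \<in> R \<Longrightarrow> y \<in> R \<Longrightarrow> x * y \<in> R" "x \<in> R \<Longrightarrow> - x \<in> R" "x \<in> R \<Longrightarrow> y \<in> R \<Longrightarrow> x - y \<in> R"
proof -
  have c: "emb c \<in> R" for c using assms by (auto simp: is_subring_def)
  show "0 \<in> R" "1 \<in> R" using c[of 0] c[of 1] by simp_all
  show a: "x \<in> R \<Longrightarrow> y \<in> R \<Longrightarrow> x + y \<in> R" and mu: "x \<in> R \<Longrightarrow> y \<in> R \<Longrightarrow> x * y \<in> R" for x y
    using assms by (auto simp: is_subring_def)
  show m: "- x \<in> R" if "x \<in> R" for x
  proof -
    have "emb (- 1) * x \<in> R" by (intro mu c that)
    then show ?thesis by (simp add: emb_uminus)
  qed
  show "x \<in> R \<Longrightarrow> y \<in> R \<Longrightarrow> x - y \<in> R" using a[of x "- y"] m[of y] by simp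
qed (use assms in \<open>auto simp: is_subring_def\<close>)

lemma subring_sum: "is_subring R \<Longrightarrow> (\<And>i. i \<in> A \<Longrightarrow> h i \<in> R) \<Longrightarrow> sum h A \<in> R"
  by (induction A rule: infinite_finite_induct) (auto intro: subringD)

lemma subring_power: "is_subring R \<Longrightarrow> x \<in> R \<Longrightarrow> x ^ n \<in> R"
  by (induction n) (auto intro: subringD)

lemma subring_adjoin:
  assumes R: "is_subring R"
  shows "is_subring {poly p z | p. \<forall>i. coeff p i \<in> R}" (is "is_subring ?S")
  unfolding is_subring_def
proof (intro conjI ballI subsetI)
  show "y \<in> ?S" if "y \<in> range emb" for y
    using that R by (auto intro!: exI[of _ "[:y:]"] simp: coeff_pCons split: nat.split intro: subringD)
next
  fix x y assume "x \<in> ?S" "y \<in> ?S"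
  then obtain p r where p: "\<forall>i. coeff p i \<in> R" "x = poly p z" and r: "\<forall>i. coeff r i \<in> R" "y = poly r z"
    by blast
  show "x + y \<in> ?S"
    using p r by (auto intro!: exI[of _ "p + r"] subringD[OF R])
  show "x * y \<in> ?S"
    using p r by (auto intro!: exI[of _ "p * r"] subringD[OF R] subring_sum[OF R] simp: coeff_mult)
qed

text \<open>Chevalley's argument: a subring maximal (by Zorn) among those that contain
  \<open>f\<close> but not \<open>inverse f\<close> is a valuation ring. If \<open>z\<close> and
  \<open>inverse z\<close> both lay outside, adjoining either one would invert \<open>f\<close>. The
  two resulting relations can be shortened against each other without end, which is
  impossible.\<close>

lemma exists_valuation_subring:
  assumes tr: "\<not> algebraic_over emb f"
  shows "\<exists>R. is_subring R \<and> f \<in> R \<and> inverse f \<notin> R \<and> (\<forall>z. z \<in> R \<or> inverse z \<in> R)"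
proof -
  let ?C = "{R. is_subring R \<and> f \<in> R \<and> inverse f \<notin> R}"
  have f0: "f \<noteq> 0" using tr by (rule not_algebraic_nonzero)
  have "\<exists>M\<in>?C. \<forall>Xs\<in>?C. M \<subseteq> Xs \<longrightarrow> Xs = M"
  proof (rule subset_Zorn_nonempty)
    have "is_subring (range (ev f))"
      unfolding is_subring_def
    proof (intro conjI ballI subsetI)
      show "y \<in> range (ev f)" if "y \<in> range emb" for y
      proof -
        obtain c where "y = emb c" using \<open>y \<in> range emb\<close> by blast
        then have "y = ev f [:c:]" by simp
        then show ?thesis by blast
      qed
    qed (auto simp flip: ev_add ev_mult)
    moreover have "f \<in> range (ev f)" by (rule range_eqI[of _ _ "[:0, 1:]"]) simp
    moreover have "inverse f \<notin> range (ev f)"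
    proof
      assume "inverse f \<in> range (ev f)"
      then obtain p where p: "inverse f = ev f p" by blast
      have "f * ev f p = 1" using f0 unfolding p[symmetric] by simp
      then have "ev f (pCons (- 1) p) = 0" by (simp add: emb_uminus)
      then have "pCons (- 1) p = 0" using tr unfolding algebraic_iff by blast
      then show False by simp
    qed
    ultimately show "?C \<noteq> {}" by blast
  next
    fix Ch assume ne: "Ch \<noteq> {}" and ch: "subset.chain ?C Ch"
    then obtain R0 where "R0 \<in> Ch" by blast
    have sub: "R \<in> ?C" if "R \<in> Ch" for R using ch that by (auto simp: subset.chain_def)
    have "is_subring (\<Union>Ch)"
      unfolding is_subring_def
    proof (intro conjI ballI)
      show "range emb \<subseteq> \<Union>Ch" using sub[OF \<open>R0 \<in> Ch\<close>] \<open>R0 \<in> Ch\<close> by (auto simp: is_subring_def)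
      fix x y assume "x \<in> \<Union>Ch" "y \<in> \<Union>Ch"
      then obtain R R' where R: "R \<in> Ch" "R' \<in> Ch" "x \<in> R" "y \<in> R'" by blast
      then consider "R \<subseteq> R'" | "R' \<subseteq> R" using ch by (auto simp: subset.chain_def)
      then have "\<exists>R\<in>Ch. x \<in> R \<and> y \<in> R" using R by cases auto
      then obtain R where "R \<in> Ch" "x \<in> R" "y \<in> R" by blast
      moreover from this have "is_subring R" using sub by blast
      ultimately show "x + y \<in> \<Union>Ch" "x * y \<in> \<Union>Ch" using subringD(4,5) by blast+
    qed
    then show "\<Union>Ch \<in> ?C" using sub \<open>R0 \<in> Ch\<close> by blast
  qed
  then obtain R where "R \<in> ?C" and max: "\<And>Xs. Xs \<in> ?C \<Longrightarrow> R \<subseteq> Xs \<Longrightarrow> Xs = R" by blast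
  then have R: "is_subring R" "f \<in> R" "inverse f \<notin> R" by auto
  \<comment> \<open>\<open>G z n\<close>: the inverse of \<open>f\<close> is a polynomial in
    \<open>z\<close> over \<open>R\<close> of degree at most \<open>n\<close>.\<close>
  define G where "G z n \<longleftrightarrow> (\<exists>p. (\<forall>i. coeff p i \<in> R) \<and> degree p \<le> n \<and> f * poly p z = 1)" for z n
  have G_ex: "\<exists>n. G z n" if "z \<notin> R" for z
  proof -
    let ?S = "{poly p z | p. \<forall>i. coeff p i \<in> R}"
    have "R \<subseteq> ?S"
      using R(1) by (auto intro!: exI[of _ "[:_:]"] simp: coeff_pCons split: nat.split intro: subringD)
    moreover have "z \<in> ?S"
      using R(1) by (auto intro!: exI[of _ "[:0, 1:]"] simp: coeff_pCons split: nat.split intro: subringD)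
    ultimately have "?S \<notin> ?C" using max that by blast
    then have "inverse f \<in> ?S" using subring_adjoin[OF R(1)] \<open>R \<subseteq> ?S\<close> R(2) by blast
    then obtain p where p: "\<forall>i. coeff p i \<in> R" "inverse f = poly p z" by blast
    have "f * poly p z = 1" using f0 unfolding p(2)[symmetric] by simp
    then show ?thesis using p unfolding G_def by blast
  qed
  have G_0: "\<not> G z 0" for z
  proof
    assume "G z 0"
    then obtain p where p: "\<forall>i. coeff p i \<in> R" "degree p = 0" "f * poly p z = 1" unfolding G_def by auto
    then have "f * coeff p 0 = 1" by (auto elim: degree_eq_zeroE)
    then have "inverse f = coeff p 0" by (rule inverse_unique)
    then show False using p(1) R(3) by auto
  qed
  have G_step: "G z n" if z: "z \<noteq> 0" and "G z (Suc n)" "G (inverse z) m" "m \<le> Suc n" for z n m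
  proof -
    obtain p where p: "\<forall>i. coeff p i \<in> R" "degree p \<le> Suc n" "f * poly p z = 1"
      using \<open>G z (Suc n)\<close> unfolding G_def by blast
    obtain r where r: "\<forall>i. coeff r i \<in> R" "degree r \<le> m" "f * poly r (inverse z) = 1"
      using \<open>G (inverse z) m\<close> unfolding G_def by blast
    define a where "a = coeff p (Suc n)"
    define b where "b = coeff r 0"
    define p1 where "p1 = p - monom a (Suc n)"
    define r1 where "r1 = (\<Sum>j=1..m. monom (coeff r j) (Suc n - j))"
    have p1: "poly p1 z = poly p z - a * z ^ Suc n" by (simp add: p1_def poly_monom)
    have "poly r (inverse z) = (\<Sum>j\<le>m. coeff r j * inverse z ^ j)"
    proof -
      have "poly r (inverse z) = poly (\<Sum>j\<le>m. monom (coeff r j) j) (inverse z)"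
        using poly_as_sum_of_monoms'[OF r(2)] by simp
      then show ?thesis by (simp add: poly_sum poly_monom)
    qed
    also have "\<dots> = b + (\<Sum>j=1..m. coeff r j * inverse z ^ j)"
      by (simp add: b_def atMost_atLeast0 sum.atLeast_Suc_atMost)
    finally have "z ^ Suc n * (poly r (inverse z) - b) = (\<Sum>j=1..m. z ^ Suc n * (coeff r j * inverse z ^ j))"
      by (simp add: sum_distrib_left)
    also have "\<dots> = poly r1 z"
      unfolding r1_def poly_sum
    proof (rule sum.cong)
      fix j assume "j \<in> {1..m}"
      then have "z ^ Suc n = z ^ (Suc n - j) * z ^ j"
        using \<open>m \<le> Suc n\<close> by (simp add: power_add[symmetric] del: power_Suc)
      then show "z ^ Suc n * (coeff r j * inverse z ^ j) = poly (monom (coeff r j) (Suc n - j)) z"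
        using z by (simp add: poly_monom power_inverse field_simps del: power_Suc)
    qed simp
    finally have r1: "poly r1 z = z ^ Suc n * (poly r (inverse z) - b)" ..
    \<comment> \<open>From \<open>f * r(1/z) = 1\<close> follows
      \<open>(1 - f * b) * z ^ Suc n = f * r1(z)\<close>. So after multiplying \<open>p\<close> by
      \<open>1 - f * b\<close> its top term can be replaced by \<open>f * a * r1\<close>, of lower
      degree, and adding \<open>b\<close> restores the value 1.\<close>
    define p' where "p' = [:b:] + smult (1 - f * b) p1 + smult (f * a) r1"
    have "f * poly p' z = f * b + (1 - f * b) * (f * poly p z - f * a * z ^ Suc n)
        + f * a * z ^ Suc n * (f * poly r (inverse z) - f * b)"
      by (simp add: p'_def p1 r1 algebra_simps)
    also have "\<dots> = 1" unfolding p(3) r(3) by (simp add: algebra_simps)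
    finally have "f * poly p' z = 1" .
    moreover have "degree p' \<le> n"
    proof -
      have "degree p1 \<le> n"
      proof (rule degree_le, intro allI impI)
        fix i assume "n < i"
        then show "coeff p1 i = 0" using p(2) by (cases "i = Suc n") (auto simp: p1_def a_def coeff_eq_0)
      qed
      moreover have "degree r1 \<le> n"
        unfolding r1_def by (rule degree_sum_le) (auto intro!: order_trans[OF degree_monom_le])
      ultimately show ?thesis
        unfolding p'_def by (intro degree_add_le order_trans[OF degree_smult_le]) auto
    qed
    moreover have "coeff p' i \<in> R" for i
    proof -
      have ab: "a \<in> R" "b \<in> R" using p(1) r(1) by (auto simp: a_def b_def)
      have "coeff p1 i \<in> R" using p(1) ab subringD[OF R(1)] by (auto simp: p1_def)
      moreover have "coeff r1 i \<in> R"
        using r(1) subringD(2)[OF R(1)] by (auto simp: r1_def coeff_sum intro!: subring_sum[OF R(1)])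
      moreover have "coeff [:b:] i \<in> R" using ab subringD[OF R(1)] by (auto simp: coeff_pCons split: nat.split)
      ultimately show ?thesis
        using ab R(2) unfolding p'_def coeff_add coeff_smult by (intro subringD[OF R(1)])
    qed
    ultimately show ?thesis unfolding G_def by blast
  qed
  have G_False: "\<not> (G z n \<and> G (inverse z) m)" if "z \<noteq> 0" for z n m
    using that
  proof (induction "n + m" arbitrary: n m z rule: less_induct)
    case less
    show ?case
    proof
      assume G: "G z n \<and> G (inverse z) m"
      show False
      proof (cases "m \<le> n")
        case True
        with G G_0 obtain n' where n': "n = Suc n'" by (metis old.nat.exhaust)
        then have "G z n'" using G_step[OF less.prems, of n' m] G True by simp
        then show False using less.hyps[of n' m z] G less.prems n' by simp
      next
        case False
        with G G_0 obtain m' where m': "m = Suc m'" by (metis old.nat.exhaust)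
        then have "G (inverse z) m'" using G_step[of "inverse z" m' n] less.prems G False by simp
        then show False using less.hyps[of n m' z] G less.prems m' by simp
      qed
    qed
  qed
  have "z \<in> R \<or> inverse z \<in> R" for z
    using G_ex[of z] G_ex[of "inverse z"] G_False[of z] subringD(2)[OF R(1)] by (cases "z = 0") auto
  then show ?thesis using R by blast
qed

text \<open>Chains of elements of the ideal \<open>P\<close> of non-units whose successive quotients
  lie in \<open>P\<close> are independent over the rational subfield of their first element, hence
  of bounded length. So \<open>P\<close> has a generator \<open>t\<close>, every nonzero element is
  a unit times a power of \<open>t\<close>, and the exponent is the place.\<close>

lemma place_of_valuation_subring:
  assumes R: "is_subring R" and val: "\<And>z. z \<in> R \<or> inverse z \<in> R" and proper: "f \<notin> R"
  shows "\<exists>v\<in>places emb. \<forall>x. x \<noteq> 0 \<longrightarrow> (0 \<le> v x \<longleftrightarrow> x \<in> R)"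
proof -
  define P where "P = {x. x = 0 \<or> inverse x \<notin> R}"
  have PR: "x \<in> R" if "x \<in> P" for x
    using that val[of x] subringD(2)[OF R] by (auto simp: P_def)
  have P_mult: "a * x \<in> P" if "a \<in> R" "x \<in> P" for a x
  proof (rule ccontr)
    assume "a * x \<notin> P"
    then have "a * x \<noteq> 0" "inverse (a * x) \<in> R" by (auto simp: P_def)
    then have "a * inverse (a * x) \<in> R" using that by (intro subringD[OF R])
    moreover have "a * inverse (a * x) = inverse x" using \<open>a * x \<noteq> 0\<close> by simp
    ultimately have "inverse x \<in> R" by metis
    then show False using that(2) \<open>a * x \<noteq> 0\<close> by (auto simp: P_def)
  qed
  have P_add: "x + y \<in> P" if "x \<in> P" "y \<in> P" for x y
  proof (cases "x = 0 \<or> y = 0")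
    case False
    have *: "u + w \<in> P" if "u / w \<in> R" "w \<in> P" "w \<noteq> 0" for u w
    proof -
      have "(u / w + 1) * w \<in> P" by (intro P_mult subringD[OF R] that)
      moreover have "(u / w + 1) * w = u + w" using that by (simp add: distrib_right)
      ultimately show ?thesis by metis
    qed
    show ?thesis using val[of "x / y"] *[of x y] *[of y x] False that by (auto simp: add.commute)
  qed (use that in auto)
  have P_0: "0 \<in> P" by (simp add: P_def)
  have P_sum: "sum h A \<in> P" if "\<And>i. i \<in> A \<Longrightarrow> h i \<in> P" for h :: "nat \<Rightarrow> 'k" and A
    using that by (induction A rule: infinite_finite_induct) (auto intro: P_add P_0)
  have P_const: "c = 0" if "emb c \<in> P" for c
    using that subringD(1)[OF R, of "inverse c"] by (auto simp: P_def emb_inverse)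
  have P_1: "1 \<notin> P" using P_const[of 1] by auto

  have chain: "card (x ` {..<n}) = n \<and> indep_over (x 0) (x ` {..<n})"
    if x: "\<And>i. i < n \<Longrightarrow> x i \<in> P \<and> x i \<noteq> 0" "\<And>i. Suc i < n \<Longrightarrow> x i / x (Suc i) \<in> P" for x n
  proof -
    have quot: "x i / x j \<in> P" if "i < j" "j < n" for i j
      using that
    proof (induction j)
      case (Suc j)
      show ?case
      proof (cases "i = j")
        case False
        then have "(x i / x j) * (x j / x (Suc j)) \<in> P" using Suc x(2) by (intro P_mult PR) auto
        then show ?thesis using x(1)[of j] Suc.prems by simp
      qed (use Suc x(2) in auto)
    qed simp
    have inj: "inj_on x {..<n}"
    proof (rule inj_onI, rule ccontr)
      fix i j assume ij: "i \<in> {..<n}" "j \<in> {..<n}" "x i = x j" "i \<noteq> j"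
      then consider "i < j" | "j < i" by linarith
      then show False by cases (use quot[of i j] quot[of j i] x(1)[of j] P_1 ij in auto)
    qed
    have c0: "coeff (\<phi> i) 0 = 0" if "(\<Sum>i<n. ev (x 0) (\<phi> i) * x i) = 0" "i < n" for \<phi> i
    proof (rule ccontr)
      assume "coeff (\<phi> i) 0 \<noteq> 0"
      \<comment> \<open>The last term with nonzero constant coefficient. After division by
        \<open>x j\<close>, the terms before it lie in \<open>P\<close> by the chain condition and
        those after it because they carry a factor \<open>x 0\<close>; so this term lies in
        \<open>P\<close> too, although its constant coefficient is a unit.\<close>
      define j where "j = Max {i. i < n \<and> coeff (\<phi> i) 0 \<noteq> 0}"
      have fin: "finite {i. i < n \<and> coeff (\<phi> i) 0 \<noteq> 0}" by simp
      then have "j \<in> {i. i < n \<and> coeff (\<phi> i) 0 \<noteq> 0}"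
        unfolding j_def using that(2) \<open>coeff (\<phi> i) 0 \<noteq> 0\<close> by (intro Max_in) auto
      then have j: "j < n" "coeff (\<phi> j) 0 \<noteq> 0" by auto
      have above: "coeff (\<phi> i) 0 = 0" if "j < i" "i < n" for i
        using Max_ge[OF fin, of i] that by (auto simp: j_def[symmetric])
      have x0: "x 0 \<in> P" "x 0 \<noteq> 0" "x j \<noteq> 0" using x(1)[of 0] x(1)[of j] j by auto
      have evR: "ev (x 0) p \<in> R" for p
        using PR[OF x0(1)] by (induction p) (auto intro: subringD[OF R])
      have ev_split: "ev (x 0) p = emb (coeff p 0) + x 0 * ev (x 0) (poly_shift 1 p)" for p
      proof -
        have "p = pCons (coeff p 0) (poly_shift 1 p)"
          by (auto simp: poly_eq_iff coeff_pCons coeff_poly_shift split: nat.split)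
        then have "ev (x 0) p = ev (x 0) (pCons (coeff p 0) (poly_shift 1 p))" by (rule arg_cong)
        then show ?thesis by (simp only: ev_pCons)
      qed
      have "ev (x 0) (\<phi> i) * (x i / x j) \<in> P" if i: "i < n" "i \<noteq> j" for i
      proof (cases "i < j")
        case True
        then show ?thesis by (intro P_mult evR quot j)
      next
        case False
        then have "ev (x 0) (\<phi> i) * (x i / x j) = (x 0 / x j * ev (x 0) (poly_shift 1 (\<phi> i))) * x i"
          using above[of i] i by (subst ev_split) simp
        also have "\<dots> \<in> P"
        proof (intro P_mult subringD[OF R] evR)
          show "x 0 / x j \<in> R" using quot[of 0 j] j x0 PR subringD(3)[OF R] by (cases "j = 0") auto
        qed (use x i in auto)
        finally show ?thesis .
      qed
      then have "(\<Sum>i\<in>{..<n} - {j}. ev (x 0) (\<phi> i) * (x i / x j)) \<in> P" by (intro P_sum) auto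
      moreover have "(\<Sum>i<n. ev (x 0) (\<phi> i) * (x i / x j)) = 0"
        using that(1) by (simp flip: sum_divide_distrib)
      then have "ev (x 0) (\<phi> j) = - (\<Sum>i\<in>{..<n} - {j}. ev (x 0) (\<phi> i) * (x i / x j))"
        using j x0 by (simp add: sum.remove[of _ j] eq_neg_iff_add_eq_0)
      moreover have "- y \<in> P" if "y \<in> P" for y
        using P_mult[OF subringD(6)[OF R subringD(3)[OF R]] that] by simp
      ultimately have "ev (x 0) (\<phi> j) \<in> P" by simp
      then have "ev (x 0) (\<phi> j) + (- ev (x 0) (poly_shift 1 (\<phi> j))) * x 0 \<in> P"
        by (intro P_add P_mult subringD[OF R] evR x0)
      then have "emb (coeff (\<phi> j) 0) \<in> P" by (subst (asm) ev_split) simp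
      then show False using P_const j by blast
    qed
    have "indep_over (x 0) (x ` {..<n})"
    proof (cases "n = 0")
      case False
      show ?thesis
      proof (rule indep_overI)
        fix p assume "(\<Sum>y\<in>x ` {..<n}. ev (x 0) (p y) * y) = 0"
        then have "(\<Sum>i<n. ev (x 0) (p (x i)) * x i) = 0" by (simp add: sum.reindex[OF inj])
        then show "\<forall>y\<in>x ` {..<n}. coeff (p y) 0 = 0" using c0[of "\<lambda>i. p (x i)"] by auto
      qed (use x(1)[of 0] False in auto)
    qed (simp add: indep_over_def)
    then show ?thesis using card_image[OF inj] by simp
  qed
  \<comment> \<open>The bound depends only on the first element of the chain.\<close>
  define N where "N z = (SOME N. \<forall>Y. indep_over z Y \<longrightarrow> card Y \<le> N)" for z
  have N: "n \<le> N (x 0)"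
    if x: "\<And>i. i < n \<Longrightarrow> x i \<in> P \<and> x i \<noteq> 0" "\<And>i. Suc i < n \<Longrightarrow> x i / x (Suc i) \<in> P" for x n
  proof -
    have "\<forall>Y. indep_over (x 0) Y \<longrightarrow> card Y \<le> N (x 0)"
      unfolding N_def by (rule someI_ex[OF indep_over_bounded])
    moreover have "card (x ` {..<n}) = n \<and> indep_over (x 0) (x ` {..<n})" by (rule chain) (use x in auto)
    ultimately show ?thesis by auto
  qed
  define z where "z = inverse f"
  have z: "z \<in> P" "z \<noteq> 0" using proper subringD(2)[OF R] by (auto simp: z_def P_def)
  \<comment> \<open>If no element of \<open>P\<close> divides all others, each \<open>t\<close> has
    some \<open>h t\<close> in \<open>P\<close> that it does not divide; then \<open>t / h t\<close>
    is in \<open>P\<close>, and iterating \<open>h\<close> gives chains of any length from the same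
    start.\<close>
  have "\<exists>t\<in>P - {0}. \<forall>y\<in>P. y / t \<in> R"
  proof (rule ccontr)
    assume "\<not> ?thesis"
    then have "\<forall>t\<in>P - {0}. \<exists>y. y \<in> P \<and> y / t \<notin> R" by auto
    then obtain h where h: "\<And>t. t \<in> P - {0} \<Longrightarrow> h t \<in> P \<and> h t / t \<notin> R" by metis
    define x where "x i = (h ^^ i) z" for i
    have h': "h t \<in> P - {0} \<and> t / h t \<in> P" if "t \<in> P - {0}" for t
      using h[OF that] that subringD(2)[OF R] by (auto simp: P_def)
    have "x i \<in> P - {0}" for i using z h' by (induction i) (auto simp: x_def)
    then have "Suc (N (x 0)) \<le> N (x 0)" using h' by (intro N) (auto simp: x_def)
    then show False by simp
  qed
  then obtain t where t: "t \<in> P" "t \<noteq> 0" "\<And>y. y \<in> P \<Longrightarrow> y / t \<in> R" by auto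
  define U where "U u \<longleftrightarrow> u \<noteq> 0 \<and> u \<in> R \<and> inverse u \<in> R" for u
  have U_iff: "U u \<longleftrightarrow> u \<in> R \<and> u \<notin> P" for u by (auto simp: U_def P_def)
  have U_mult: "U (a * b)" if "U a" "U b" for a b using that by (auto simp: U_def intro: subringD[OF R])
  have U_inv: "U (inverse a)" if "U a" for a using that by (auto simp: U_def)
  have ex_R: "\<exists>k::nat. U (x / t ^ k)" if x: "x \<in> R" "x \<noteq> 0" for x
  proof -
    have bnd: "k \<le> N x" if k: "x / t ^ k \<in> R" for k
    proof (cases "k = 0")
      case False
      \<comment> \<open>The chain \<open>x, t ^ (k - 1), ..., t\<close>: if \<open>t ^ k\<close>
        divides \<open>x\<close>, its length \<open>k\<close> is bounded in terms of
        \<open>x\<close>.\<close>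
      define c where "c i = (if i = 0 then x else t ^ (k - i))" for i
      have "k \<le> N (c 0)"
      proof (rule N)
        have tP: "t ^ m \<in> P" if "m > 0" for m
        proof -
          have "t ^ (m - 1) * t \<in> P" by (intro P_mult subring_power[OF R] PR t)
          then show ?thesis using that by (cases m) (auto simp: mult.commute)
        qed
        have xP: "(x / t ^ k) * t ^ k \<in> P" using k tP False by (intro P_mult) auto
        show "c i \<in> P \<and> c i \<noteq> 0" if "i < k" for i
          using that xP t tP x by (auto simp: c_def)
        show "c i / c (Suc i) \<in> P" if "Suc i < k" for i
        proof -
          have "c i / c (Suc i) = (if i = 0 then x / t ^ k else 1) * t"
          proof -
            have "t ^ (k - i) = t ^ (k - Suc i) * t" using that by (simp add: Suc_diff_Suc flip: power_Suc2)
            then show ?thesis using t by (auto simp: c_def)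
          qed
          moreover have "(if i = 0 then x / t ^ k else 1) * t \<in> P"
            using k t(1) subringD(3)[OF R] by (intro P_mult) auto
          ultimately show ?thesis by metis
        qed
      qed
      then show ?thesis by (simp add: c_def)
    qed simp
    define k where "k = (GREATEST k. x / t ^ k \<in> R)"
    have k: "x / t ^ k \<in> R"
      unfolding k_def by (rule GreatestI_nat[of _ 0 "N x"]) (use x bnd in auto)
    have "x / t ^ Suc k \<notin> R"
    proof
      assume "x / t ^ Suc k \<in> R"
      then have "Suc k \<le> k" unfolding k_def by (rule Greatest_le_nat[where b = "N x"]) (use bnd in auto)
      then show False by simp
    qed
    then have "x / t ^ k \<notin> P" using t(3)[of "x / t ^ k"] by (auto simp: mult.commute)
    then show ?thesis using k by (auto simp: U_iff)
  qed
  have ex: "\<exists>k. U (x / t powi k)" if x: "x \<noteq> 0" for x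
  proof (cases "x \<in> R")
    case True
    then obtain k where "U (x / t ^ k)" using ex_R x by blast
    then show ?thesis by (intro exI[of _ "int k"]) simp
  next
    case False
    then obtain k where "U (inverse x / t ^ k)" using ex_R[of "inverse x"] val[of x] x by auto
    from U_inv[OF this] show ?thesis
      by (intro exI[of _ "- int k"]) (simp add: power_int_minus field_simps)
  qed
  have powR: "t powi k \<in> R" if "k \<ge> 0" for k
    using that PR[OF t(1)] by (auto simp: power_int_def intro: subring_power[OF R])
  have powP: "t powi k \<in> P" if "k > 0" for k
  proof -
    have "t powi k = t powi (k - 1) * t" using t(2) by (simp add: power_int_minus_mult)
    then show ?thesis using P_mult[OF powR t(1), of "k - 1"] that by simp
  qed
  define v where "v x = (if x = 0 then 0 else SOME k. U (x / t powi k))" for x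
  have vU: "U (x / t powi (v x))" if "x \<noteq> 0" for x
    using someI_ex[OF ex[OF that]] that by (simp add: v_def)
  have v_ge: "k \<le> v x \<longleftrightarrow> x / t powi k \<in> R" if x: "x \<noteq> 0" for x k
  proof -
    have eq: "x / t powi k = (x / t powi v x) * t powi (v x - k)"
      using t(2) by (simp add: power_int_diff)
    show ?thesis
    proof
      assume "k \<le> v x"
      then show "x / t powi k \<in> R"
        unfolding eq using vU[OF x] by (intro subringD[OF R] powR) (auto simp: U_def)
    next
      assume R': "x / t powi k \<in> R"
      show "k \<le> v x"
      proof (rule ccontr)
        assume "\<not> k \<le> v x"
        then have "(x / t powi k) * t powi (k - v x) \<in> P" by (intro P_mult R' powP) simp
        moreover have "(x / t powi k) * t powi (k - v x) = x / t powi v x"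
          using t(2) by (simp add: power_int_diff)
        ultimately show False using vU[OF x] by (simp add: U_iff)
      qed
    qed
  qed
  have v_eq: "v x = k" if "x \<noteq> 0" "U (x / t powi k)" for x k
  proof (rule antisym)
    show "k \<le> v x" using v_ge that by (auto simp: U_def)
    have "\<not> k + 1 \<le> v x"
    proof
      assume "k + 1 \<le> v x"
      then have "x / t powi (k + 1) * t \<in> P" using v_ge[OF that(1)] t(1) by (intro P_mult) auto
      moreover have "x / t powi (k + 1) * t = x / t powi k" using t(2) by (simp add: power_int_add)
      ultimately show False using that by (simp add: U_iff)
    qed
    then show "v x \<le> k" by simp
  qed
  have "v \<in> places emb"
    unfolding places_def
  proof (intro CollectI conjI allI impI)
    show "v 0 = 0" by (simp add: v_def)
  next
    fix x y :: 'k assume "x \<noteq> 0" "y \<noteq> 0"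
    then have "U ((x / t powi v x) * (y / t powi v y))" by (intro U_mult vU)
    then show "v (x * y) = v x + v y"
      using \<open>x \<noteq> 0\<close> \<open>y \<noteq> 0\<close> t(2) by (intro v_eq) (auto simp: power_int_add)
  next
    fix x y :: 'k assume x: "x \<noteq> 0" and y: "y \<noteq> 0" and xy: "x + y \<noteq> 0"
    have "x / t powi min (v x) (v y) \<in> R" "y / t powi min (v x) (v y) \<in> R"
      using v_ge[OF x, symmetric] v_ge[OF y, symmetric] by auto
    then have "(x + y) / t powi min (v x) (v y) \<in> R"
      unfolding add_divide_distrib by (intro subringD[OF R])
    then show "min (v x) (v y) \<le> v (x + y)" using v_ge[OF xy] by blast
  next
    fix c :: 'f assume "c \<noteq> 0"
    then show "v (emb c) = 0"
      using subringD(1)[OF R] by (intro v_eq) (simp_all add: U_def flip: emb_inverse)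
  next
    have "v t = 1" using t(2) subringD(3)[OF R] by (intro v_eq) (simp_all add: U_def)
    then show "\<exists>x. x \<noteq> 0 \<and> v x = 1" using t(2) by (intro exI[of _ t]) simp
  qed
  moreover have "0 \<le> v x \<longleftrightarrow> x \<in> R" if "x \<noteq> 0" for x using v_ge[OF that, of 0] by simp
  ultimately show ?thesis by (intro bexI[of _ v] allI impI)
qed

section \<open>Rules of computation for places\<close>

lemma placeD:
  assumes "v \<in> places emb"
  shows "v 0 = 0" and "\<forall>x y. x \<noteq> 0 \<longrightarrow> y \<noteq> 0 \<longrightarrow> v (x * y) = v x + v y"
    and "\<forall>x y. x \<noteq> 0 \<longrightarrow> y \<noteq> 0 \<longrightarrow> x + y \<noteq> 0 \<longrightarrow> min (v x) (v y) \<le> v (x + y)"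
    and "\<forall>c. c \<noteq> 0 \<longrightarrow> v (emb c) = 0" and "\<exists>x. x \<noteq> 0 \<and> v x = 1"
  using assms unfolding places_def mem_Collect_eq by - (elim conjE, assumption)+

lemmas place_0 [simp] = placeD(1)
lemmas place_mult = placeD(2)[rule_format]
lemmas place_add = placeD(3)[rule_format]
lemmas place_uniformizer = placeD(5)

lemma place_emb [simp]: "v \<in> places emb \<Longrightarrow> v (emb c) = 0"
  by (cases "c = 0") (auto dest: placeD(1,4))

lemma exists_zero_place:
  assumes "\<not> algebraic_over emb f"
  shows "\<exists>v\<in>places emb. 0 < v f"
proof -
  obtain R where R: "is_subring R" "f \<in> R" "inverse f \<notin> R" "\<And>z. z \<in> R \<or> inverse z \<in> R"
    using exists_valuation_subring[OF assms] by blast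
  obtain v where v: "v \<in> places emb" "\<And>x. x \<noteq> 0 \<Longrightarrow> 0 \<le> v x \<longleftrightarrow> x \<in> R"
    using place_of_valuation_subring[OF R(1,4,3)] by blast
  have f0: "f \<noteq> 0" using R by auto
  have "v (f * inverse f) = v f + v (inverse f)" "v 1 = 0"
    using place_mult[OF v(1), of f "inverse f"] place_emb[OF v(1), of 1] f0 by simp_all
  then have "v f = - v (inverse f)" using f0 by simp
  moreover have "\<not> 0 \<le> v (inverse f)" using v(2)[of "inverse f"] f0 R(3) by simp
  ultimately show ?thesis using v(1) by (intro bexI[of _ v]) auto
qed

end

section \<open>Residue fields and approximation\<close>

definition add_subgroup :: "'a::ab_group_add set \<Rightarrow> bool" where
  "add_subgroup I \<longleftrightarrow> 0 \<in> I \<and> (\<forall>x\<in>I. \<forall>y\<in>I. x - y \<in> I)"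

text \<open>The quotient \<open>R / I\<close> as a bare set, since only its cardinality
  matters.\<close>

definition cosets :: "'a::ab_group_add set \<Rightarrow> 'a set \<Rightarrow> 'a set set" where
  "cosets R I = (\<lambda>x. (+) x ` I) ` R"

lemma add_subgroupD:
  assumes "add_subgroup I"
  shows "0 \<in> I" "x \<in> I \<Longrightarrow> y \<in> I \<Longrightarrow> x - y \<in> I" "x \<in> I \<Longrightarrow> - x \<in> I" "x \<in> I \<Longrightarrow> y \<in> I \<Longrightarrow> x + y \<in> I"
proof -
  show "0 \<in> I" and d: "x \<in> I \<Longrightarrow> y \<in> I \<Longrightarrow> x - y \<in> I" for x y using assms by (auto simp: add_subgroup_def)
  then show n: "x \<in> I \<Longrightarrow> - x \<in> I" for x by (metis diff_0)
  show "x \<in> I \<Longrightarrow> y \<in> I \<Longrightarrow> x + y \<in> I" using d[of x "- y"] n[of y] by simp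
qed

lemma coset_eq_iff:
  assumes "add_subgroup I"
  shows "(+) x ` I = (+) y ` I \<longleftrightarrow> x - y \<in> I"
proof
  assume "(+) x ` I = (+) y ` I"
  moreover have "x \<in> (+) x ` I" using add_subgroupD(1)[OF assms] by (intro image_eqI[of _ _ 0]) auto
  ultimately show "x - y \<in> I" by auto
next
  have sub: "(+) u ` I \<subseteq> (+) w ` I" if "u - w \<in> I" for u w
  proof clarify
    fix i assume "i \<in> I"
    then have "(u - w) + i \<in> I" using that by (intro add_subgroupD(4)[OF assms])
    then show "u + i \<in> (+) w ` I" by (intro image_eqI[of _ _ "(u - w) + i"]) auto
  qed
  assume "x - y \<in> I"
  then show "(+) x ` I = (+) y ` I"
    using sub[of x y] sub[of y x] add_subgroupD(3)[OF assms, of "x - y"] by auto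
qed

lemma cosets_self:
  assumes "add_subgroup I"
  shows "cosets I I = {I}"
proof -
  have "(+) x ` I = I" if "x \<in> I" for x using coset_eq_iff[OF assms, of x 0] that by simp
  then have "cosets I I = (\<lambda>_. I) ` I" unfolding cosets_def by (rule image_cong[OF refl])
  then show ?thesis using add_subgroupD(1)[OF assms] by auto
qed

lemma cosets_cong_bij:
  assumes I: "add_subgroup I" and J: "add_subgroup J"
    and h: "h ` R = S" "\<And>x y. x \<in> R \<Longrightarrow> y \<in> R \<Longrightarrow> h x - h y \<in> J \<longleftrightarrow> x - y \<in> I"
  shows "\<exists>g. bij_betw g (cosets R I) (cosets S J)"
proof -
  define g where "g C = (+) (h (SOME x. x \<in> R \<and> C = (+) x ` I)) ` J" for C
  have g: "g ((+) x ` I) = (+) (h x) ` J" if "x \<in> R" for x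
  proof -
    have "\<exists>y. y \<in> R \<and> (+) x ` I = (+) y ` I" using that by blast
    moreover define s where "s = (SOME y. y \<in> R \<and> (+) x ` I = (+) y ` I)"
    ultimately have s: "s \<in> R" "(+) s ` I = (+) x ` I" using someI_ex[of "\<lambda>y. y \<in> R \<and> (+) x ` I = (+) y ` I"] by auto
    then have "h s - h x \<in> J" using h(2)[OF s(1) that] unfolding coset_eq_iff[OF I] by blast
    then show ?thesis unfolding g_def s_def[symmetric] coset_eq_iff[OF J] .
  qed
  have "bij_betw g (cosets R I) (cosets S J)"
    unfolding bij_betw_def
  proof
    show "inj_on g (cosets R I)"
    proof (rule inj_onI)
      fix C D assume "C \<in> cosets R I" "D \<in> cosets R I" and gCD: "g C = g D"
      then obtain x y where x: "x \<in> R" "C = (+) x ` I" and y: "y \<in> R" "D = (+) y ` I"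
        by (auto simp: cosets_def)
      have "h x - h y \<in> J" using gCD g[OF x(1)] g[OF y(1)] x(2) y(2) coset_eq_iff[OF J] by simp
      then show "C = D" unfolding x(2) y(2) coset_eq_iff[OF I] using h(2) x(1) y(1) by blast
    qed
    show "g ` cosets R I = cosets S J"
      unfolding cosets_def h(1)[symmetric] by (auto simp: image_image g)
  qed
  then show ?thesis by blast
qed

text \<open>Index formula for a tower of subgroups: sums of a representative of a coset of
  \<open>J\<close> in \<open>R\<close> and one of a coset of \<open>I\<close> in \<open>J\<close>
  represent the cosets of \<open>I\<close> in \<open>R\<close> once each.\<close>

lemma finite_card_cosets_mult:
  assumes I: "add_subgroup I" and J: "add_subgroup J" and R: "add_subgroup R"
    and sub: "I \<subseteq> J" "J \<subseteq> R" and fin: "finite (cosets R J)" "finite (cosets J I)"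
  shows "finite (cosets R I)" and "card (cosets R I) = card (cosets R J) * card (cosets J I)"
proof -
  have "\<exists>T\<subseteq>R. inj_on (\<lambda>x. (+) x ` J) T \<and> cosets R J = (\<lambda>x. (+) x ` J) ` T"
    unfolding cosets_def by (rule subset_image_inj[THEN iffD1, OF subset_refl])
  then obtain T where T: "T \<subseteq> R" "bij_betw (\<lambda>x. (+) x ` J) T (cosets R J)" by (auto simp: bij_betw_def)
  have "\<exists>U\<subseteq>J. inj_on (\<lambda>x. (+) x ` I) U \<and> cosets J I = (\<lambda>x. (+) x ` I) ` U"
    unfolding cosets_def by (rule subset_image_inj[THEN iffD1, OF subset_refl])
  then obtain U where U: "U \<subseteq> J" "bij_betw (\<lambda>x. (+) x ` I) U (cosets J I)" by (auto simp: bij_betw_def)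
  have "bij_betw (\<lambda>(t, u). (+) (t + u) ` I) (T \<times> U) (cosets R I)"
    unfolding bij_betw_def
  proof
    show "inj_on (\<lambda>(t, u). (+) (t + u) ` I) (T \<times> U)"
    proof (rule inj_onI, clarify, rule conjI)
      fix t u t' u' assume *: "t \<in> T" "u \<in> U" "t' \<in> T" "u' \<in> U" "(+) (t + u) ` I = (+) (t' + u') ` I"
      then have d: "(t + u) - (t' + u') \<in> I" by (simp add: coset_eq_iff[OF I])
      have "u - u' \<in> J" using U(1) * by (intro add_subgroupD(2)[OF J]) auto
      then have "((t + u) - (t' + u')) - (u - u') \<in> J"
        by (rule add_subgroupD(2)[OF J, rotated]) (use d sub in blast)
      moreover have "((t + u) - (t' + u')) - (u - u') = t - t'" by simp
      ultimately have "(+) t ` J = (+) t' ` J" unfolding coset_eq_iff[OF J] by simp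
      then show tt: "t = t'" using T(2) * unfolding bij_betw_def by (blast dest: inj_onD)
      have "(t + u) - (t' + u') = u - u'" using tt by simp
      then have "(+) u ` I = (+) u' ` I" using d unfolding coset_eq_iff[OF I] by simp
      then show "u = u'" using U(2) * unfolding bij_betw_def by (blast dest: inj_onD)
    qed
    show "(\<lambda>(t, u). (+) (t + u) ` I) ` (T \<times> U) = cosets R I"
    proof (intro equalityI subsetI)
      fix C assume "C \<in> (\<lambda>(t, u). (+) (t + u) ` I) ` (T \<times> U)"
      then show "C \<in> cosets R I"
        using T(1) U(1) sub unfolding cosets_def by (auto intro!: imageI add_subgroupD[OF R])
    next
      fix C assume "C \<in> cosets R I"
      then obtain x where x: "x \<in> R" "C = (+) x ` I" by (auto simp: cosets_def)
      then have "(+) x ` J \<in> (\<lambda>x. (+) x ` J) ` T" using T(2) by (auto simp: bij_betw_def cosets_def)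
      then obtain t where t: "t \<in> T" "x - t \<in> J" by (auto simp: coset_eq_iff[OF J])
      then have "(+) (x - t) ` I \<in> (\<lambda>x. (+) x ` I) ` U" using U(2) by (auto simp: bij_betw_def cosets_def)
      then obtain u where u: "u \<in> U" "x - t - u \<in> I" by (auto simp: coset_eq_iff[OF I])
      then have "C = (+) (t + u) ` I" unfolding x(2) coset_eq_iff[OF I] by (simp add: algebra_simps)
      then show "C \<in> (\<lambda>(t, u). (+) (t + u) ` I) ` (T \<times> U)" using t u by force
    qed
  qed
  moreover have "finite (T \<times> U)" "card (T \<times> U) = card (cosets R J) * card (cosets J I)"
    using bij_betw_same_card[OF T(2)] bij_betw_same_card[OF U(2)] bij_betw_finite[OF T(2)] bij_betw_finite[OF U(2)] fin
    by (auto simp: card_cartesian_product)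
  ultimately show "finite (cosets R I)" "card (cosets R I) = card (cosets R J) * card (cosets J I)"
    by (auto simp: bij_betw_finite dest: bij_betw_same_card)
qed

text \<open>Elements with the same image coset differ by the kernel of \<open>h\<close> modulo
  \<open>I\<close>, so no fibre is larger than that kernel. All upper bounds for spaces of functions
  come from this count, one place at a time.\<close>

lemma card_le_cosets_kernel:
  fixes h :: "'b::ab_group_add \<Rightarrow> 'a::ab_group_add"
  assumes I: "add_subgroup I" and G: "add_subgroup G"
    and h: "\<And>x y. x \<in> G \<Longrightarrow> y \<in> G \<Longrightarrow> h (x - y) = h x - h y" "h ` G \<subseteq> R"
    and fin: "finite (cosets R I)" "finite {g\<in>G. h g \<in> I}"
  shows "finite G" and "card G \<le> card (cosets R I) * card {g\<in>G. h g \<in> I}"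
proof -
  define F where "F C = {g\<in>G. (+) (h g) ` I = C}" for C
  have F: "finite (F C) \<and> card (F C) \<le> card {g\<in>G. h g \<in> I}" for C
  proof (cases "F C = {}")
    case False
    then obtain g0 where g0: "g0 \<in> G" "(+) (h g0) ` I = C" by (auto simp: F_def)
    have "(\<lambda>g. g - g0) ` F C \<subseteq> {g\<in>G. h g \<in> I}"
    proof clarify
      fix g assume "g \<in> F C"
      then have "g \<in> G" "h g - h g0 \<in> I" using g0 by (auto simp: F_def coset_eq_iff[OF I, symmetric])
      then show "g - g0 \<in> G \<and> h (g - g0) \<in> I" using g0 h(1) by (auto intro: add_subgroupD[OF G])
    qed
    moreover have "inj_on (\<lambda>g. g - g0) (F C)" by (auto intro: inj_onI)
    ultimately show ?thesis using inj_on_finite[OF _ _ fin(2)] card_inj_on_le[OF _ _ fin(2)] by blast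
  qed auto
  have eq: "G = (\<Union>C\<in>cosets R I. F C)" using h(2) by (auto simp: F_def cosets_def)
  have "finite (\<Union>C\<in>cosets R I. F C)" using fin F by blast
  then show "finite G" using eq by simp
  have "card G \<le> (\<Sum>C\<in>cosets R I. card (F C))" using card_UN_le[OF fin(1), of F] eq by simp
  also have "\<dots> \<le> (\<Sum>C\<in>cosets R I. card {g\<in>G. h g \<in> I})" using F by (intro sum_mono) auto
  finally show "card G \<le> card (cosets R I) * card {g\<in>G. h g \<in> I}" by simp
qed

context function_field
begin

lemma subspace_add_subgroup: "vs.subspace V \<Longrightarrow> add_subgroup V"
  by (auto simp: add_subgroup_def vs.subspace_0 vs.subspace_diff)

section \<open>Bases modulo a subspace and their cardinalities\<close>

definition indep_mod :: "'k set \<Rightarrow> 'k set \<Rightarrow> bool" where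
  "indep_mod B I \<longleftrightarrow> finite B \<and> (\<forall>c. (\<Sum>b\<in>B. emb (c b) * b) \<in> I \<longrightarrow> (\<forall>b\<in>B. c b = 0))"

lemma indep_modD: "indep_mod B I \<Longrightarrow> (\<Sum>b\<in>B. emb (c b) * b) \<in> I \<Longrightarrow> b \<in> B \<Longrightarrow> c b = 0"
  by (auto simp: indep_mod_def)

lemma card_cosets_basis:
  assumes I: "vs.subspace I" and R: "vs.subspace R" and B: "finite B" "B \<subseteq> R"
    and ex1: "\<And>x. x \<in> R \<Longrightarrow> \<exists>!c. c \<in> B \<rightarrow>\<^sub>E (UNIV :: 'f set) \<and> x - (\<Sum>b\<in>B. emb (c b) * b) \<in> I"
  shows "finite (cosets R I)" and "card (cosets R I) = q ^ card B"
proof -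
  let ?s = "\<lambda>c. \<Sum>b\<in>B. emb (c b) * b"
  have sR: "?s c \<in> R" for c using B(2) by (auto intro!: vs.subspace_sum[OF R] vs.subspace_scale[OF R])
  note Isg = subspace_add_subgroup[OF I]
  have "bij_betw (\<lambda>c. (+) (?s c) ` I) (B \<rightarrow>\<^sub>E UNIV) (cosets R I)"
    unfolding bij_betw_def
  proof
    show "inj_on (\<lambda>c. (+) (?s c) ` I) (B \<rightarrow>\<^sub>E UNIV)"
    proof (rule inj_onI)
      fix c c' :: "'k \<Rightarrow> 'f"
      assume c: "c \<in> B \<rightarrow>\<^sub>E UNIV" "c' \<in> B \<rightarrow>\<^sub>E UNIV" "(+) (?s c) ` I = (+) (?s c') ` I"
      then have "?s c - ?s c' \<in> I" "?s c - ?s c \<in> I" using vs.subspace_0[OF I] by (auto simp: coset_eq_iff[OF Isg])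
      then show "c = c'" using ex1[OF sR[of c]] c by blast
    qed
    show "(\<lambda>c. (+) (?s c) ` I) ` (B \<rightarrow>\<^sub>E UNIV) = cosets R I"
    proof (intro equalityI subsetI)
      fix C assume "C \<in> cosets R I"
      then obtain x where x: "x \<in> R" "C = (+) x ` I" by (auto simp: cosets_def)
      then obtain c where "c \<in> B \<rightarrow>\<^sub>E (UNIV :: 'f set)" "x - ?s c \<in> I" using ex1 by blast
      then show "C \<in> (\<lambda>c. (+) (?s c) ` I) ` (B \<rightarrow>\<^sub>E UNIV)"
        using x by (intro image_eqI[of _ _ c]) (auto simp: coset_eq_iff[OF Isg])
    qed (use sR in \<open>auto simp: cosets_def\<close>)
  qed
  moreover have "finite (B \<rightarrow>\<^sub>E (UNIV :: 'f set))" "card (B \<rightarrow>\<^sub>E (UNIV :: 'f set)) = q ^ card B"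
    using B by (auto simp: card_PiE intro!: finite_PiE)
  ultimately show "finite (cosets R I)" "card (cosets R I) = q ^ card B"
    by (auto simp: bij_betw_finite dest: bij_betw_same_card)
qed

text \<open>A maximal independent family exists because the sizes are bounded by \<open>m\<close>;
  restricting coefficient functions to \<open>B\<close> makes them unique.\<close>

lemma exists_basis_mod:
  assumes I: "vs.subspace I" and R: "vs.subspace R"
    and bnd: "\<And>B. B \<subseteq> R \<Longrightarrow> indep_mod B I \<Longrightarrow> card B \<le> m"
  shows "\<exists>B. finite B \<and> B \<subseteq> R \<and> indep_mod B I \<and>
     (\<forall>x\<in>R. \<exists>!c. c \<in> B \<rightarrow>\<^sub>E (UNIV :: 'f set) \<and> x - (\<Sum>b\<in>B. emb (c b) * b) \<in> I)"
proof -
  define k where "k = (GREATEST k. \<exists>B\<subseteq>R. indep_mod B I \<and> card B = k)"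
  have "\<exists>B\<subseteq>R. indep_mod B I \<and> card B = 0" by (intro exI[of _ "{}"]) (simp add: indep_mod_def)
  then have "\<exists>B\<subseteq>R. indep_mod B I \<and> card B = k"
    unfolding k_def by (rule GreatestI_nat[where b = m]) (use bnd in blast)
  then obtain B where B: "B \<subseteq> R" "indep_mod B I" "card B = k" by blast
  have max: "card B' \<le> card B" if "B' \<subseteq> R" "indep_mod B' I" for B'
    unfolding B(3) k_def by (rule Greatest_le_nat[where b = m]) (use bnd that in auto)
  have finB: "finite B" using B(2) by (simp add: indep_mod_def)
  let ?s = "\<lambda>c. \<Sum>b\<in>B. emb (c b) * b"
  have ex: "\<exists>c. x - ?s c \<in> I" if x: "x \<in> R" for x
  proof (rule ccontr)
    assume "\<nexists>c. x - ?s c \<in> I"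
    then have no: "x - ?s c \<notin> I" for c by blast
    have "x \<notin> B"
    proof
      assume "x \<in> B"
      then have "?s (\<lambda>b. if b = x then 1 else 0) = x"
        using finB by (simp add: if_distrib[of emb] if_distrib[of "\<lambda>c. c * _"] cong: if_cong)
      then show False using no[of "\<lambda>b. if b = x then 1 else 0"] vs.subspace_0[OF I] by simp
    qed
    have "indep_mod (insert x B) I"
      unfolding indep_mod_def
    proof (intro conjI allI impI)
      fix c assume "(\<Sum>b\<in>insert x B. emb (c b) * b) \<in> I"
      then have s: "emb (c x) * x + ?s c \<in> I" using finB \<open>x \<notin> B\<close> by simp
      have "c x = 0"
      proof (rule ccontr)
        assume cx: "c x \<noteq> 0"
        have "emb (inverse (c x)) * (emb (c x) * x + ?s c) \<in> I" using s by (rule vs.subspace_scale[OF I])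
        also have "emb (inverse (c x)) * (emb (c x) * x + ?s c) = x - ?s (\<lambda>b. - inverse (c x) * c b)"
          using cx by (simp add: emb_mult emb_uminus emb_inverse distrib_left sum_distrib_left sum_negf mult.assoc[symmetric])
        finally show False using no[of "\<lambda>b. - inverse (c x) * c b"] by blast
      qed
      then have "\<forall>b\<in>B. c b = 0" using s B(2) by (auto simp: indep_mod_def)
      then show "\<forall>b\<in>insert x B. c b = 0" using \<open>c x = 0\<close> by simp
    qed (use finB in simp)
    then have "card (insert x B) \<le> card B" using max B(1) x by auto
    then show False using finB \<open>x \<notin> B\<close> by simp
  qed
  have "\<exists>!c. c \<in> B \<rightarrow>\<^sub>E (UNIV :: 'f set) \<and> x - ?s c \<in> I" if "x \<in> R" for x
  proof -
    obtain c where c: "x - ?s c \<in> I" using ex[OF \<open>x \<in> R\<close>] ..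
    have "?s (restrict c B) = ?s c" by (intro sum.cong) auto
    then have r: "restrict c B \<in> B \<rightarrow>\<^sub>E UNIV \<and> x - ?s (restrict c B) \<in> I" using c by simp
    have u: "d = d'" if d: "d \<in> B \<rightarrow>\<^sub>E UNIV \<and> x - ?s d \<in> I" "d' \<in> B \<rightarrow>\<^sub>E UNIV \<and> x - ?s d' \<in> I" for d d'
    proof -
      have "(x - ?s d') - (x - ?s d) \<in> I" by (rule vs.subspace_diff[OF I]) (use d in auto)
      also have "(x - ?s d') - (x - ?s d) = ?s (\<lambda>b. d b - d' b)"
        by (simp add: emb_diff left_diff_distrib sum_subtractf)
      finally have "\<forall>b\<in>B. d b - d' b = 0" using indep_modD[OF B(2), of "\<lambda>b. d b - d' b"] by blast
      then show ?thesis using d by (intro PiE_ext[of d B _ d']) auto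
    qed
    show ?thesis by (rule ex1I[of _ "restrict c B"], rule r, rule u[OF _ r])
  qed
  then show ?thesis by (intro exI[of _ B] conjI ballI finB B(1,2))
qed

text \<open>The bridge from the dimension in the definition of \<open>riemann_roch_dim\<close> to
  cardinalities, in which dimensions are computed from here on.\<close>

lemma card_subspace:
  assumes V: "vs.subspace V" and fin: "finite V"
  shows "card V = q ^ vs.dim V"
proof -
  obtain B where B: "B \<subseteq> V" "vs.independent B" "V \<subseteq> vs.span B" "card B = vs.dim V"
    using vs.basis_exists[of V] by metis
  have finB: "finite B" using B(1) fin by (rule finite_subset)
  let ?s = "\<lambda>c. \<Sum>b\<in>B. emb (c b) * b"
  have "\<exists>!c. c \<in> B \<rightarrow>\<^sub>E (UNIV :: 'f set) \<and> x - ?s c \<in> {0}" if "x \<in> V" for x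
  proof -
    have "x \<in> range ?s" using B(3) that unfolding vs.span_finite[OF finB] by blast
    then obtain c where c: "x = ?s c" by blast
    have "?s (restrict c B) = ?s c" by (intro sum.cong) auto
    then have r: "restrict c B \<in> B \<rightarrow>\<^sub>E UNIV \<and> x - ?s (restrict c B) \<in> {0}" using c by simp
    have u: "d = d'" if d: "d \<in> B \<rightarrow>\<^sub>E UNIV \<and> x - ?s d \<in> {0}" "d' \<in> B \<rightarrow>\<^sub>E UNIV \<and> x - ?s d' \<in> {0}" for d d'
    proof -
      have "?s (\<lambda>b. d b - d' b) = 0" using d by (simp add: emb_diff left_diff_distrib sum_subtractf)
      then have "\<forall>b\<in>B. d b - d' b = 0"
        using vs.independentD[OF B(2) finB subset_refl, of "\<lambda>b. d b - d' b"] by blast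
      then show ?thesis using d by (intro PiE_ext[of d B _ d']) auto
    qed
    show ?thesis by (rule ex1I[of _ "restrict c B"], rule r, rule u[OF _ r])
  qed
  from card_cosets_basis(2)[OF vs.subspace_single_0 V finB B(1) this]
  have "card (cosets V {0}) = q ^ vs.dim V" using B(4) by simp
  moreover have "card (cosets V {0}) = card V" unfolding cosets_def by (intro card_image) (auto intro: inj_onI)
  ultimately show ?thesis by simp
qed

text \<open>The \<open>k\<close>-th power of the maximal ideal, fractional for negative
  \<open>k\<close>. It always contains 0, which implements the infinite valuation of 0 although
  \<open>v 0 = 0\<close>.\<close>

definition pw :: "('k \<Rightarrow> int) \<Rightarrow> int \<Rightarrow> 'k set" where
  "pw v k = {x. x = 0 \<or> k \<le> v x}"

lemma valuation_ring_pw: "valuation_ring v = pw v 0"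
  and valuation_ideal_pw: "valuation_ideal v = pw v 1"
  by (auto simp: valuation_ring_def valuation_ideal_def pw_def)

lemma pw_0 [simp]: "0 \<in> pw v k" by (simp add: pw_def)

lemma pw_iff: "x \<noteq> 0 \<Longrightarrow> x \<in> pw v k \<longleftrightarrow> k \<le> v x" by (simp add: pw_def)

lemma pw_mono: "x \<in> pw v k \<Longrightarrow> j \<le> k \<Longrightarrow> x \<in> pw v j" by (auto simp: pw_def)

context
  fixes v assumes v: "v \<in> places emb"
begin

lemma place_1 [simp]: "v 1 = 0" using place_emb[OF v, of 1] by simp

lemma place_inverse: "v (inverse x) = - v x"
  using place_mult[OF v, of x "inverse x"] v by (cases "x = 0") auto

lemma place_divide: "x \<noteq> 0 \<Longrightarrow> y \<noteq> 0 \<Longrightarrow> v (x / y) = v x - v y"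
  using place_mult[OF v, of x "inverse y"] by (simp add: place_inverse divide_inverse)

lemma place_power: "v (x ^ n) = int n * v x"
proof (cases "x = 0")
  case False
  then show ?thesis using place_mult[OF v] by (induction n) (auto simp: algebra_simps)
qed (use v in \<open>cases n; simp\<close>)

lemma place_powi: "v (x powi k) = k * v x"
  by (auto simp: power_int_def place_power place_inverse)

lemma place_uminus: "v (- x) = v x"
  using place_mult[OF v, of "emb (- 1)" x] place_emb[OF v, of "- 1"] by (cases "x = 0") (auto simp: emb_uminus)

lemma pw_add: "x \<in> pw v k \<Longrightarrow> y \<in> pw v k \<Longrightarrow> x + y \<in> pw v k"
  using place_add[OF v, of x y] by (cases "x = 0 \<or> y = 0 \<or> x + y = 0") (auto simp: pw_def)

lemma pw_mult: "x \<in> pw v j \<Longrightarrow> y \<in> pw v k \<Longrightarrow> x * y \<in> pw v (j + k)"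
  using place_mult[OF v, of x y] by (cases "x = 0 \<or> y = 0") (auto simp: pw_def)

lemma pw_mult_0: "x \<in> pw v 0 \<Longrightarrow> y \<in> pw v k \<Longrightarrow> x * y \<in> pw v k"
  using pw_mult[of x 0 y k] by simp

lemma pw_emb [simp]: "emb c \<in> pw v 0"
  using v by (auto simp: pw_def)

lemma pw_1 [simp]: "1 \<in> pw v 0" by (simp add: pw_def)

lemma pw_subspace: "vs.subspace (pw v k)"
  by (auto simp: vs.subspace_def intro: pw_add pw_mult_0)

lemmas pw_subgroup = subspace_add_subgroup[OF pw_subspace]
lemmas pw_diff = add_subgroupD(2)[OF pw_subgroup]

lemma pw_uminus [simp]: "- x \<in> pw v k \<longleftrightarrow> x \<in> pw v k"
  by (simp add: pw_def place_uminus)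

lemma pw_sum: "(\<And>i. i \<in> A \<Longrightarrow> h i \<in> pw v k) \<Longrightarrow> sum h A \<in> pw v k"
  by (induction A rule: infinite_finite_induct) (auto intro: pw_add)

lemma pw_power: "x \<in> pw v k \<Longrightarrow> x ^ n \<in> pw v (int n * k)"
  by (cases "x = 0") (auto simp: pw_iff place_power power_0_left mult_left_mono)

lemma pw_ev: "x \<in> pw v 0 \<Longrightarrow> ev x p \<in> pw v 0"
  by (induction p) (auto intro!: pw_add pw_mult_0)

text \<open>Strict triangle equality; stating the hypothesis through \<open>pw\<close> includes
  \<open>y = 0\<close>.\<close>

lemma place_add_eq:
  assumes "x \<noteq> 0" "y \<in> pw v (v x + 1)"
  shows "x + y \<noteq> 0" and "v (x + y) = v x"
proof -
  show nz: "x + y \<noteq> 0"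
  proof
    assume "x + y = 0"
    then have "y = - x" by (simp add: eq_neg_iff_add_eq_0 add.commute)
    then show False using assms by (simp add: pw_iff)
  qed
  show "v (x + y) = v x"
  proof (cases "y = 0")
    case False
    then have y: "v x < v y" using assms by (simp add: pw_iff)
    have "min (v (x + y)) (v (- y)) \<le> v (x + y + - y)"
      using nz False assms by (intro place_add[OF v]) auto
    moreover have "min (v x) (v y) \<le> v (x + y)" using nz False assms by (intro place_add[OF v])
    ultimately show ?thesis using y by (simp add: place_uminus)
  qed simp
qed

lemma pw_scale_image:
  assumes "t \<noteq> 0" shows "(*) t ` pw v k = pw v (k + v t)"
proof (intro equalityI subsetI)
  fix y assume "y \<in> pw v (k + v t)"
  then show "y \<in> (*) t ` pw v k"
    using assms place_divide[of y t] by (intro image_eqI[of _ _ "y / t"]; cases "y = 0") (auto simp: pw_iff)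
next
  fix y assume "y \<in> (*) t ` pw v k"
  then obtain x where "x \<in> pw v k" "y = t * x" by blast
  then show "y \<in> pw v (k + v t)" using assms place_mult[OF v assms, of x] by (cases "x = 0") (auto simp: pw_iff)
qed

end

text \<open>The degree of \<open>K\<close> over the rational subfield of a transcendental
  \<open>z\<close>. For a constant \<open>z\<close> only the empty family is independent, so the
  value is 0 and agrees with the degree of its empty polar divisor.\<close>

definition ext_deg :: "'k \<Rightarrow> nat" where
  "ext_deg z = (GREATEST m. \<exists>Y. indep_over z Y \<and> card Y = m)"

lemma indep_over_le_ext_deg: "indep_over z Y \<Longrightarrow> card Y \<le> ext_deg z"
  and exists_indep_over_ext_deg: "\<exists>Y. indep_over z Y \<and> card Y = ext_deg z"
proof -
  obtain m where m: "\<And>Y. indep_over z Y \<Longrightarrow> card Y \<le> m" using indep_over_bounded by blast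
  show "indep_over z Y \<Longrightarrow> card Y \<le> ext_deg z"
    unfolding ext_deg_def by (rule Greatest_le_nat[where b = m]) (use m in auto)
  have "\<exists>Y. indep_over z Y \<and> card Y = 0" by (intro exI[of _ "{}"]) (simp add: indep_over_def)
  then show "\<exists>Y. indep_over z Y \<and> card Y = ext_deg z"
    unfolding ext_deg_def by (rule GreatestI_nat[where b = m]) (use m in blast)
qed

lemma Int_subspace: "(\<And>a. a \<in> A \<Longrightarrow> vs.subspace (F a)) \<Longrightarrow> vs.subspace (\<Inter>a\<in>A. F a)"
  by (auto simp: vs.subspace_def)

text \<open>In a relation with polynomials in \<open>z\<close> as coefficients, all but the constant
  coefficients carry a factor \<open>z\<close>, so the combination of the constant coefficients lies
  in \<open>I\<close>. Independence modulo \<open>I\<close> over the constants therefore lifts to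
  independence over the rational subfield, which bounds the basis by
  \<open>ext_deg z\<close>.\<close>

lemma basis_mod_zeros:
  assumes S: "S \<subseteq> places emb" "z \<noteq> 0" and pos: "\<And>v. v \<in> S \<Longrightarrow> 0 < v z"
  defines "R \<equiv> (\<Inter>v\<in>S. pw v 0)" and "I \<equiv> (\<Inter>v\<in>S. pw v (v z))"
  shows "\<exists>B. finite B \<and> B \<subseteq> R \<and> card B \<le> ext_deg z \<and>
     (\<forall>x\<in>R. \<exists>!c. c \<in> B \<rightarrow>\<^sub>E (UNIV :: 'f set) \<and> x - (\<Sum>b\<in>B. emb (c b) * b) \<in> I)"
proof -
  have sub: "vs.subspace I" "vs.subspace R"
    unfolding I_def R_def using S by (auto intro!: Int_subspace pw_subspace)
  have bnd: "card B \<le> ext_deg z" if B: "B \<subseteq> R" "indep_mod B I" for B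
  proof (rule indep_over_le_ext_deg, rule indep_overI[OF S(2)])
    show "finite B" using B by (simp add: indep_mod_def)
    fix P assume P: "(\<Sum>y\<in>B. ev z (P y) * y) = 0"
    have split: "ev z p = emb (coeff p 0) + z * ev z (poly_shift 1 p)" for p
    proof -
      have "p = pCons (coeff p 0) (poly_shift 1 p)"
        by (auto simp: poly_eq_iff coeff_pCons coeff_poly_shift split: nat.split)
      then have "ev z p = ev z (pCons (coeff p 0) (poly_shift 1 p))" by (rule arg_cong)
      then show ?thesis by (simp only: ev_pCons)
    qed
    have "(\<Sum>b\<in>B. emb (coeff (P b) 0) * b) = - (\<Sum>b\<in>B. z * ev z (poly_shift 1 (P b)) * b)"
      using P by (subst (asm) split) (simp add: distrib_right sum.distrib eq_neg_iff_add_eq_0)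
    also have "\<dots> \<in> I"
      unfolding I_def
    proof
      fix v assume v: "v \<in> S"
      then have vp: "v \<in> places emb" using S by blast
      have "z * ev z (poly_shift 1 (P b)) * b \<in> pw v (v z + 0 + 0)" if "b \<in> B" for b
        using pos[OF v] B(1) that v S(2) vp
        by (intro pw_mult pw_ev) (auto simp: pw_iff R_def)
      then show "- (\<Sum>b\<in>B. z * ev z (poly_shift 1 (P b)) * b) \<in> pw v (v z)"
        using vp by (auto intro!: pw_sum)
    qed
    finally show "\<forall>y\<in>B. coeff (P y) 0 = 0" using indep_modD[OF B(2), of "\<lambda>b. coeff (P b) 0"] by blast
  qed
  have "\<exists>B. finite B \<and> B \<subseteq> R \<and> indep_mod B I \<and>
     (\<forall>x\<in>R. \<exists>!c. c \<in> B \<rightarrow>\<^sub>E (UNIV :: 'f set) \<and> x - (\<Sum>b\<in>B. emb (c b) * b) \<in> I)"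
    by (rule exists_basis_mod[OF sub, where m = "ext_deg z"]) (rule bnd)
  then obtain B where "finite B" "B \<subseteq> R" "indep_mod B I"
    "\<forall>x\<in>R. \<exists>!c. c \<in> B \<rightarrow>\<^sub>E (UNIV :: 'f set) \<and> x - (\<Sum>b\<in>B. emb (c b) * b) \<in> I"
    by (elim exE conjE)
  then show ?thesis using bnd by (intro exI[of _ B] conjI)
qed

text \<open>With one place and a uniformizer as \<open>z\<close>, the quotient \<open>R / I\<close>
  is the residue field, which is thereby of finite degree.\<close>

lemma exists_residue_basis:
  assumes v: "v \<in> places emb"
  shows "\<exists>B. residue_basis emb v B"
proof -
  obtain t where t: "t \<noteq> 0" "v t = 1" using place_uniformizer[OF v] by blast
  have "\<exists>B. finite B \<and> B \<subseteq> (\<Inter>v\<in>{v}. pw v 0) \<and> card B \<le> ext_deg t \<and>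
     (\<forall>x\<in>(\<Inter>v\<in>{v}. pw v 0). \<exists>!c. c \<in> B \<rightarrow>\<^sub>E (UNIV :: 'f set) \<and> x - (\<Sum>b\<in>B. emb (c b) * b) \<in> (\<Inter>v\<in>{v}. pw v (v t)))"
    by (rule basis_mod_zeros) (use v t in auto)
  then show ?thesis
    unfolding residue_basis_def valuation_ring_pw valuation_ideal_pw by (elim exE) (auto simp: t(2))
qed

text \<open>Multiplication by a power of a uniformizer identifies each successive quotient with the
  residue field. The cardinality of the latter determines the size of every residue basis, so the
  definite description in \<open>place_degree\<close> is meaningful.\<close>

lemma cosets_pw:
  assumes v: "v \<in> places emb"
  shows "finite (cosets (pw v k) (pw v (k + int m)))"
    and "card (cosets (pw v k) (pw v (k + int m))) = q ^ (m * place_degree emb v)"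
proof -
  have rb: "finite (cosets (pw v 0) (pw v 1)) \<and> card (cosets (pw v 0) (pw v 1)) = q ^ card B"
    if "residue_basis emb v B" for B
    using card_cosets_basis[OF pw_subspace[OF v, of 1] pw_subspace[OF v, of 0], of B] that
    unfolding residue_basis_def valuation_ring_pw valuation_ideal_pw by auto
  obtain B where B: "residue_basis emb v B" using exists_residue_basis[OF v] by blast
  have inj: "q ^ a = q ^ b \<Longrightarrow> a = b" for a b using q_ge_2 by (simp add: power_inject_exp)
  have "place_degree emb v = card B"
    unfolding place_degree_def
  proof (rule the_equality)
    show "d = card B" if "\<exists>B. residue_basis emb v B \<and> card B = d" for d
    proof -
      from that obtain B' where "residue_basis emb v B'" "card B' = d" by blast
      then have "q ^ d = q ^ card B" using rb[of B'] rb[OF B] by simp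
      then show ?thesis by (rule inj)
    qed
  qed (use B in blast)
  then have 0: "finite (cosets (pw v 0) (pw v 1))" "card (cosets (pw v 0) (pw v 1)) = q ^ place_degree emb v"
    using rb[OF B] by auto
  obtain t where t: "t \<noteq> 0" "v t = 1" using place_uniformizer[OF v] by blast
  have 1: "finite (cosets (pw v k) (pw v (k + 1))) \<and> card (cosets (pw v k) (pw v (k + 1))) = q ^ place_degree emb v" for k
  proof -
    have tk: "t powi k \<noteq> 0" "v (t powi k) = k" using t by (auto simp: place_powi[OF v])
    have "\<exists>g. bij_betw g (cosets (pw v 0) (pw v 1)) (cosets (pw v k) (pw v (k + 1)))"
    proof (rule cosets_cong_bij[where h = "(*) (t powi k)"])
      show "(*) (t powi k) ` pw v 0 = pw v k" using pw_scale_image[OF v tk(1), of 0] tk by simp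
      fix x y
      have "x - y \<in> pw v 1 \<longleftrightarrow> t powi k * (x - y) \<in> pw v (1 + k)"
        using place_mult[OF v tk(1), of "x - y"] tk by (cases "x = y") (auto simp: pw_iff)
      then show "t powi k * x - t powi k * y \<in> pw v (k + 1) \<longleftrightarrow> x - y \<in> pw v 1"
        by (simp add: right_diff_distrib add.commute)
    qed (use v in \<open>auto intro: pw_subgroup\<close>)
    then obtain g where "bij_betw g (cosets (pw v 0) (pw v 1)) (cosets (pw v k) (pw v (k + 1)))" ..
    then show ?thesis using 0 bij_betw_finite[of g "cosets (pw v 0) (pw v 1)"]
        bij_betw_same_card[of g "cosets (pw v 0) (pw v 1)"] by simp
  qed
  have "finite (cosets (pw v k) (pw v (k + int m))) \<and>
    card (cosets (pw v k) (pw v (k + int m))) = q ^ (m * place_degree emb v)"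
  proof (induction m)
    case 0
    then show ?case using cosets_self[OF pw_subgroup[OF v]] by simp
  next
    case (Suc m)
    have "pw v (k + int m + 1) \<subseteq> pw v (k + int m)" "pw v (k + int m) \<subseteq> pw v k"
      by (auto intro: pw_mono)
    note * = finite_card_cosets_mult[OF pw_subgroup[OF v] pw_subgroup[OF v] pw_subgroup[OF v] this
        conjunct1[OF Suc] conjunct1[OF 1]]
    have "k + int (Suc m) = k + int m + 1" by simp
    then show ?case using * Suc 1[of "k + int m"] by (simp only: power_add mult_Suc mult.commute simp_thms)
  qed
  then show "finite (cosets (pw v k) (pw v (k + int m)))"
    and "card (cosets (pw v k) (pw v (k + int m))) = q ^ (m * place_degree emb v)" by auto
qed

lemma place_degree_pos: assumes v: "v \<in> places emb" shows "0 < place_degree emb v"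
proof (rule ccontr)
  assume "\<not> 0 < place_degree emb v"
  then have "card (cosets (pw v 0) (pw v 1)) = 1" using cosets_pw(2)[OF v, of 0 1] by simp
  then obtain C where C: "cosets (pw v 0) (pw v 1) = {C}" by (elim card_1_singletonE)
  have "(+) x ` pw v 1 = C" if "x \<in> pw v 0" for x
    using C imageI[OF that, of "\<lambda>x. (+) x ` pw v 1"] unfolding cosets_def by (simp only: singleton_iff)
  then have "(+) 0 ` pw v 1 = (+) 1 ` pw v 1" using pw_1[OF v] pw_0 by metis
  then have "0 - 1 \<in> pw v 1" unfolding coset_eq_iff[OF pw_subgroup[OF v]] .
  then show False using v by (simp add: pw_iff place_uminus)
qed

lemma q_power_le_iff: "q ^ a \<le> q ^ b \<longleftrightarrow> a \<le> b"
  using q_ge_2 by (intro power_increasing_iff) simp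

text \<open>Otherwise the valuation ring of \<open>v\<close> lies in that of \<open>w\<close>, every
  \<open>v\<close>-unit is a \<open>w\<close>-unit, and \<open>w\<close> is a multiple of
  \<open>v\<close>; both being normalized, they coincide.\<close>

lemma place_not_dominated:
  assumes v: "v \<in> places emb" and w: "w \<in> places emb" and "v \<noteq> w"
  shows "\<exists>x. x \<noteq> 0 \<and> 0 \<le> v x \<and> w x < 0"
proof (rule ccontr)
  assume "\<not> ?thesis"
  then have no: "0 \<le> w x" if "x \<noteq> 0" "0 \<le> v x" for x using that by force
  have eq0: "w x = 0" if "x \<noteq> 0" "v x = 0" for x
    using no[of x] no[of "inverse x"] that by (simp add: place_inverse v w)
  obtain t where t: "t \<noteq> 0" "v t = 1" using place_uniformizer[OF v] by blast
  have weq: "w x = v x * w t" if "x \<noteq> 0" for x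
  proof -
    have "v (x / t powi v x) = 0" using that t by (simp add: place_divide v place_powi)
    then have "w (x / t powi v x) = 0" using that t by (intro eq0) auto
    then show ?thesis using that t by (simp add: place_divide w place_powi)
  qed
  obtain s where "s \<noteq> 0" "w s = 1" using place_uniformizer[OF w] by blast
  then have "v s * w t = 1" using weq[of s] by simp
  moreover have "0 \<le> w t" using no[of t] t by simp
  ultimately have "w t = 1" by (auto simp: zmult_eq_1_iff)
  then have "v x = w x" for x using weq[of x] v w by (cases "x = 0") auto
  then show False using \<open>v \<noteq> w\<close> by auto
qed

text \<open>To a function \<open>y\<close> for \<open>S\<close> a high power of some
  \<open>z\<close> with \<open>v z > 0 > w z\<close> is added; the exponent rules out ties, so that
  at every pole the sum has the valuation of the dominating summand.\<close>

lemma exists_separating: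
  assumes "finite S" "S \<subseteq> places emb" "v \<in> places emb" "v \<notin> S"
  shows "\<exists>y. y \<noteq> 0 \<and> 0 < v y \<and> (\<forall>w\<in>S. w y < 0)"
  using assms
proof (induction S)
  case empty
  then obtain t where "t \<noteq> 0" "v t = 1" using place_uniformizer by blast
  then show ?case by (intro exI[of _ t]) simp
next
  case (insert w S)
  then have v: "v \<in> places emb" and w: "w \<in> places emb" and vw: "v \<noteq> w" by auto
  obtain y where y: "y \<noteq> 0" "0 < v y" "\<And>u. u \<in> S \<Longrightarrow> u y < 0" using insert by auto
  show ?case
  proof (cases "w y < 0")
    case True
    then show ?thesis using y by (intro exI[of _ y]) auto
  next
    case False
    obtain a where a: "a \<noteq> 0" "0 \<le> v a" "w a < 0" using place_not_dominated[OF v w vw] by blast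
    obtain b where b: "b \<noteq> 0" "0 \<le> w b" "v b < 0" using place_not_dominated[OF w v] vw by blast
    define z where "z = a / b"
    have z: "z \<noteq> 0" "0 < v z" "w z < 0"
      using a b by (auto simp: z_def place_divide v w)
    \<comment> \<open>\<open>r\<close> exceeds every \<open>\<bar>u y\<bar>\<close> on
      \<open>S\<close>: \<open>z ^ r\<close> dominates \<open>y\<close> where \<open>z\<close> has a
      pole, and \<open>y\<close> dominates on the rest of \<open>S\<close>.\<close>
    define r where "r = nat (1 + (\<Sum>u\<in>S. \<bar>u y\<bar>))"
    have r: "\<bar>u y\<bar> < int r" if "u \<in> S" for u
      using member_le_sum[OF that, of "\<lambda>u. \<bar>u y\<bar>"] insert(1) by (simp add: r_def)
    have "0 \<le> (\<Sum>u\<in>S. \<bar>u y\<bar>)" by (intro sum_nonneg) auto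
    then have r1: "0 < int r" unfolding r_def by linarith
    have zr: "z ^ r \<noteq> 0" using z by simp
    have dom: "y + z ^ r \<noteq> 0 \<and> u (y + z ^ r) < 0"
      if u: "u \<in> places emb" "u z < 0" "int r * u z < u y" for u
    proof -
      have "y \<in> pw u (u (z ^ r) + 1)" using u y(1) by (simp add: pw_iff place_power)
      then have "z ^ r + y \<noteq> 0" "u (z ^ r + y) = u (z ^ r)"
        using place_add_eq[OF u(1) zr] by auto
      then show ?thesis using u(2) r1 by (simp add: place_power u(1) add.commute mult_less_0_iff)
    qed
    have "int r * w z < 0" using r1 z by (simp add: mult_less_0_iff)
    then have wlt: "y + z ^ r \<noteq> 0 \<and> w (y + z ^ r) < 0" using False z by (intro dom[OF w]) auto
    moreover have "0 < v (y + z ^ r)"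
    proof -
      have "1 \<le> int r * v z" using r1 z(2) zero_less_mult_iff[of "int r" "v z"] by linarith
      then have "y \<in> pw v 1" "z ^ r \<in> pw v 1" using y zr by (simp_all add: pw_iff place_power v)
      then have "y + z ^ r \<in> pw v 1" by (rule pw_add[OF v])
      then show ?thesis using wlt by (simp add: pw_iff)
    qed
    moreover have "u (y + z ^ r) < 0" if u: "u \<in> S" for u
    proof -
      have up: "u \<in> places emb" using u insert by auto
      show ?thesis
      proof (cases "u z < 0")
        case True
        then have "int r * u z \<le> int r * (- 1)" by (intro mult_left_mono) auto
        then have "int r * u z < u y" using r[OF u] by linarith
        then show ?thesis using dom[OF up True] by blast
      next
        case False
        then have "z ^ r \<in> pw u (u y + 1)"
          using y(3)[OF u] zr by (auto simp: pw_iff place_power up intro: order_trans[of _ 0])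
        then show ?thesis using place_add_eq[OF up y(1)] y(3)[OF u] by auto
      qed
    qed
    ultimately show ?thesis by (intro exI[of _ "y + z ^ r"]) auto
  qed
qed

text \<open>For a separating \<open>y\<close>, the power \<open>y ^ s\<close> is small at
  \<open>v\<close> and has large poles on \<open>S\<close>; so \<open>1 / (1 + y ^ s)\<close> is
  close to 1 at \<open>v\<close> and close to 0 on \<open>S\<close>.\<close>

lemma exists_near_one:
  assumes S: "finite S" "S \<subseteq> places emb" and v: "v \<in> places emb" "v \<notin> S"
  shows "\<exists>x. x - 1 \<in> pw v k \<and> (\<forall>w\<in>S. x \<in> pw w k)"
proof -
  obtain y where y: "y \<noteq> 0" "0 < v y" "\<And>w. w \<in> S \<Longrightarrow> w y < 0"
    using exists_separating[OF S v] by blast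
  define s where "s = nat \<bar>k\<bar> + 1"
  have s: "k \<le> int s" "0 < int s" by (auto simp: s_def)
  have "int s * 1 \<le> int s * v y" using y(2) by (intro mult_left_mono) auto
  then have vs: "int s \<le> v (y ^ s)" by (simp add: place_power v)
  then have "y ^ s \<in> pw v (v 1 + 1)" using s by (auto simp: pw_def v)
  from place_add_eq[OF v(1) one_neq_zero this] have u: "1 + y ^ s \<noteq> 0" "v (1 + y ^ s) = 0"
    using v by auto
  have "1 / (1 + y ^ s) - 1 = - (y ^ s / (1 + y ^ s))" using u by (simp add: field_simps)
  moreover have "y ^ s / (1 + y ^ s) \<in> pw v k"
    using u y vs s by (simp add: pw_iff place_divide v)
  ultimately have "1 / (1 + y ^ s) - 1 \<in> pw v k" using v by simp
  moreover have "1 / (1 + y ^ s) \<in> pw w k" if w: "w \<in> S" for w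
  proof -
    have wp: "w \<in> places emb" using w S by auto
    have "int s * w y \<le> int s * (- 1)" using y(3)[OF w] by (intro mult_left_mono) auto
    then have ws: "w (y ^ s) \<le> - int s" by (simp add: place_power wp)
    then have "1 \<in> pw w (w (y ^ s) + 1)" using s by (simp add: pw_iff wp)
    from place_add_eq(2)[OF wp _ this] have "w (1 + y ^ s) = w (y ^ s)" using y(1) by (simp add: add.commute)
    then show ?thesis using u s ws by (simp add: pw_iff place_divide wp)
  qed
  ultimately show ?thesis by blast
qed

text \<open>The combination of the \<open>a v\<close> with functions near 1 at \<open>v\<close> and
  near 0 at the other places of \<open>S\<close>. Their precision is \<open>k + m\<close>, where
  \<open>m\<close> bounds the poles of all \<open>a v\<close> on \<open>S\<close>.\<close>

lemma weak_approximation: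
  assumes S: "finite S" "S \<subseteq> places emb"
  shows "\<exists>x. \<forall>v\<in>S. x - a v \<in> pw v k"
proof -
  define m where "m = (\<Sum>u\<in>S. \<Sum>v\<in>S. \<bar>u (a v)\<bar>)"
  have am: "a v \<in> pw u (- m)" if "u \<in> S" "v \<in> S" for u v
  proof -
    have "\<bar>u (a v)\<bar> \<le> (\<Sum>v\<in>S. \<bar>u (a v)\<bar>)" using S that by (intro member_le_sum) auto
    also have "\<dots> \<le> m" unfolding m_def using S that by (intro member_le_sum[of u S "\<lambda>u. \<Sum>v\<in>S. \<bar>u (a v)\<bar>"] sum_nonneg) auto
    finally show ?thesis by (auto simp: pw_def)
  qed
  have "\<forall>v\<in>S. \<exists>x. x - 1 \<in> pw v (k + m) \<and> (\<forall>w\<in>S - {v}. x \<in> pw w (k + m))"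
    using S by (intro ballI exists_near_one) auto
  then obtain e where e: "\<And>v. v \<in> S \<Longrightarrow> e v - 1 \<in> pw v (k + m)"
    "\<And>v w. v \<in> S \<Longrightarrow> w \<in> S - {v} \<Longrightarrow> e v \<in> pw w (k + m)" by metis
  have "(\<Sum>v\<in>S. e v * a v) - a u \<in> pw u k" if u: "u \<in> S" for u
  proof -
    have up: "u \<in> places emb" using u S by auto
    have "(\<Sum>v\<in>S. e v * a v) - a u = (e u - 1) * a u + (\<Sum>v\<in>S - {u}. e v * a v)"
      using S u by (simp add: sum.remove[of _ u] algebra_simps)
    also have "\<dots> \<in> pw u (k + m + - m)"
      using u by (intro pw_add pw_sum pw_mult up e am) auto
    finally show ?thesis by simp
  qed
  then show ?thesis by blast
qed

section \<open>Divisors and Riemann-Roch spaces\<close>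

abbreviation pdeg :: "('k \<Rightarrow> int) \<Rightarrow> nat" where "pdeg \<equiv> place_degree emb"

text \<open>By weak approximation \<open>R / I\<close> is at least as large as the product of the
  local quotients of \<open>pw v 0\<close> by \<open>pw v (v z)\<close>, which has \<open>q\<close>
  to the weighted number of zeros elements; \<open>basis_mod_zeros\<close> bounds
  \<open>R / I\<close> from above.\<close>

lemma sum_zeros_le:
  assumes S: "finite S" "S \<subseteq> places emb" and z: "z \<noteq> 0" and pos: "\<And>v. v \<in> S \<Longrightarrow> 0 < v z"
  shows "(\<Sum>v\<in>S. nat (v z) * pdeg v) \<le> ext_deg z"
proof -
  define R where "R = (\<Inter>v\<in>S. pw v 0)"
  define I where "I = (\<Inter>v\<in>S. pw v (v z))"
  have sub: "vs.subspace I" "vs.subspace R"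
    unfolding I_def R_def using S by (auto intro!: Int_subspace pw_subspace)
  have Isg: "add_subgroup I" using sub subspace_add_subgroup by blast
  have "\<exists>B. finite B \<and> B \<subseteq> R \<and> card B \<le> ext_deg z \<and>
     (\<forall>x\<in>R. \<exists>!c. c \<in> B \<rightarrow>\<^sub>E (UNIV :: 'f set) \<and> x - (\<Sum>b\<in>B. emb (c b) * b) \<in> I)"
    unfolding R_def I_def by (rule basis_mod_zeros) (use S z pos in auto)
  then obtain B where B: "finite B" "B \<subseteq> R" "card B \<le> ext_deg z"
    "\<forall>x\<in>R. \<exists>!c. c \<in> B \<rightarrow>\<^sub>E (UNIV :: 'f set) \<and> x - (\<Sum>b\<in>B. emb (c b) * b) \<in> I"
    by (elim exE conjE)
  note cR = card_cosets_basis[OF sub B(1,2) B(4)[rule_format]]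
  define T where "T = (\<Pi>\<^sub>E v\<in>S. cosets (pw v 0) (pw v (v z)))"
  \<comment> \<open>Approximation comes with one exponent for all places; the sum dominates every
    \<open>v z\<close>.\<close>
  define K where "K = (\<Sum>v\<in>S. v z)"
  have K: "v z \<le> K" if "v \<in> S" for v
    unfolding K_def using S that pos by (intro member_le_sum[of v S "\<lambda>v. v z"]) (auto intro: less_imp_le)
  have "\<forall>C\<in>T. \<exists>x. x \<in> R \<and> (\<forall>v\<in>S. C v = (+) x ` pw v (v z))"
  proof
    fix C assume C: "C \<in> T"
    have "\<forall>v\<in>S. \<exists>r. r \<in> pw v 0 \<and> C v = (+) r ` pw v (v z)"
      using C unfolding T_def cosets_def by blast
    then obtain r where r: "\<And>v. v \<in> S \<Longrightarrow> r v \<in> pw v 0 \<and> C v = (+) (r v) ` pw v (v z)" by metis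
    obtain x where x: "\<And>v. v \<in> S \<Longrightarrow> x - r v \<in> pw v K" using weak_approximation[OF S] by blast
    have xz: "x - r v \<in> pw v (v z)" if "v \<in> S" for v using x[OF that] K[OF that] by (rule pw_mono)
    have "x \<in> pw v 0" if v: "v \<in> S" for v
    proof -
      have vp: "v \<in> places emb" using v S by auto
      have "x - r v \<in> pw v 0" by (rule pw_mono[OF xz[OF v]]) (use pos[OF v] in simp)
      then have "(x - r v) + r v \<in> pw v 0" using r[OF v] by (intro pw_add[OF vp]) auto
      then show ?thesis by simp
    qed
    moreover have "C v = (+) x ` pw v (v z)" if v: "v \<in> S" for v
    proof -
      have vp: "v \<in> places emb" using v S by auto
      have "(+) x ` pw v (v z) = (+) (r v) ` pw v (v z)"
        unfolding coset_eq_iff[OF pw_subgroup[OF vp]] by (rule xz[OF v])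
      then show ?thesis using r[OF v] by simp
    qed
    ultimately show "\<exists>x. x \<in> R \<and> (\<forall>v\<in>S. C v = (+) x ` pw v (v z))" unfolding R_def by blast
  qed
  then obtain Xs where Xs: "\<And>C. C \<in> T \<Longrightarrow> Xs C \<in> R" "\<And>C v. C \<in> T \<Longrightarrow> v \<in> S \<Longrightarrow> C v = (+) (Xs C) ` pw v (v z)"
    by metis
  have "inj_on (\<lambda>C. (+) (Xs C) ` I) T"
  proof (rule inj_onI)
    fix C D assume C: "C \<in> T" and D: "D \<in> T" and "(+) (Xs C) ` I = (+) (Xs D) ` I"
    then have d: "Xs C - Xs D \<in> I" unfolding coset_eq_iff[OF Isg] by simp
    have "C v = D v" if v: "v \<in> S" for v
    proof -
      have vp: "v \<in> places emb" using v S by auto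
      have "Xs C - Xs D \<in> pw v (v z)" using d v unfolding I_def by blast
      then have "(+) (Xs C) ` pw v (v z) = (+) (Xs D) ` pw v (v z)"
        unfolding coset_eq_iff[OF pw_subgroup[OF vp]] .
      then show ?thesis using Xs(2)[OF C v] Xs(2)[OF D v] by simp
    qed
    then show "C = D" using C D unfolding T_def by (intro PiE_ext)
  qed
  moreover have "(\<lambda>C. (+) (Xs C) ` I) ` T \<subseteq> cosets R I" using Xs(1) unfolding cosets_def by blast
  ultimately have "card T \<le> card (cosets R I)" using cR(1) by (rule card_inj_on_le)
  moreover have "card T = (\<Prod>v\<in>S. q ^ (nat (v z) * pdeg v))"
    unfolding T_def
  proof (subst card_PiE[OF S(1)], rule prod.cong)
    fix v assume v: "v \<in> S"
    then have "card (cosets (pw v 0) (pw v (0 + int (nat (v z))))) = q ^ (nat (v z) * pdeg v)"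
      using S by (intro cosets_pw) auto
    then show "card (cosets (pw v 0) (pw v (v z))) = q ^ (nat (v z) * pdeg v)" using pos[OF v] by simp
  qed simp
  ultimately have "q ^ (\<Sum>v\<in>S. nat (v z) * pdeg v) \<le> q ^ card B"
    using cR(2) by (simp add: power_sum)
  then have "(\<Sum>v\<in>S. nat (v z) * pdeg v) \<le> card B" using q_ge_2 by (simp add: power_increasing_iff)
  then show ?thesis using B(3) by simp
qed

lemma finite_zeros:
  assumes "z \<noteq> 0"
  shows "finite {v \<in> places emb. 0 < v z}"
proof (rule ccontr)
  assume inf: "infinite {v \<in> places emb. 0 < v z}"
  obtain S where S: "S \<subseteq> {v \<in> places emb. 0 < v z}" "finite S" "card S = Suc (ext_deg z)"
    using infinite_arbitrarily_large[OF inf, of "Suc (ext_deg z)"] by blast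
  have "card S = (\<Sum>v\<in>S. 1)" by simp
  also have "\<dots> \<le> (\<Sum>v\<in>S. nat (v z) * pdeg v)"
  proof (rule sum_mono)
    fix v assume "v \<in> S"
    then have "0 < nat (v z)" "0 < pdeg v" using S place_degree_pos by auto
    then show "1 \<le> nat (v z) * pdeg v" by (simp add: Suc_le_eq)
  qed
  also have "\<dots> \<le> ext_deg z" using S assms by (intro sum_zeros_le) auto
  finally show False using S by simp
qed

lemma finite_places_nonzero:
  assumes "z \<noteq> 0"
  shows "finite {v \<in> places emb. v z \<noteq> 0}"
proof -
  have "{v \<in> places emb. v z \<noteq> 0} \<subseteq> {v \<in> places emb. 0 < v z} \<union> {v \<in> places emb. 0 < v (inverse z)}"
    by (auto simp: place_inverse)
  then show ?thesis
    using finite_zeros[OF assms] finite_zeros[of "inverse z"] assms by (auto intro: finite_subset)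
qed

abbreviation Div :: "'k divisor set" where "Div \<equiv> divisors emb"
abbreviation Eff :: "'k divisor set" where "Eff \<equiv> effective_divisors emb"
abbreviation deg :: "'k divisor \<Rightarrow> int" where "deg \<equiv> divisor_degree emb"
abbreviation pdiv :: "'k \<Rightarrow> 'k divisor" where "pdiv \<equiv> principal_divisor emb"
abbreviation L :: "'k divisor \<Rightarrow> 'k set" where "L \<equiv> riemann_roch_space emb"

section \<open>Arithmetic of divisors and their degrees\<close>

lemma deg_eq_sum:
  assumes "finite A" "{v. D v \<noteq> 0} \<subseteq> A"
  shows "deg D = (\<Sum>v\<in>A. int (pdeg v) * D v)"
  unfolding divisor_degree_def using assms by (intro sum.mono_neutral_left) auto

lemma DivD: "D \<in> Div \<Longrightarrow> finite {v. D v \<noteq> 0}" "D \<in> Div \<Longrightarrow> D v \<noteq> 0 \<Longrightarrow> v \<in> places emb"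
  by (auto simp: divisors_def)

lemma Div_0 [simp]: "(\<lambda>_. 0) \<in> Div" by (simp add: divisors_def)

lemma deg_0 [simp]: "deg (\<lambda>_. 0) = 0" by (simp add: divisor_degree_def)

lemma Div_pointwise:
  assumes D: "D \<in> Div" and E: "E \<in> Div" and f: "f 0 0 = 0"
  shows "(\<lambda>v. f (D v) (E v)) \<in> Div"
proof -
  have s: "{v. f (D v) (E v) \<noteq> 0} \<subseteq> {v. D v \<noteq> 0} \<union> {v. E v \<noteq> 0}" using f by auto
  then have "finite {v. f (D v) (E v) \<noteq> 0}" using D E DivD(1) by (auto intro: finite_subset)
  then show ?thesis using s DivD(2)[OF D] DivD(2)[OF E] by (auto simp: divisors_def)
qed

lemma Div_add: "D \<in> Div \<Longrightarrow> E \<in> Div \<Longrightarrow> (\<lambda>v. D v + E v) \<in> Div"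
  and Div_diff: "D \<in> Div \<Longrightarrow> E \<in> Div \<Longrightarrow> (\<lambda>v. D v - E v) \<in> Div"
  and Div_uminus: "D \<in> Div \<Longrightarrow> (\<lambda>v. - D v) \<in> Div"
  and Div_scale: "D \<in> Div \<Longrightarrow> (\<lambda>v. k * D v) \<in> Div"
  and Div_max: "D \<in> Div \<Longrightarrow> E \<in> Div \<Longrightarrow> (\<lambda>v. max (D v) (E v)) \<in> Div"
  using Div_pointwise[of D E "(+)"] Div_pointwise[of D E "(-)"] Div_pointwise[of D D "\<lambda>a _. - a"]
    Div_pointwise[of D D "\<lambda>a _. k * a"] Div_pointwise[of D E max] by auto

lemma deg_add:
  assumes "D \<in> Div" "E \<in> Div"
  shows "deg (\<lambda>v. D v + E v) = deg D + deg E"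
proof -
  let ?A = "{v. D v \<noteq> 0} \<union> {v. E v \<noteq> 0}"
  have A: "finite ?A" using assms DivD(1) by blast
  have "deg (\<lambda>v. D v + E v) = (\<Sum>v\<in>?A. int (pdeg v) * (D v + E v))" by (rule deg_eq_sum[OF A]) auto
  also have "\<dots> = (\<Sum>v\<in>?A. int (pdeg v) * D v) + (\<Sum>v\<in>?A. int (pdeg v) * E v)"
    by (simp add: distrib_left sum.distrib)
  also have "\<dots> = deg D + deg E" using deg_eq_sum[OF A, of D] deg_eq_sum[OF A, of E] by auto
  finally show ?thesis .
qed

lemma deg_scale:
  assumes "D \<in> Div"
  shows "deg (\<lambda>v. k * D v) = k * deg D"
proof -
  have "deg (\<lambda>v. k * D v) = (\<Sum>v\<in>{v. D v \<noteq> 0}. int (pdeg v) * (k * D v))"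
    using assms DivD(1) by (intro deg_eq_sum) auto
  then show ?thesis by (simp add: divisor_degree_def sum_distrib_left mult_ac)
qed

lemma deg_uminus: "D \<in> Div \<Longrightarrow> deg (\<lambda>v. - D v) = - deg D"
  using deg_scale[of D "- 1"] by simp

lemma deg_diff:
  assumes "D \<in> Div" "E \<in> Div"
  shows "deg (\<lambda>v. D v - E v) = deg D - deg E"
  using deg_add[OF assms(1) Div_uminus[OF assms(2)]] deg_uminus[OF assms(2)] by simp

lemma EffD: "A \<in> Eff \<Longrightarrow> A \<in> Div" "A \<in> Eff \<Longrightarrow> 0 \<le> A v"
  by (auto simp: effective_divisors_def)

lemma EffI: "A \<in> Div \<Longrightarrow> (\<And>v. 0 \<le> A v) \<Longrightarrow> A \<in> Eff"
  by (auto simp: effective_divisors_def)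

lemma Eff_0 [simp]: "(\<lambda>_. 0) \<in> Eff" by (simp add: EffI)

lemma Eff_add:
  assumes "A \<in> Eff" "B \<in> Eff" shows "(\<lambda>v. A v + B v) \<in> Eff"
  using EffD(2)[OF assms(1)] EffD(2)[OF assms(2)] by (intro EffI Div_add EffD(1)[OF assms(1)] EffD(1)[OF assms(2)]) simp

lemma deg_Eff:
  assumes "A \<in> Eff" shows "0 \<le> deg A"
  unfolding divisor_degree_def using EffD(2)[OF assms] by (intro sum_nonneg) simp

lemma deg_mono:
  assumes "D \<in> Div" "E \<in> Div" "\<And>v. D v \<le> E v"
  shows "deg D \<le> deg E"
  using deg_Eff[of "\<lambda>v. E v - D v"] deg_diff[OF assms(2,1)] assms by (simp add: EffI Div_diff)

lemma Eff_coeff_le_deg: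
  assumes A: "A \<in> Eff"
  shows "int (pdeg v) * A v \<le> deg A"
proof (cases "A v = 0")
  case False
  then show ?thesis unfolding divisor_degree_def
    using DivD(1)[OF EffD(1)[OF A]] EffD(2)[OF A]
    by (intro member_le_sum[of v "{v. A v \<noteq> 0}" "\<lambda>v. int (pdeg v) * A v"]) auto
qed (simp add: deg_Eff[OF A])

lemma Eff_deg_0:
  assumes A: "A \<in> Eff" "deg A = 0" shows "A = (\<lambda>_. 0)"
proof
  fix v
  show "A v = 0"
  proof (rule ccontr)
    assume "A v \<noteq> 0"
    then have "0 < int (pdeg v)" "0 < A v"
      using DivD(2)[OF EffD(1)[OF A(1)]] place_degree_pos EffD(2)[OF A(1), of v] by auto
    then have "0 < int (pdeg v) * A v" by simp
    then show False using Eff_coeff_le_deg[OF A(1), of v] A(2) by linarith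
  qed
qed

lemma Div_upd:
  assumes "D \<in> Div" "v \<in> places emb"
  shows "D(v := k) \<in> Div"
proof -
  have s: "{w. (D(v := k)) w \<noteq> 0} \<subseteq> insert v {w. D w \<noteq> 0}" by auto
  have "finite {w. (D(v := k)) w \<noteq> 0}" by (rule finite_subset[OF s]) (simp add: DivD(1)[OF assms(1)])
  then show ?thesis using assms by (auto simp: divisors_def split: if_splits)
qed

lemma deg_upd:
  assumes D: "D \<in> Div" and v: "v \<in> places emb"
  shows "deg (D(v := k)) = deg D + int (pdeg v) * (k - D v)"
proof -
  let ?A = "insert v {w. D w \<noteq> 0}"
  have A: "finite ?A" "v \<in> ?A" using DivD(1)[OF D] by auto
  have "deg (D(v := k)) = (\<Sum>w\<in>?A. int (pdeg w) * (D(v := k)) w)" by (rule deg_eq_sum[OF A(1)]) auto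
  also have "\<dots> = int (pdeg v) * k + (\<Sum>w\<in>?A - {v}. int (pdeg w) * D w)"
  proof -
    have "(\<Sum>w\<in>?A - {v}. int (pdeg w) * (D(v := k)) w) = (\<Sum>w\<in>?A - {v}. int (pdeg w) * D w)"
      by (rule sum.cong) simp_all
    then show ?thesis using sum.remove[OF A, of "\<lambda>w. int (pdeg w) * (D(v := k)) w"] by simp
  qed
  also have "(\<Sum>w\<in>?A - {v}. int (pdeg w) * D w) = deg D - int (pdeg v) * D v"
  proof -
    have "deg D = (\<Sum>w\<in>?A. int (pdeg w) * D w)" by (rule deg_eq_sum[OF A(1)]) auto
    then show ?thesis using sum.remove[OF A, of "\<lambda>w. int (pdeg w) * D w"] by simp
  qed
  finally have "deg (D(v := k)) = int (pdeg v) * k + (deg D - int (pdeg v) * D v)" .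
  then show ?thesis unfolding right_diff_distrib by linarith
qed

text \<open>A step adds the whole multiplicity at one new place, matching the quotients counted in
  \<open>cosets_pw\<close>.\<close>

lemma Eff_induct [consumes 1, case_names zero upd]:
  assumes A: "A \<in> Eff"
    and zero: "P (\<lambda>_. 0)"
    and upd: "\<And>A v m. A \<in> Eff \<Longrightarrow> v \<in> places emb \<Longrightarrow> A v = 0 \<Longrightarrow> P A \<Longrightarrow> P (A(v := int m))"
  shows "P A"
proof -
  have "P A" if "finite S" "{v. A v \<noteq> 0} \<subseteq> S" "A \<in> Eff" for S A
    using that
  proof (induction S arbitrary: A)
    case empty
    then have "A = (\<lambda>_. 0)" by auto
    then show ?case using zero by simp
  next
    case (insert v S)
    show ?case
    proof (cases "A v = 0")
      case True
      then show ?thesis using insert by (intro insert.IH) auto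
    next
      case False
      then have v: "v \<in> places emb" using insert.prems EffD(1) DivD(2) by blast
      have E: "A(v := 0) \<in> Eff"
      proof (rule EffI)
        show "A(v := 0) \<in> Div" by (rule Div_upd[OF EffD(1)[OF insert.prems(2)] v])
        show "0 \<le> (A(v := 0)) w" for w using EffD(2)[OF insert.prems(2), of w] by simp
      qed
      have "{w. (A(v := 0)) w \<noteq> 0} \<subseteq> S" using insert.prems(1) by auto
      then have "P (A(v := 0))" using E by (rule insert.IH)
      then have "P ((A(v := 0))(v := int (nat (A v))))" using E v by (intro upd) auto
      moreover have "(A(v := 0))(v := int (nat (A v))) = A"
        using EffD(2)[OF insert.prems(2), of v] by auto
      ultimately show ?thesis by simp
    qed
  qed
  then show ?thesis using A DivD(1)[OF EffD(1)[OF A]] by blast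
qed

section \<open>Riemann-Roch spaces\<close>

lemma L_iff: "f \<noteq> 0 \<Longrightarrow> f \<in> L D \<longleftrightarrow> (\<forall>v\<in>places emb. - D v \<le> v f)"
  by (auto simp: riemann_roch_space_def)

lemma L_0 [simp]: "0 \<in> L D" by (simp add: riemann_roch_space_def)

lemma L_pw: "f \<in> L D \<longleftrightarrow> f = 0 \<or> (\<forall>v\<in>places emb. f \<in> pw v (- D v))"
  by (cases "f = 0") (auto simp: L_iff pw_iff)

lemma L_mono:
  assumes "\<And>v. D v \<le> E v" shows "L D \<subseteq> L E"
proof
  fix f assume "f \<in> L D"
  moreover have "pw v (- D v) \<subseteq> pw v (- E v)" for v using assms[of v] by (auto intro: pw_mono)
  ultimately show "f \<in> L E" unfolding L_pw by blast
qed

lemma L_subspace: "vs.subspace (L D)"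
  unfolding vs.subspace_def
proof (intro conjI ballI allI)
  show "x + y \<in> L D" if "x \<in> L D" "y \<in> L D" for x y
    unfolding L_pw using that by (intro disjI2 ballI pw_add) (auto simp: L_pw)
  show "emb c * x \<in> L D" if "x \<in> L D" for c x
    unfolding L_pw using that by (intro disjI2 ballI pw_mult_0) (auto simp: L_pw)
qed simp

lemmas L_subgroup = subspace_add_subgroup[OF L_subspace]

text \<open>The inverse of a nonconstant \<open>f\<close> is nonconstant, hence transcendental by
  \<open>constants_closed\<close>, and vanishes at some place; there \<open>f\<close> has a
  pole.\<close>

lemma L_trivial: "L (\<lambda>_. 0) = range emb"
proof
  show "range emb \<subseteq> L (\<lambda>_. 0)" by (auto simp: riemann_roch_space_def)
  show "L (\<lambda>_. 0) \<subseteq> range emb"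
  proof
    fix f assume f: "f \<in> L (\<lambda>_. 0)"
    show "f \<in> range emb"
    proof (rule ccontr)
      assume nf: "f \<notin> range emb"
      have "f \<noteq> 0"
      proof
        assume "f = 0"
        then have "f = emb 0" by simp
        then show False using nf by blast
      qed
      have "inverse f \<notin> range emb"
      proof
        assume "inverse f \<in> range emb"
        then obtain c where "inverse f = emb c" by blast
        then have "f = emb (inverse c)" by (simp add: emb_inverse flip: \<open>inverse f = emb c\<close>)
        then show False using nf by blast
      qed
      then obtain v where v: "v \<in> places emb" "0 < v (inverse f)"
        using exists_zero_place constants_closed by blast
      then show False using f \<open>f \<noteq> 0\<close> by (auto simp: L_iff place_inverse)
    qed
  qed
qed

lemma card_L_trivial: "finite (L (\<lambda>_. 0))" "card (L (\<lambda>_. 0)) = q"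
  unfolding L_trivial by (simp_all add: q_def)

text \<open>Allowing \<open>m\<close> further poles at \<open>v\<close> enlarges the space by a
  factor of at most \<open>q ^ (m * pdeg v)\<close>, the size of the space of principal parts: the
  functions whose principal part vanishes form the previous space.\<close>

lemma card_L_add_Eff:
  assumes "A \<in> Eff" "finite (L D)"
  shows "finite (L (\<lambda>v. D v + A v)) \<and> card (L (\<lambda>v. D v + A v)) \<le> q ^ nat (deg A) * card (L D)"
  using assms(1)
proof (induction rule: Eff_induct)
  case (upd A v m)
  let ?E = "\<lambda>w. D w + A w" and ?E' = "\<lambda>w. D w + (A(v := int m)) w"
  have ker: "{f \<in> L ?E'. f \<in> pw v (- D v)} = L ?E"
  proof (intro equalityI subsetI)
    fix f assume f: "f \<in> {f \<in> L ?E'. f \<in> pw v (- D v)}"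
    show "f \<in> L ?E"
    proof (cases "f = 0")
      case False
      have "- ?E w \<le> w f" if "w \<in> places emb" for w
        using f that False upd(3) by (cases "w = v") (auto simp: L_iff pw_iff)
      then show ?thesis using False by (simp add: L_iff)
    qed simp
  next
    fix f assume f: "f \<in> L ?E"
    have "L ?E \<subseteq> L ?E'" using upd(3) by (intro L_mono) auto
    moreover have "f \<in> pw v (- ?E v)" using f upd(2) by (cases "f = 0") (auto simp: L_pw simp del: pw_iff)
    ultimately show "f \<in> {f \<in> L ?E'. f \<in> pw v (- D v)}"
      using f upd(3) by auto
  qed
  have im: "(\<lambda>f. f) ` L ?E' \<subseteq> pw v (- D v - int m)"
    using upd(2) by (auto simp: L_pw dest!: bspec[of _ _ v])
  have cs: "finite (cosets (pw v (- D v - int m)) (pw v (- D v)))"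
    "card (cosets (pw v (- D v - int m)) (pw v (- D v))) = q ^ (m * pdeg v)"
    using cosets_pw[OF upd(2), of "- D v - int m" m] by auto
  have fin: "finite {f \<in> L ?E'. f \<in> pw v (- D v)}" unfolding ker using upd(4) by blast
  have le: "finite (L ?E') \<and> card (L ?E') \<le> q ^ (m * pdeg v) * card (L ?E)"
    using card_le_cosets_kernel[OF pw_subgroup[OF upd(2)] L_subgroup _ im cs(1) fin] cs(2) ker by simp
  have "deg (A(v := int m)) = deg A + int (m * pdeg v)"
    using deg_upd[OF EffD(1)[OF upd(1)] upd(2)] upd(3) by simp
  then have "nat (deg (A(v := int m))) = m * pdeg v + nat (deg A)"
    using deg_Eff[OF upd(1)] by linarith
  moreover have "q ^ (m * pdeg v) * card (L ?E) \<le> q ^ (m * pdeg v) * (q ^ nat (deg A) * card (L D))"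
    using upd(4) by (intro mult_le_mono2) auto
  ultimately have "card (L ?E') \<le> q ^ nat (deg (A(v := int m))) * card (L D)"
    using le order_trans unfolding power_add mult.assoc by (simp only: power_add mult.assoc) (meson order_trans)
  then show ?case using le by blast
qed (use assms(2) in simp)

lemma card_L_Eff:
  assumes "A \<in> Eff"
  shows "finite (L A)" and "card (L A) \<le> q ^ (nat (deg A) + 1)"
  using card_L_add_Eff[OF assms card_L_trivial(1)] by (simp_all add: card_L_trivial mult.commute)

lemma finite_L: assumes D: "D \<in> Div" shows "finite (L D)"
proof -
  have "(\<lambda>v. max (D v) 0) \<in> Eff" using Div_max[OF D Div_0] by (intro EffI) auto
  then have "finite (L (\<lambda>v. max (D v) 0))" by (rule card_L_Eff)
  then show ?thesis by (rule finite_subset[OF L_mono, rotated]) simp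
qed

lemma card_L: assumes D: "D \<in> Div" shows "card (L D) = q ^ riemann_roch_dim emb D"
  unfolding riemann_roch_dim_def using L_subspace finite_L[OF D] by (rule card_subspace)

lemma card_L_mono:
  assumes D: "D \<in> Div" and E: "E \<in> Div" and le: "\<And>v. D v \<le> E v"
  shows "card (L E) \<le> q ^ nat (deg E - deg D) * card (L D)"
proof -
  have "(\<lambda>v. E v - D v) \<in> Eff" using Div_diff[OF E D] le by (intro EffI) auto
  from card_L_add_Eff[OF this finite_L[OF D]] show ?thesis by (simp add: deg_diff E D)
qed

section \<open>Polar divisors and the degree of principal divisors\<close>

definition poles :: "'k \<Rightarrow> 'k divisor" where
  "poles z v = (if v \<in> places emb then max 0 (- v z) else 0)"

lemma poles_Eff:
  assumes "z \<noteq> 0" shows "poles z \<in> Eff"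
proof (rule EffI)
  have "{v. poles z v \<noteq> 0} \<subseteq> {v \<in> places emb. v z \<noteq> 0}" by (auto simp: poles_def split: if_splits)
  then show "poles z \<in> Div"
    using finite_places_nonzero[OF assms] by (auto simp: divisors_def intro: finite_subset)
qed (simp add: poles_def)

lemma deg_poles_le:
  assumes "z \<noteq> 0" shows "deg (poles z) \<le> int (ext_deg (inverse z))"
proof -
  let ?S = "{v. poles z v \<noteq> 0}"
  have fin: "finite ?S" using DivD(1)[OF EffD(1)[OF poles_Eff[OF assms]]] .
  have S: "?S \<subseteq> places emb" "\<And>v. v \<in> ?S \<Longrightarrow> 0 < v (inverse z) \<and> poles z v = v (inverse z)"
    by (auto simp: poles_def place_inverse split: if_splits)
  have "deg (poles z) = (\<Sum>v\<in>?S. int (nat (v (inverse z)) * pdeg v))"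
    unfolding divisor_degree_def
  proof (rule sum.cong[OF refl])
    fix v assume "v \<in> ?S"
    then show "int (pdeg v) * poles z v = int (nat (v (inverse z)) * pdeg v)"
      using S(2)[of v] by simp
  qed
  also have "\<dots> \<le> int (ext_deg (inverse z))"
    unfolding of_nat_sum[symmetric] of_nat_le_iff
  proof (rule sum_zeros_le[OF fin S(1)])
    show "0 < v (inverse z)" if "v \<in> ?S" for v using S(2)[OF that] ..
  qed (use assms in simp)
  finally show ?thesis .
qed

text \<open>For a maximal independent family \<open>Y\<close> the products \<open>z ^ i * y\<close>
  with \<open>i \<le> k\<close> are independent over the constants. Their poles are bounded by
  \<open>k\<close> times those of \<open>z\<close> plus the total \<open>C\<close> of the poles of
  \<open>Y\<close>, which does not depend on \<open>k\<close>.\<close>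

lemma card_L_poles_ge:
  assumes z: "z \<noteq> 0"
  shows "\<exists>C\<in>Eff. \<forall>k::nat. q ^ ((k + 1) * ext_deg z) \<le> card (L (\<lambda>v. int k * poles z v + C v))"
proof -
  obtain Y where Y: "indep_over z Y" "card Y = ext_deg z" using exists_indep_over_ext_deg by blast
  have finY: "finite Y" using Y by (simp add: indep_over_def)
  have Y0: "y \<noteq> 0" if "y \<in> Y" for y
  proof
    assume "y = 0"
    then have "(\<Sum>u\<in>Y. ev z (if u = y then 1 else 0) * u) = 0"
      by (intro sum.neutral) auto
    from indep_overD[OF Y(1) this that] show False by simp
  qed
  define C where "C v = (\<Sum>y\<in>Y. poles y v)" for v
  have C: "C \<in> Eff"
    unfolding C_def using finY Y0
    by (induction Y rule: finite_induct) (simp_all add: Eff_add poles_Eff)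
  have "q ^ ((k + 1) * ext_deg z) \<le> card (L (\<lambda>v. int k * poles z v + C v))" for k
  proof -
    let ?D = "\<lambda>v. int k * poles z v + C v"
    have D: "?D \<in> Div" by (intro Div_add Div_scale EffD(1)[OF C] EffD(1)[OF poles_Eff[OF z]])
    let ?T = "Y \<rightarrow>\<^sub>E {p :: 'f poly. degree p \<le> k}"
    let ?s = "\<lambda>P. \<Sum>y\<in>Y. ev z (P y) * y"
    have "inj_on ?s ?T"
    proof (rule inj_onI)
      fix P Q assume P: "P \<in> ?T" and Q: "Q \<in> ?T" and "?s P = ?s Q"
      then have "(\<Sum>y\<in>Y. ev z (P y - Q y) * y) = 0"
        by (simp add: left_diff_distrib sum_subtractf)
      then have "P y = Q y" if "y \<in> Y" for y
        using indep_overD[OF Y(1) _ that, of "\<lambda>y. P y - Q y"] by simp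
      then show "P = Q" using P Q by (intro PiE_ext)
    qed
    moreover have "?s ` ?T \<subseteq> L ?D"
    proof (rule image_subsetI)
      fix P assume P: "P \<in> ?T"
      have tm: "z ^ i * y \<in> L ?D" if "i \<le> k" "y \<in> Y" for i y
      proof -
        have "- ?D v \<le> v (z ^ i * y)" if v: "v \<in> places emb" for v
        proof -
          have "poles y v \<le> C v" unfolding C_def
            using finY \<open>y \<in> Y\<close> by (intro member_le_sum) (auto simp: poles_def)
          moreover have "- v y \<le> poles y v" "- v z \<le> poles z v" "0 \<le> poles z v" using v by (auto simp: poles_def)
          moreover have "int i * (- v z) \<le> int k * poles z v"
          proof -
            have "int i * (- v z) \<le> int i * poles z v" using \<open>- v z \<le> poles z v\<close> by (intro mult_left_mono) auto
            also have "\<dots> \<le> int k * poles z v" using \<open>0 \<le> poles z v\<close> \<open>i \<le> k\<close> by (intro mult_right_mono) auto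
            finally show ?thesis .
          qed
          ultimately show ?thesis
            using v z Y0[OF \<open>y \<in> Y\<close>] by (simp add: place_mult[OF v] place_power)
        qed
        then show ?thesis using z Y0[OF \<open>y \<in> Y\<close>] by (simp add: L_iff)
      qed
      have "ev z (P y) * y = (\<Sum>i\<le>k. emb (coeff (P y) i) * (z ^ i * y))" if y: "y \<in> Y" for y
      proof -
        have "P y = (\<Sum>i\<le>k. monom (coeff (P y) i) i)"
          using P y by (intro poly_as_sum_of_monoms'[symmetric]) auto
        then have "ev z (P y) = ev z (\<Sum>i\<le>k. monom (coeff (P y) i) i)" by (rule arg_cong)
        then show ?thesis by (simp add: ev_sum sum_distrib_right mult.assoc)
      qed
      then have "?s P = (\<Sum>y\<in>Y. \<Sum>i\<le>k. emb (coeff (P y) i) * (z ^ i * y))" by simp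
      also have "\<dots> \<in> L ?D"
        by (intro vs.subspace_sum[OF L_subspace] vs.subspace_scale[OF L_subspace] tm) auto
      finally show "?s P \<in> L ?D" .
    qed
    ultimately have "card ?T \<le> card (L ?D)" using finite_L[OF D] by (rule card_inj_on_le)
    moreover have "card ?T = q ^ ((k + 1) * ext_deg z)"
      using finY Y(2) by (simp only: card_PiE card_polys_degree_le prod_constant power_mult CARD_eq_q)
    ultimately show ?thesis by simp
  qed
  then show ?thesis using C by blast
qed

text \<open>The lower bound of \<open>card_L_poles_ge\<close> grows with slope
  \<open>ext_deg z\<close> in \<open>k\<close>, the upper bound of \<open>card_L_Eff\<close> with
  slope \<open>deg (poles z)\<close>.\<close>

lemma ext_deg_le_deg_poles:
  assumes z: "z \<noteq> 0" shows "int (ext_deg z) \<le> deg (poles z)"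
proof (rule ccontr)
  assume "\<not> int (ext_deg z) \<le> deg (poles z)"
  then have lt: "deg (poles z) + 1 \<le> int (ext_deg z)" by simp
  obtain C where C: "C \<in> Eff"
    and le: "\<And>k. q ^ ((k + 1) * ext_deg z) \<le> card (L (\<lambda>v. int k * poles z v + C v))"
    using card_L_poles_ge[OF z] by blast
  \<comment> \<open>Large enough for a slope difference of 1 to outweigh the constant
    \<open>deg C\<close>.\<close>
  define k where "k = nat (deg C) + 1"
  let ?D = "\<lambda>v. int k * poles z v + C v"
  note B = EffD(1)[OF poles_Eff[OF z]]
  have D: "?D \<in> Eff"
    using EffD(2)[OF poles_Eff[OF z]] EffD(2)[OF C] by (intro EffI Div_add Div_scale EffD(1)[OF C] B) simp
  have "q ^ ((k + 1) * ext_deg z) \<le> q ^ (nat (deg ?D) + 1)"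
    using le[of k] card_L_Eff(2)[OF D] by linarith
  then have "(k + 1) * ext_deg z \<le> nat (deg ?D) + 1" by (simp only: q_power_le_iff)
  moreover have "deg ?D = int k * deg (poles z) + deg C"
    using deg_add[OF Div_scale[OF B] EffD(1)[OF C]] deg_scale[OF B] by simp
  ultimately have "(int k + 1) * int (ext_deg z) \<le> int k * deg (poles z) + deg C + 1"
    using deg_Eff[OF D] by (smt (verit) int_nat_eq of_nat_1 of_nat_add of_nat_le_iff of_nat_mult)
  moreover have "(int k + 1) * (deg (poles z) + 1) \<le> (int k + 1) * int (ext_deg z)"
    using lt by (intro mult_left_mono) auto
  ultimately show False using deg_Eff[OF C] deg_Eff[OF poles_Eff[OF z]]
    by (simp add: k_def algebra_simps)
qed

text \<open>Each of \<open>ext_deg z\<close>, \<open>deg (poles z)\<close>,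
  \<open>ext_deg (inverse z)\<close>, \<open>deg (poles (inverse z))\<close> is at most the next
  one, and the last at most the first. The zeros of \<open>z\<close> are the poles of its inverse,
  so this is the product formula.\<close>

lemma deg_poles:
  assumes z: "z \<noteq> 0"
  shows "deg (poles z) = int (ext_deg z)" and "deg (poles (inverse z)) = deg (poles z)"
  using ext_deg_le_deg_poles[OF z] ext_deg_le_deg_poles[of "inverse z"]
    deg_poles_le[OF z] deg_poles_le[of "inverse z"] z by auto

lemma pdiv_eq: "z \<noteq> 0 \<Longrightarrow> pdiv z = (\<lambda>v. poles (inverse z) v - poles z v)"
  by (rule ext) (auto simp: principal_divisor_def poles_def place_inverse)

lemma pdiv_Div: "z \<noteq> 0 \<Longrightarrow> pdiv z \<in> Div"
  using EffD(1)[OF poles_Eff] by (simp add: pdiv_eq Div_diff)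

lemma deg_pdiv: "z \<noteq> 0 \<Longrightarrow> deg (pdiv z) = 0"
  using EffD(1)[OF poles_Eff] by (simp add: pdiv_eq deg_diff deg_poles(2))

lemma deg_poles_pos:
  assumes "\<not> algebraic_over emb z" shows "0 < deg (poles z)"
proof -
  have z: "z \<noteq> 0" using assms by (rule not_algebraic_nonzero)
  obtain v where v: "v \<in> places emb" "0 < v z" using exists_zero_place[OF assms] by blast
  then have "poles (inverse z) v \<noteq> 0" by (simp add: poles_def place_inverse)
  then have "deg (poles (inverse z)) \<noteq> 0"
    using Eff_deg_0[OF poles_Eff, of "inverse z"] z by auto
  then show ?thesis using deg_Eff[OF poles_Eff[OF z]] deg_poles(2)[OF z] by linarith
qed

section \<open>Riemann's theorem\<close>

abbreviation ldim :: "'k divisor \<Rightarrow> nat" where "ldim \<equiv> riemann_roch_dim emb"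
abbreviation g :: int where "g \<equiv> genus emb"

lemma not_algebraic_iff: "\<not> algebraic_over emb z \<longleftrightarrow> z \<notin> range emb"
proof
  assume z: "\<not> algebraic_over emb z"
  show "z \<notin> range emb"
  proof
    assume "z \<in> range emb"
    then obtain c where "z = emb c" by blast
    then have "ev z [:- c, 1:] = 0" by (simp add: emb_uminus)
    then have "[:- c, 1:] = (0 :: 'f poly)" using z unfolding algebraic_iff by blast
    then show False by simp
  qed
qed (use constants_closed in blast)

lemma not_algebraic_inverse:
  assumes "\<not> algebraic_over emb z" shows "\<not> algebraic_over emb (inverse z)"
  unfolding not_algebraic_iff
proof
  assume "inverse z \<in> range emb"
  then obtain c where c: "inverse z = emb c" by blast
  have "z = inverse (inverse z)" by simp
  also have "\<dots> = emb (inverse c)" unfolding c emb_inverse ..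
  finally show False using assms unfolding not_algebraic_iff by blast
qed

lemma pdiv_apply: "v \<in> places emb \<Longrightarrow> pdiv f v = v f"
  by (simp add: principal_divisor_def)

lemma pdiv_mult: "f \<noteq> 0 \<Longrightarrow> h \<noteq> 0 \<Longrightarrow> pdiv (f * h) v = pdiv f v + pdiv h v"
  by (simp add: principal_divisor_def place_mult)

lemma pdiv_inverse: "pdiv (inverse f) v = - pdiv f v"
  by (simp add: principal_divisor_def place_inverse)

lemma pdiv_1: "pdiv 1 v = 0"
  by (simp add: principal_divisor_def)

lemma pdiv_eq_0_iff:
  assumes "f \<noteq> 0" shows "(\<forall>v. pdiv f v = 0) \<longleftrightarrow> f \<in> range emb"
proof
  assume *: "\<forall>v. pdiv f v = 0"
  have "0 \<le> v f" if "v \<in> places emb" for v using *[rule_format, of v] pdiv_apply[OF that, of f] by simp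
  then have "f \<in> L (\<lambda>_. 0)" using assms by (simp add: L_iff)
  then show "f \<in> range emb" unfolding L_trivial .
next
  assume "f \<in> range emb"
  then show "\<forall>v. pdiv f v = 0" by (auto simp: principal_divisor_def)
qed

lemma L_add_pdiv_Eff:
  assumes D: "D \<in> Div" and f: "f \<noteq> 0"
  shows "f \<in> L D \<longleftrightarrow> (\<lambda>v. D v + pdiv f v) \<in> Eff"
proof
  assume fL: "f \<in> L D"
  show "(\<lambda>v. D v + pdiv f v) \<in> Eff"
  proof (rule EffI[OF Div_add[OF D pdiv_Div[OF f]]])
    show "0 \<le> D v + pdiv f v" for v
    proof (cases "v \<in> places emb")
      case True
      then have "- D v \<le> v f" using fL f by (simp add: L_iff)
      then show ?thesis using pdiv_apply[OF True, of f] by simp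
    next
      case False
      then have "D v = 0" using DivD(2)[OF D] by blast
      then show ?thesis using False by (simp add: principal_divisor_def)
    qed
  qed
next
  assume E: "(\<lambda>v. D v + pdiv f v) \<in> Eff"
  have "- D v \<le> v f" if "v \<in> places emb" for v
    using EffD(2)[OF E, of v] pdiv_apply[OF that, of f] by simp
  then show "f \<in> L D" using f by (simp add: L_iff)
qed

lemma deg_add_pdiv: "D \<in> Div \<Longrightarrow> f \<noteq> 0 \<Longrightarrow> deg (\<lambda>v. D v + pdiv f v) = deg D"
  by (simp add: deg_add pdiv_Div deg_pdiv)

lemma ldim_eqI:
  assumes "D \<in> Div" "E \<in> Div" "card (L D) = card (L E)" shows "ldim D = ldim E"
proof -
  have "q ^ ldim D = q ^ ldim E" using assms by (simp add: card_L)
  then show ?thesis using q_power_le_iff[of "ldim D" "ldim E"] q_power_le_iff[of "ldim E" "ldim D"] by simp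
qed

lemma ldim_add_pdiv:
  assumes D: "D \<in> Div" and f: "f \<noteq> 0"
  shows "ldim (\<lambda>v. D v + pdiv f v) = ldim D"
proof (rule ldim_eqI[OF Div_add[OF D pdiv_Div[OF f]] D])
  have "bij_betw (\<lambda>h. h / f) (L D) (L (\<lambda>v. D v + pdiv f v))"
  proof (rule bij_betw_byWitness[where f' = "\<lambda>h. h * f"])
    show "(\<lambda>h. h / f) ` L D \<subseteq> L (\<lambda>v. D v + pdiv f v)"
    proof (rule image_subsetI)
      fix h assume h: "h \<in> L D"
      show "h / f \<in> L (\<lambda>v. D v + pdiv f v)"
      proof (cases "h = 0")
        case False
        then show ?thesis using h f by (simp add: L_iff place_divide pdiv_apply)
      qed simp
    qed
    show "(\<lambda>h. h * f) ` L (\<lambda>v. D v + pdiv f v) \<subseteq> L D"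
    proof (rule image_subsetI)
      fix h assume h: "h \<in> L (\<lambda>v. D v + pdiv f v)"
      show "h * f \<in> L D"
      proof (cases "h = 0")
        case False
        have "- D v \<le> v (h * f)" if v: "v \<in> places emb" for v
        proof -
          have "- (D v + pdiv f v) \<le> v h" using h v unfolding L_iff[OF False] by blast
          then show ?thesis using pdiv_apply[OF v, of f] place_mult[OF v False f] by simp
        qed
        then show ?thesis using False f by (simp add: L_iff)
      qed simp
    qed
  qed (use f in auto)
  then show "card (L (\<lambda>v. D v + pdiv f v)) = card (L D)" by (rule bij_betw_same_card[symmetric])
qed

lemma ldim_pos_iff:
  assumes D: "D \<in> Div" shows "0 < ldim D \<longleftrightarrow> (\<exists>f\<in>L D. f \<noteq> 0)"
proof
  assume "0 < ldim D"
  show "\<exists>f\<in>L D. f \<noteq> 0"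
  proof (rule ccontr)
    assume "\<not> ?thesis"
    then have "L D = {0}" by auto
    then have "q ^ ldim D = 1" using card_L[OF D] by simp
    then show False using q_ge_2 \<open>0 < ldim D\<close> by simp
  qed
next
  assume "\<exists>f\<in>L D. f \<noteq> 0"
  then obtain f where "f \<in> L D" "f \<noteq> 0" by blast
  then have "card {0, f} \<le> card (L D)" by (intro card_mono finite_L[OF D]) auto
  then have "2 \<le> q ^ ldim D" using card_L[OF D] \<open>f \<noteq> 0\<close> by simp
  then show "0 < ldim D" by (cases "ldim D") simp_all
qed

text \<open>A nonzero \<open>f\<close> in \<open>L D\<close> makes \<open>D\<close> equivalent to an
  effective divisor of the same degree, for which \<open>card_L_Eff\<close> applies.\<close>

lemma ldim_le:
  assumes D: "D \<in> Div" and "0 \<le> deg D" shows "int (ldim D) \<le> deg D + 1"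
proof (cases "ldim D = 0")
  case False
  then obtain f where f: "f \<in> L D" "f \<noteq> 0" using ldim_pos_iff[OF D] by auto
  let ?E = "\<lambda>v. D v + pdiv f v"
  have E: "?E \<in> Eff" using f L_add_pdiv_Eff[OF D] by blast
  have "q ^ ldim ?E \<le> q ^ (nat (deg ?E) + 1)"
    using card_L_Eff(2)[OF E] card_L[OF EffD(1)[OF E]] by simp
  then have "ldim ?E \<le> nat (deg ?E) + 1" unfolding q_power_le_iff .
  then show ?thesis using ldim_add_pdiv[OF D f(2)] deg_add_pdiv[OF D f(2)] assms(2) by simp
qed (use assms in simp)

lemma ldim_mono_defect:
  assumes D: "D \<in> Div" and E: "E \<in> Div" and le: "\<And>v. D v \<le> E v"
  shows "deg D - int (ldim D) \<le> deg E - int (ldim E)"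
proof -
  have "q ^ ldim E \<le> q ^ (nat (deg E - deg D) + ldim D)"
    using card_L_mono[OF D E le] card_L[OF D] card_L[OF E] by (simp add: power_add)
  then have "ldim E \<le> nat (deg E - deg D) + ldim D" unfolding q_power_le_iff .
  moreover have "deg D \<le> deg E" by (rule deg_mono[OF D E le])
  ultimately show ?thesis by linarith
qed

text \<open>The defect \<open>deg D - ldim D\<close> is monotone and invariant under linear equivalence.\<close>

lemma defect_le_of_ldim_diff_pos:
  assumes D: "D \<in> Div" and E: "E \<in> Div" and "0 < ldim (\<lambda>v. E v - D v)"
  shows "deg D - int (ldim D) \<le> deg E - int (ldim E)"
proof -
  have ED: "(\<lambda>v. E v - D v) \<in> Div" by (rule Div_diff[OF E D])
  obtain f where f: "f \<in> L (\<lambda>v. E v - D v)" "f \<noteq> 0" using assms(3) ldim_pos_iff[OF ED] by blast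
  have "(\<lambda>v. E v - D v + pdiv f v) \<in> Eff" using f L_add_pdiv_Eff[OF ED f(2)] by blast
  from EffD(2)[OF this] have "D v \<le> E v + pdiv f v" for v by (smt (verit))
  from ldim_mono_defect[OF D Div_add[OF E pdiv_Div[OF f(2)]] this]
  show ?thesis by (simp add: ldim_add_pdiv[OF E f(2)] deg_add_pdiv[OF E f(2)])
qed

text \<open>The divisors \<open>E k\<close> have defect at most \<open>deg C - ext_deg z\<close> by
  the growth of their spaces. Every divisor lies below its positive part, and that lies, up to
  linear equivalence, below \<open>E k\<close> for large \<open>k\<close>.\<close>

lemma defect_bounded: "\<exists>\<gamma>. \<forall>D\<in>Div. deg D - int (ldim D) \<le> \<gamma>"
proof -
  obtain z where tr: "\<not> algebraic_over emb z" using one_variable by blast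
  note z = not_algebraic_nonzero[OF tr]
  note B = EffD(1)[OF poles_Eff[OF z]]
  obtain C where C: "C \<in> Eff"
    and le: "\<And>k. q ^ ((k + 1) * ext_deg z) \<le> card (L (\<lambda>v. int k * poles z v + C v))"
    using card_L_poles_ge[OF z] by blast
  define E where "E k = (\<lambda>v. int k * poles z v + C v)" for k :: nat
  have E: "E k \<in> Div" for k unfolding E_def by (intro Div_add Div_scale B EffD(1)[OF C])
  have degE: "deg (E k) = int k * int (ext_deg z) + deg C" for k
    unfolding E_def using deg_add[OF Div_scale[OF B] EffD(1)[OF C]] deg_scale[OF B] deg_poles(1)[OF z] by simp
  have ldE: "(int k + 1) * int (ext_deg z) \<le> int (ldim (E k))" for k
  proof -
    have "q ^ ((k + 1) * ext_deg z) \<le> q ^ ldim (E k)" using le[of k] card_L[OF E] unfolding E_def by simp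
    then have "(k + 1) * ext_deg z \<le> ldim (E k)" unfolding q_power_le_iff .
    then have "int ((k + 1) * ext_deg z) \<le> int (ldim (E k))" by (simp only: of_nat_le_iff)
    then show ?thesis by (simp only: of_nat_mult of_nat_add of_nat_1)
  qed
  have pos: "1 \<le> int (ext_deg z)" using deg_poles_pos[OF tr] deg_poles(1)[OF z] by simp
  have "deg D - int (ldim D) \<le> deg C - int (ext_deg z)" if D: "D \<in> Div" for D
  proof -
    define A where "A = (\<lambda>v. max (D v) 0)"
    have A: "A \<in> Div" "\<And>v. D v \<le> A v" "A \<in> Eff"
      unfolding A_def using Div_max[OF D Div_0] by (auto intro: EffI)
    \<comment> \<open>Enough for \<open>E k - A\<close> to have a nonzero section:
      \<open>ldim (E k) \<ge> k + 1\<close>, and subtracting \<open>A\<close> costs at most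
      \<open>deg A\<close> dimensions.\<close>
    define k where "k = nat (deg A)"
    have k: "int k = deg A" using deg_Eff[OF A(3)] by (simp add: k_def)
    have "deg (\<lambda>v. E k v - A v) - int (ldim (\<lambda>v. E k v - A v)) \<le> deg (E k) - int (ldim (E k))"
      by (rule ldim_mono_defect[OF Div_diff[OF E A(1)] E]) (use EffD(2)[OF A(3)] in simp)
    then have "int (ldim (E k)) - deg A \<le> int (ldim (\<lambda>v. E k v - A v))"
      using deg_diff[OF E A(1), of k] by simp
    moreover have "(int k + 1) * 1 \<le> (int k + 1) * int (ext_deg z)" using pos by (intro mult_left_mono) auto
    then have "(int k + 1) * 1 \<le> int (ldim (E k))" using ldE[of k] by (rule order_trans)
    then have "1 \<le> int (ldim (E k)) - deg A" using k by simp
    ultimately have "1 \<le> int (ldim (\<lambda>v. E k v - A v))" by (rule order_trans[rotated])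
    then have "0 < ldim (\<lambda>v. E k v - A v)" by simp
    from defect_le_of_ldim_diff_pos[OF A(1) E this]
    have "deg A - int (ldim A) \<le> deg (E k) - int (ldim (E k))" .
    also have "\<dots> \<le> deg C - int (ext_deg z)" using degE[of k] ldE[of k] by (simp add: algebra_simps)
    finally show ?thesis using ldim_mono_defect[OF D A(1,2)] by simp
  qed
  then show ?thesis by blast
qed

text \<open>The \<open>GREATEST\<close> over the integers in the definition of the genus is attained
  because the defects are bounded above; the search is moved to the naturals by measuring from the
  value at the zero divisor.\<close>

lemma genus_attained: "\<exists>D\<in>Div. g = deg D - int (ldim D) + 1"
  and genus_upper: "D \<in> Div \<Longrightarrow> deg D - int (ldim D) + 1 \<le> g"
proof -
  obtain \<gamma> where \<gamma>: "\<And>D. D \<in> Div \<Longrightarrow> deg D - int (ldim D) \<le> \<gamma>" using defect_bounded by blast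
  let ?h = "\<lambda>D. deg D - int (ldim D) + 1"
  let ?x = "?h (\<lambda>_. 0)"
  have "\<exists>D. (D \<in> Div \<and> ?x \<le> ?h D) \<and> (\<forall>E. E \<in> Div \<and> ?x \<le> ?h E \<longrightarrow> nat (?h E - ?x) \<le> nat (?h D - ?x))"
  proof (rule ex_has_greatest_nat)
    show "(\<lambda>_. 0) \<in> Div \<and> ?x \<le> ?x" by simp
    show "\<forall>E. E \<in> Div \<and> ?x \<le> ?h E \<longrightarrow> nat (?h E - ?x) < Suc (nat (\<gamma> + 1 - ?x))"
      unfolding less_Suc_eq_le using \<gamma> by (intro allI impI nat_mono) auto
  qed
  then obtain D1 where D1: "D1 \<in> Div" "?x \<le> ?h D1"
    and max: "\<And>E. E \<in> Div \<Longrightarrow> ?x \<le> ?h E \<Longrightarrow> nat (?h E - ?x) \<le> nat (?h D1 - ?x)" by blast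
  have max': "?h E \<le> ?h D1" if "E \<in> Div" for E
    using max[OF that] D1(2) by linarith
  have "g = ?h D1"
    unfolding genus_def by (rule Greatest_equality) (use D1 max' in auto)
  then show "\<exists>D\<in>Div. g = ?h D" "D \<in> Div \<Longrightarrow> ?h D \<le> g" using D1(1) max' by auto
qed

lemma riemann_inequality: "D \<in> Div \<Longrightarrow> deg D + 1 - g \<le> int (ldim D)"
  using genus_upper[of D] by simp

text \<open>If \<open>deg D\<close> is large, Riemann's inequality gives \<open>D - D0\<close> a
  nonzero section, where \<open>D0\<close> has maximal defect. So the defect of \<open>D\<close> is
  at least that of \<open>D0\<close>, hence also maximal.\<close>

lemma riemann_equality: "\<exists>c\<ge>0. \<forall>D\<in>Div. c \<le> deg D \<longrightarrow> int (ldim D) = deg D + 1 - g"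
proof -
  obtain D0 where D0: "D0 \<in> Div" "g = deg D0 - int (ldim D0) + 1" using genus_attained by blast
  have "int (ldim D) = deg D + 1 - g" if D: "D \<in> Div" "max 0 (deg D0 + g) \<le> deg D" for D
  proof (rule antisym)
    have "deg (\<lambda>v. D v - D0 v) + 1 - g \<le> int (ldim (\<lambda>v. D v - D0 v))"
      by (rule riemann_inequality[OF Div_diff[OF D(1) D0(1)]])
    then have "0 < ldim (\<lambda>v. D v - D0 v)" using deg_diff[OF D(1) D0(1)] D(2) by simp
    from defect_le_of_ldim_diff_pos[OF D0(1) D(1) this]
    show "int (ldim D) \<le> deg D + 1 - g" using D0(2) by simp
    show "deg D + 1 - g \<le> int (ldim D)" by (rule riemann_inequality[OF D(1)])
  qed
  then show ?thesis by (intro exI[of _ "max 0 (deg D0 + g)"]) auto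
qed

section \<open>The class number\<close>

text \<open>At any place \<open>z\<close> or its inverse is integral. A residue field of degree at
  most \<open>m\<close> is smaller than the set of polynomials of degree at most \<open>m\<close>,
  so two of these agree there, and the place is a zero of one of finitely many nonzero
  functions.\<close>

lemma finite_places_degree_le: "finite {v \<in> places emb. pdeg v \<le> m}"
proof -
  obtain z where tr: "\<not> algebraic_over emb z" using one_variable by blast
  define Z where "Z = (\<Union>w\<in>{z, inverse z}. \<Union>p\<in>{p :: 'f poly. degree p \<le> m} - {0}. {v \<in> places emb. 0 < v (ev w p)})"
  have ne: "ev w p \<noteq> 0" if "w \<in> {z, inverse z}" "p \<noteq> 0" for w p
    using tr not_algebraic_inverse[OF tr] that unfolding algebraic_iff by blast
  have "finite Z" unfolding Z_def using ne by (intro finite_UN_I finite_zeros) auto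
  moreover have "{v \<in> places emb. pdeg v \<le> m} \<subseteq> Z"
  proof clarify
    fix v assume v: "v \<in> places emb" and dv: "pdeg v \<le> m"
    obtain w where w: "w \<in> {z, inverse z}" "w \<in> pw v 0"
    proof (cases "0 \<le> v z")
      case True
      then show ?thesis using that[of z] by (simp add: pw_def)
    next
      case False
      then show ?thesis using that[of "inverse z"] by (simp add: pw_def place_inverse v)
    qed
    let ?h = "\<lambda>p. (+) (ev w p) ` pw v 1"
    let ?P = "{p :: 'f poly. degree p \<le> m}"
    have cs: "finite (cosets (pw v 0) (pw v 1))" "card (cosets (pw v 0) (pw v 1)) = q ^ pdeg v"
      using cosets_pw[OF v, of 0 1] by auto
    have sub: "?h ` ?P \<subseteq> cosets (pw v 0) (pw v 1)"
      using pw_ev[OF v w(2)] unfolding cosets_def by blast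
    have "\<not> inj_on ?h ?P"
    proof
      assume "inj_on ?h ?P"
      then have "card ?P \<le> q ^ pdeg v" using card_inj_on_le[OF _ sub cs(1)] cs(2) by simp
      then have "q ^ (m + 1) \<le> q ^ pdeg v" by (simp only: card_polys_degree_le CARD_eq_q)
      then show False using dv unfolding q_power_le_iff by simp
    qed
    then obtain p r where p: "p \<in> ?P" "r \<in> ?P" "?h p = ?h r" "p \<noteq> r" unfolding inj_on_def by blast
    have "ev w p - ev w r \<in> pw v 1" using p(3) unfolding coset_eq_iff[OF pw_subgroup[OF v]] .
    then have "ev w (p - r) \<in> pw v 1" by simp
    moreover have "p - r \<noteq> 0" "degree (p - r) \<le> m" using p by (auto intro: degree_diff_le)
    ultimately have "v \<in> {v \<in> places emb. 0 < v (ev w (p - r))}" "p - r \<in> ?P - {0}"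
      using v ne[OF w(1), of "p - r"] by (auto simp: pw_iff simp del: ev_diff)
    then show "v \<in> Z" unfolding Z_def using w(1) by blast
  qed
  ultimately show ?thesis by (rule finite_subset[rotated])
qed

section \<open>Effective divisors of a given degree\<close>

definition Eff_of_deg :: "nat \<Rightarrow> 'k divisor set" where
  "Eff_of_deg d = {A \<in> Eff. deg A = int d}"

abbreviation num_Eff :: "nat \<Rightarrow> nat" where "num_Eff d \<equiv> card (Eff_of_deg d)"

text \<open>Only places of degree at most \<open>d\<close> occur, with multiplicities at most
  \<open>d\<close>.\<close>

lemma finite_Eff_of_deg: "finite (Eff_of_deg d)"
proof -
  let ?P = "{v \<in> places emb. pdeg v \<le> d}"
  have bnd: "v \<in> ?P \<and> A v \<in> {0..int d}" if A: "A \<in> Eff_of_deg d" "A v \<noteq> 0" for A v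
  proof -
    have AE: "A \<in> Eff" "deg A = int d" using A by (auto simp: Eff_of_deg_def)
    have v: "v \<in> places emb" using DivD(2)[OF EffD(1)[OF AE(1)] A(2)] .
    have a: "1 \<le> A v" using EffD(2)[OF AE(1), of v] A(2) by simp
    have p: "1 \<le> int (pdeg v)" using place_degree_pos[OF v] by simp
    have "int (pdeg v) * 1 \<le> int (pdeg v) * A v" "1 * A v \<le> int (pdeg v) * A v"
      using a p by (intro mult_left_mono mult_right_mono; simp)+
    then have "int (pdeg v) \<le> int d" "A v \<le> int d"
      using Eff_coeff_le_deg[OF AE(1), of v] unfolding AE(2) by linarith+
    then show ?thesis using a v by simp
  qed
  have "inj_on (\<lambda>A. restrict A ?P) (Eff_of_deg d)"
  proof (rule inj_onI, rule ext)
    fix A B v assume A: "A \<in> Eff_of_deg d" and B: "B \<in> Eff_of_deg d" and eq: "restrict A ?P = restrict B ?P"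
    show "A v = B v"
    proof (cases "v \<in> ?P")
      case True
      then show ?thesis using fun_cong[OF eq, of v] by simp
    next
      case False
      then have "A v = 0" "B v = 0" using bnd[OF A, of v] bnd[OF B, of v] by blast+
      then show ?thesis by simp
    qed
  qed
  moreover have "(\<lambda>A. restrict A ?P) ` Eff_of_deg d \<subseteq> (\<Pi>\<^sub>E v\<in>?P. {0..int d})"
  proof (rule image_subsetI)
    fix A assume A: "A \<in> Eff_of_deg d"
    have "A v \<in> {0..int d}" for v using bnd[OF A, of v] by (cases "A v = 0") auto
    then show "restrict A ?P \<in> (\<Pi>\<^sub>E v\<in>?P. {0..int d})" by (simp add: PiE_iff)
  qed
  moreover have "finite (\<Pi>\<^sub>E v\<in>?P. {0..int d})" by (intro finite_PiE finite_places_degree_le) auto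
  ultimately show ?thesis using inj_on_finite by blast
qed

section \<open>Divisor classes\<close>

abbreviation lequiv :: "'k divisor \<Rightarrow> 'k divisor \<Rightarrow> bool" (infix "\<sim>" 50) where
  "D \<sim> E \<equiv> (D, E) \<in> linear_equivalence emb"

lemma lequiv_iff: "D \<sim> E \<longleftrightarrow> (\<exists>f. f \<noteq> 0 \<and> D = (\<lambda>v. E v + pdiv f v))"
proof -
  have "(\<forall>v. D v - E v = pdiv f v) \<longleftrightarrow> D = (\<lambda>v. E v + pdiv f v)" for f
    by (simp add: fun_eq_iff algebra_simps)
  then show ?thesis unfolding linear_equivalence_def by simp
qed

lemma lequiv_refl [simp]: "D \<sim> D"
  unfolding lequiv_iff by (rule exI[of _ 1]) (simp add: pdiv_1)

lemma lequiv_sym: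
  assumes "D \<sim> E" shows "E \<sim> D"
proof -
  obtain f where f: "f \<noteq> 0" "D = (\<lambda>v. E v + pdiv f v)" using assms unfolding lequiv_iff by blast
  then show ?thesis unfolding lequiv_iff by (intro exI[of _ "inverse f"]) (simp add: pdiv_inverse)
qed

lemma lequiv_trans:
  assumes "D \<sim> E" "E \<sim> F" shows "D \<sim> F"
proof -
  obtain f h where f: "f \<noteq> 0" "D = (\<lambda>v. E v + pdiv f v)" and h: "h \<noteq> 0" "E = (\<lambda>v. F v + pdiv h v)"
    using assms unfolding lequiv_iff by blast
  then show ?thesis unfolding lequiv_iff by (intro exI[of _ "h * f"]) (simp add: pdiv_mult add.assoc)
qed

lemma lequiv_class_eq_iff: "linear_equivalence emb `` {D} = linear_equivalence emb `` {E} \<longleftrightarrow> D \<sim> E"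
  using lequiv_refl lequiv_sym lequiv_trans by blast

lemma lequiv_add:
  assumes "D \<sim> E" shows "(\<lambda>v. D v + M v) \<sim> (\<lambda>v. E v + M v)"
proof -
  obtain f where f: "f \<noteq> 0" "D = (\<lambda>v. E v + pdiv f v)" using assms unfolding lequiv_iff by blast
  then show ?thesis unfolding lequiv_iff by (intro exI[of _ f]) (simp add: fun_eq_iff)
qed

lemma exists_place: "\<exists>v. v \<in> places emb"
  using one_variable exists_zero_place by blast

abbreviation Div0 :: "'k divisor set" where "Div0 \<equiv> divisors_degree_zero emb"

text \<open>After translation by a divisor \<open>M\<close> of degree at least the genus, every
  class contains an effective divisor, by Riemann's inequality; there are finitely many of that
  degree.\<close>

lemma finite_classes: "finite (Div0 // linear_equivalence emb)"
proof -
  obtain w where w: "w \<in> places emb" using exists_place by blast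
  \<comment> \<open>The absolute value makes the degree both nonnegative and at least
    \<open>g\<close>.\<close>
  define M where "M = (\<lambda>v. if v = w then \<bar>g\<bar> else 0)"
  have M: "M = (\<lambda>_. 0)(w := \<bar>g\<bar>)" by (auto simp: M_def)
  have MD: "M \<in> Div" unfolding M by (rule Div_upd[OF Div_0 w])
  have dM: "g \<le> deg M" "0 \<le> deg M"
  proof -
    have d: "deg M = int (pdeg w) * \<bar>g\<bar>" unfolding M using deg_upd[OF Div_0 w] by simp
    have "1 * \<bar>g\<bar> \<le> int (pdeg w) * \<bar>g\<bar>" using place_degree_pos[OF w] by (intro mult_right_mono) auto
    then show "g \<le> deg M" "0 \<le> deg M" using d by auto
  qed
  have "\<exists>A. A \<in> Eff_of_deg (nat (deg M)) \<and> (\<lambda>v. A v - M v) \<in> Xs" if Xs: "Xs \<in> Div0 // linear_equivalence emb" for Xs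
  proof -
    obtain D where D: "D \<in> Div0" "Xs = linear_equivalence emb `` {D}" using Xs by (elim quotientE)
    then have DD: "D \<in> Div" "deg D = 0" by (auto simp: divisors_degree_zero_def)
    note DM = Div_add[OF DD(1) MD]
    have dDM: "deg (\<lambda>v. D v + M v) = deg M" using deg_add[OF DD(1) MD] DD(2) by simp
    then have "0 < ldim (\<lambda>v. D v + M v)" using riemann_inequality[OF DM] dM by simp
    then obtain f where f: "f \<in> L (\<lambda>v. D v + M v)" "f \<noteq> 0" using ldim_pos_iff[OF DM] by blast
    let ?A = "\<lambda>v. D v + M v + pdiv f v"
    have "?A \<in> Eff" using L_add_pdiv_Eff[OF DM f(2)] f(1) by blast
    moreover have "deg ?A = deg M" using deg_add_pdiv[OF DM f(2)] dDM by simp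
    moreover have "(\<lambda>v. ?A v - M v) \<in> Xs"
    proof -
      have "(\<lambda>v. ?A v - M v) = (\<lambda>v. D v + pdiv f v)" by (simp add: fun_eq_iff)
      then have "(\<lambda>v. ?A v - M v) \<sim> D" unfolding lequiv_iff using f(2) by blast
      then show ?thesis unfolding D(2) using lequiv_sym by blast
    qed
    ultimately show ?thesis using dM(2) by (intro exI[of _ ?A]) (simp add: Eff_of_deg_def)
  qed
  then obtain A where A: "\<And>Xs. Xs \<in> Div0 // linear_equivalence emb \<Longrightarrow>
      A Xs \<in> Eff_of_deg (nat (deg M)) \<and> (\<lambda>v. A Xs v - M v) \<in> Xs" by metis
  have "inj_on A (Div0 // linear_equivalence emb)"
  proof (rule inj_onI)
    fix Xs Y assume Xs: "Xs \<in> Div0 // linear_equivalence emb" and Y: "Y \<in> Div0 // linear_equivalence emb" and eq: "A Xs = A Y"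
    obtain D E where D: "Xs = linear_equivalence emb `` {D}" and E: "Y = linear_equivalence emb `` {E}"
      using Xs Y by (elim quotientE)
    have "D \<sim> (\<lambda>v. A Xs v - M v)" "E \<sim> (\<lambda>v. A Xs v - M v)" using A[OF Xs] A[OF Y] eq D E by auto
    then have "D \<sim> E" using lequiv_sym lequiv_trans by blast
    then show "Xs = Y" unfolding D E lequiv_class_eq_iff .
  qed
  then show ?thesis
    by (rule inj_on_finite[OF _ _ finite_Eff_of_deg[of "nat (deg M)"]]) (use A in blast)
qed

abbreviation h :: nat where "h \<equiv> class_number emb"

definition class_reps :: "'k divisor set" where
  "class_reps = (SOME T. T \<subseteq> Div0 \<and> finite T \<and> card T = h \<and> (\<forall>D\<in>Div0. \<exists>E\<in>T. D \<sim> E) \<and>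
     (\<forall>D\<in>T. \<forall>E\<in>T. D \<sim> E \<longrightarrow> D = E))"

lemma class_reps:
  "class_reps \<subseteq> Div0" "finite class_reps" "card class_reps = h"
  "D \<in> Div0 \<Longrightarrow> \<exists>E\<in>class_reps. D \<sim> E"
  "D \<in> class_reps \<Longrightarrow> E \<in> class_reps \<Longrightarrow> D \<sim> E \<Longrightarrow> D = E"
proof -
  let ?c = "\<lambda>D. linear_equivalence emb `` {D}"
  have "Div0 // linear_equivalence emb = ?c ` Div0" unfolding quotient_def by blast
  then obtain T where T: "T \<subseteq> Div0" "inj_on ?c T" "Div0 // linear_equivalence emb = ?c ` T"
    using subset_image_inj[THEN iffD1, of "Div0 // linear_equivalence emb" ?c Div0] by auto
  have "finite T" using finite_classes unfolding T(3) by (rule finite_imageD) (rule T(2))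
  moreover have "card T = h" unfolding class_number_def T(3) by (rule card_image[OF T(2), symmetric])
  moreover have "\<exists>E\<in>T. D \<sim> E" if "D \<in> Div0" for D
  proof -
    have "?c D \<in> ?c ` T" unfolding T(3)[symmetric] using that by (rule quotientI)
    then show ?thesis using lequiv_class_eq_iff by blast
  qed
  moreover have "D = E" if "D \<in> T" "E \<in> T" "D \<sim> E" for D E
    using T(2) that unfolding inj_on_def lequiv_class_eq_iff by blast
  ultimately have "\<exists>T. T \<subseteq> Div0 \<and> finite T \<and> card T = h \<and> (\<forall>D\<in>Div0. \<exists>E\<in>T. D \<sim> E) \<and>
     (\<forall>D\<in>T. \<forall>E\<in>T. D \<sim> E \<longrightarrow> D = E)" using T(1) by blast
  from someI_ex[OF this] have R: "class_reps \<subseteq> Div0 \<and> finite class_reps \<and> card class_reps = h \<and>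
     (\<forall>D\<in>Div0. \<exists>E\<in>class_reps. D \<sim> E) \<and> (\<forall>D\<in>class_reps. \<forall>E\<in>class_reps. D \<sim> E \<longrightarrow> D = E)"
    unfolding class_reps_def .
  show "class_reps \<subseteq> Div0" "finite class_reps" "card class_reps = h" using R by simp_all
  show "D \<in> Div0 \<Longrightarrow> \<exists>E\<in>class_reps. D \<sim> E" using R by blast
  show "D \<in> class_reps \<Longrightarrow> E \<in> class_reps \<Longrightarrow> D \<sim> E \<Longrightarrow> D = E" using R by blast
qed

text \<open>For a fixed effective \<open>M\<close> of degree \<open>d\<close>, every other one is
  \<open>D + M + pdiv f\<close> with one of \<open>h\<close> representatives \<open>D\<close> and a
  function \<open>f\<close> from a space of at most \<open>q ^ (d + 1)\<close> elements.\<close>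

lemma num_Eff_le: "num_Eff d \<le> h * q ^ (d + 1)"
proof (cases "Eff_of_deg d = {}")
  case False
  then obtain M where M: "M \<in> Eff" "deg M = int d" by (auto simp: Eff_of_deg_def)
  note MD = EffD(1)[OF M(1)]
  have DM: "(\<lambda>v. D v + M v) \<in> Div \<and> deg (\<lambda>v. D v + M v) = int d" if "D \<in> class_reps" for D
  proof -
    have "D \<in> Div" "deg D = 0" using class_reps(1) that by (auto simp: divisors_degree_zero_def)
    then show ?thesis using Div_add[OF _ MD] deg_add[OF _ MD] M(2) by simp
  qed
  let ?S = "SIGMA D:class_reps. L (\<lambda>v. D v + M v)"
  have fin: "finite ?S" using DM finite_L class_reps(2) by (intro finite_SigmaI) auto
  have "Eff_of_deg d \<subseteq> (\<lambda>(D, f) v. D v + M v + pdiv f v) ` ?S"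
  proof
    fix A assume "A \<in> Eff_of_deg d"
    then have A: "A \<in> Eff" "deg A = int d" by (auto simp: Eff_of_deg_def)
    have "(\<lambda>v. A v - M v) \<in> Div0"
      using Div_diff[OF EffD(1)[OF A(1)] MD] deg_diff[OF EffD(1)[OF A(1)] MD] A(2) M(2)
      by (simp add: divisors_degree_zero_def)
    then obtain D where D: "D \<in> class_reps" "(\<lambda>v. A v - M v) \<sim> D" using class_reps(4) by blast
    then obtain f where f: "f \<noteq> 0" "(\<lambda>v. A v - M v) = (\<lambda>v. D v + pdiv f v)" unfolding lequiv_iff by blast
    have eq: "A = (\<lambda>v. D v + M v + pdiv f v)"
    proof
      fix v
      show "A v = D v + M v + pdiv f v" using fun_cong[OF f(2), of v] by simp
    qed
    then have "f \<in> L (\<lambda>v. D v + M v)" using L_add_pdiv_Eff[of "\<lambda>v. D v + M v" f] DM[OF D(1)] f(1) A(1) by simp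
    then show "A \<in> (\<lambda>(D, f) v. D v + M v + pdiv f v) ` ?S" using D(1) eq by (intro image_eqI[of _ _ "(D, f)"]) auto
  qed
  then have "num_Eff d \<le> card ?S" using surj_card_le[OF fin] by blast
  also have "\<dots> = (\<Sum>D\<in>class_reps. card (L (\<lambda>v. D v + M v)))"
    using DM finite_L class_reps(2) by (intro card_SigmaI) auto
  also have "\<dots> \<le> (\<Sum>D\<in>class_reps. q ^ (d + 1))"
  proof (rule sum_mono)
    fix D assume D: "D \<in> class_reps"
    have "int (ldim (\<lambda>v. D v + M v)) \<le> int d + 1" using ldim_le[of "\<lambda>v. D v + M v"] DM[OF D] by simp
    then have "ldim (\<lambda>v. D v + M v) \<le> d + 1" by simp
    then show "card (L (\<lambda>v. D v + M v)) \<le> q ^ (d + 1)"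
      unfolding card_L[OF conjunct1[OF DM[OF D]]] q_power_le_iff .
  qed
  finally show ?thesis using class_reps(3) by simp
qed simp

lemma card_same_pdiv:
  assumes "f \<noteq> 0"
  shows "{k. k \<noteq> 0 \<and> (\<forall>v. pdiv k v = pdiv f v)} = (\<lambda>c. emb c * f) ` (UNIV - {0})"
    and "card {k. k \<noteq> 0 \<and> (\<forall>v. pdiv k v = pdiv f v)} = q - 1"
proof -
  show eq: "{k. k \<noteq> 0 \<and> (\<forall>v. pdiv k v = pdiv f v)} = (\<lambda>c. emb c * f) ` (UNIV - {0})"
  proof (intro equalityI subsetI)
    fix k assume "k \<in> {k. k \<noteq> 0 \<and> (\<forall>v. pdiv k v = pdiv f v)}"
    then have k: "k \<noteq> 0" "\<And>v. pdiv k v = pdiv f v" by auto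
    have "\<forall>v. pdiv (k * inverse f) v = 0" using k assms by (simp add: pdiv_mult pdiv_inverse)
    then obtain c where c: "k * inverse f = emb c" using pdiv_eq_0_iff[of "k * inverse f"] k assms by auto
    have "k = emb c * f" unfolding c[symmetric] using assms by simp
    moreover have "c \<noteq> 0" using calculation k by auto
    ultimately show "k \<in> (\<lambda>c. emb c * f) ` (UNIV - {0})" by blast
  next
    fix k assume "k \<in> (\<lambda>c. emb c * f) ` (UNIV - {0})"
    then obtain c where c: "c \<noteq> 0" "k = emb c * f" by blast
    have "pdiv (emb c) v = 0" for v using c(1) pdiv_eq_0_iff[of "emb c"] by simp
    then show "k \<in> {k. k \<noteq> 0 \<and> (\<forall>v. pdiv k v = pdiv f v)}" using c assms by (simp add: pdiv_mult)
  qed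
  have "inj_on (\<lambda>c. emb c * f) (UNIV - {0})" using assms by (auto intro: inj_onI)
  then show "card {k. k \<noteq> 0 \<and> (\<forall>v. pdiv k v = pdiv f v)} = q - 1"
    unfolding eq by (simp add: card_image card_Diff_subset)
qed

text \<open>Nonzero sections of \<open>M\<close> with the same divisor differ by constants, so at
  least \<open>(q ^ ldim M - 1) / (q - 1) \<ge> q ^ (ldim M - 1)\<close> divisors arise; the factor
  \<open>q\<close> on the right avoids the predecessor.\<close>

lemma num_Eff_ge:
  assumes M: "M \<in> Div" "deg M = int d" and pos: "0 < ldim M"
  shows "q ^ ldim M \<le> q * num_Eff d"
proof -
  from pos obtain l where l: "ldim M = Suc l" by (cases "ldim M") auto
  let ?F = "\<lambda>f v. M v + pdiv f v"
  have fib: "card {f \<in> L M - {0}. ?F f = A} \<le> q - 1" for A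
  proof (cases "{f \<in> L M - {0}. ?F f = A} = {}")
    case False
    then obtain f where f: "f \<noteq> 0" "?F f = A" by blast
    have "{k \<in> L M - {0}. ?F k = A} \<subseteq> {k. k \<noteq> 0 \<and> (\<forall>v. pdiv k v = pdiv f v)}"
      unfolding f(2)[symmetric] by (auto simp: fun_eq_iff)
    moreover have "finite {k. k \<noteq> 0 \<and> (\<forall>v. pdiv k v = pdiv f v)}" unfolding card_same_pdiv(1)[OF f(1)] by simp
    ultimately show ?thesis unfolding card_same_pdiv(2)[OF f(1), symmetric] by (rule card_mono[rotated])
  next
    case True
    show ?thesis unfolding True by simp
  qed
  have fin: "finite (L M - {0})" using finite_L[OF M(1)] by simp
  have eq: "L M - {0} = (\<Union>A\<in>Eff_of_deg d. {f \<in> L M - {0}. ?F f = A})"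
    using L_add_pdiv_Eff[OF M(1)] deg_add_pdiv[OF M(1)] M(2) by (auto simp: Eff_of_deg_def)
  have "card (L M - {0}) = card (\<Union>A\<in>Eff_of_deg d. {f \<in> L M - {0}. ?F f = A})"
    by (rule arg_cong[OF eq])
  also have "\<dots> \<le> (\<Sum>A\<in>Eff_of_deg d. card {f \<in> L M - {0}. ?F f = A})"
    by (rule card_UN_le[OF finite_Eff_of_deg])
  also have "\<dots> \<le> (\<Sum>A\<in>Eff_of_deg d. q - 1)" using fib by (intro sum_mono)
  finally have "card (L M - {0}) \<le> (q - 1) * num_Eff d" by (simp add: mult.commute)
  moreover have "card (L M - {0}) = q ^ ldim M - 1" using card_L[OF M(1)] finite_L[OF M(1)] by simp
  ultimately have "q * q ^ l - 1 \<le> (q - 1) * num_Eff d" using l by simp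
  moreover have "(q - 1) * q ^ l \<le> q * q ^ l - 1"
    using q_ge_2 one_le_power[of q l] by (simp add: diff_mult_distrib diff_le_mono2)
  ultimately have "(q - 1) * q ^ l \<le> (q - 1) * num_Eff d" by linarith
  then have "q ^ l \<le> num_Eff d" using q_ge_2 by simp
  then show ?thesis using l by simp
qed

end

section \<open>Divisors of degree one\<close>

lemma finite_field_power_CARD:
  fixes x :: "'a::{field,finite}"
  shows "x ^ CARD('a) = x"
proof (cases "x = 0")
  case False
  have "x * (\<Prod>y\<in>UNIV - {0}. x * y) = x * x ^ (CARD('a) - 1) * \<Prod>(UNIV - {0})"
    by (simp add: prod.distrib mult_ac)
  also have "x * x ^ (CARD('a) - 1) = x ^ CARD('a)"
    by (metis finite_UNIV_card_ge_0 finite power_minus_mult mult.commute)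
  also have "(\<Prod>y\<in>UNIV - {0}. x * y) = \<Prod>(UNIV - {0})"
    by (rule prod.reindex_bij_witness[of _ "\<lambda>y. y / x" "\<lambda>y. x * y"]) (use False in auto)
  finally show ?thesis by simp
qed (simp add: power_0_left)

text \<open>Interpreted both for \<open>K\<close> and for its algebraic closure, in each of which
  the Frobenius map has to be additive.\<close>

locale field_hom_finite =
  fixes e :: "'f::{field,finite} \<Rightarrow> 'a::field"
  assumes e_1: "e 1 = 1" and e_add: "e (a + b) = e a + e b" and e_mult: "e (a * b) = e a * e b"
begin

lemma e_0: "e 0 = 0" using e_add[of 0 0] by (metis add_cancel_right_right)

lemma e_eq_0_iff: "e a = 0 \<longleftrightarrow> a = 0"
  using e_mult[of a "inverse a"] e_0 e_1 by (cases "a = 0") auto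

lemma inj_e: "inj e"
proof (rule injI)
  fix a b assume "e a = e b"
  then have "e (a - b) + e b = 0 + e b" using e_add[of "a - b" b] by simp
  then show "a = b" using e_eq_0_iff[of "a - b"] by simp
qed

lemma e_power: "e (a ^ n) = e a ^ n"
  by (induction n) (simp_all add: e_1 e_mult)

lemma e_power_CARD: "e a ^ CARD('f) = e a"
  using e_power[of a "CARD('f)"] by (simp add: finite_field_power_CARD)

lemma of_nat_CARD: "of_nat (CARD('f)) = (0 :: 'a)"
proof -
  have "e (of_nat n) = of_nat n" for n by (induction n) (simp_all add: e_0 e_1 e_add)
  moreover have "(of_nat (CARD('f)) :: 'f) = 0" by (simp add: of_nat_eq_0_iff_char_dvd CHAR_dvd_CARD)
  ultimately show ?thesis using e_0 by metis
qed

text \<open>The images of the constants are already as many roots of \<open>X ^ q - X\<close> as its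
  degree permits, so being fixed by Frobenius characterizes them.\<close>

lemma card_roots_Frobenius: "{y :: 'a. y ^ CARD('f) = y} = range e"
proof -
  let ?n = "CARD('f)"
  let ?p = "monom 1 ?n - monom (1 :: 'a) 1"
  have n: "1 < ?n" using card_mono[of "UNIV :: 'f set" "{0, 1}"] by simp
  then have c: "coeff ?p ?n = 1" by simp
  then have p0: "?p \<noteq> 0" by (metis coeff_0 zero_neq_one)
  have "degree ?p \<le> ?n" using n by (intro degree_diff_le) (auto intro: order_trans[OF degree_monom_le])
  then have "card {y. poly ?p y = 0} \<le> ?n" using card_poly_roots_bound[OF p0] by simp
  moreover have eq: "{y. poly ?p y = 0} = {y. y ^ ?n = y}" by (simp add: poly_monom)
  moreover have "range e \<subseteq> {y. y ^ ?n = y}" using e_power_CARD by auto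
  moreover have "card (range e) = ?n" by (rule card_image[OF inj_e])
  moreover have "finite {y. poly ?p y = 0}" by (rule poly_roots_finite[OF p0])
  ultimately show ?thesis using card_seteq[of "{y. y ^ ?n = y}" "range e"] by simp
qed

text \<open>As a polynomial in \<open>y\<close> of degree less than \<open>CARD('f)\<close>, the difference of both sides vanishes
  at all multiples of \<open>x\<close> by constants.\<close>

lemma Frobenius_add: "(x + y) ^ CARD('f) = x ^ CARD('f) + (y :: 'a) ^ CARD('f)"
proof (cases "x = 0")
  case False
  let ?n = "CARD('f)"
  define p where "p = [:x, 1:] ^ ?n - monom 1 ?n - [:x ^ ?n:]"
  have n: "0 < ?n" by simp
  have lin: "degree ([:x, 1:] ^ ?n) = ?n" "coeff ([:x, 1:] ^ ?n) ?n = 1"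
  proof -
    show d: "degree ([:x, 1:] ^ ?n) = ?n" by (simp add: degree_power_eq)
    show "coeff ([:x, 1:] ^ ?n) ?n = 1" using lead_coeff_power[of "[:x, 1:]" ?n] d by simp
  qed
  have big: "coeff p i = 0" if "?n \<le> i" for i
  proof (cases "i = ?n")
    case True
    then show ?thesis using n lin(2) by (auto simp: p_def coeff_pCons split: nat.split)
  next
    case False
    then have "?n < i" using that by simp
    then show ?thesis using n coeff_eq_0[of "[:x, 1:] ^ ?n" i] lin(1)
      by (auto simp: p_def coeff_pCons split: nat.split)
  qed
  have root: "poly p (e c * x) = 0" for c
  proof -
    have "(x + e c * x) ^ ?n = e (1 + c) ^ ?n * x ^ ?n"
      unfolding power_mult_distrib[symmetric] by (simp add: e_add e_1 algebra_simps)
    then have "(x + e c * x) ^ ?n = (1 + e c) * x ^ ?n" unfolding e_power_CARD by (simp add: e_add e_1)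
    moreover have "(e c * x) ^ ?n = e c * x ^ ?n" unfolding power_mult_distrib e_power_CARD ..
    ultimately show ?thesis by (simp add: p_def poly_power poly_monom distrib_right)
  qed
  have "p = 0"
  proof (rule ccontr)
    assume p0: "p \<noteq> 0"
    have "degree p < ?n" using big[of "degree p"] p0 by (metis leading_coeff_0_iff not_le)
    moreover have "inj (\<lambda>c. e c * x)" using False inj_e by (auto simp: inj_def)
    then have "card (range (\<lambda>c. e c * x)) = ?n" by (rule card_image)
    moreover have "card (range (\<lambda>c. e c * x)) \<le> card {y. poly p y = 0}"
      using root by (intro card_mono poly_roots_finite p0) auto
    ultimately show False using card_poly_roots_bound[OF p0] by linarith
  qed
  then have "poly p y = 0" by simp
  then show ?thesis by (simp add: p_def poly_power poly_monom algebra_simps)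
qed (simp add: power_0_left)

lemma Frobenius_pow_add: "(x + y :: 'a) ^ (CARD('f) ^ k) = x ^ (CARD('f) ^ k) + y ^ (CARD('f) ^ k)"
  by (induction k) (simp_all add: power_mult Frobenius_add mult.commute[of "CARD('f)"] del: power_Suc add: power_Suc2)

end

lemma map_poly_hom_mult:
  assumes "\<phi> 0 = (0 :: 'b::comm_ring_1)" "\<And>a b. \<phi> (a + b) = \<phi> a + \<phi> b" "\<And>a b. \<phi> (a * b) = \<phi> a * \<phi> b"
  shows "map_poly \<phi> (p * r) = map_poly \<phi> p * map_poly \<phi> (r :: 'a::comm_ring_1 poly)"
proof -
  have "\<phi> (sum h A) = (\<Sum>a\<in>A. \<phi> (h a))" for h and A :: "nat set"
    using assms(1,2) by (induction A rule: infinite_finite_induct) auto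
  then show ?thesis by (simp add: poly_eq_iff coeff_map_poly assms coeff_mult)
qed

context function_field
begin

sublocale eK: field_hom_finite emb
  by unfold_locales (simp_all add: emb_add emb_mult)

abbreviation ac :: "'k \<Rightarrow> 'k alg_closure" where "ac \<equiv> to_ac"

sublocale eC: field_hom_finite "\<lambda>c. ac (emb c)"
  by unfold_locales (simp_all add: emb_add emb_mult)

section \<open>The constant extension inside the algebraic closure\<close>

definition evc :: "'k alg_closure \<Rightarrow> 'k poly \<Rightarrow> 'k alg_closure" where
  "evc \<beta> p = poly (map_poly ac p) \<beta>"

lemma map_poly_ac_mult: "map_poly ac (p * r) = map_poly ac p * map_poly ac r"
  by (rule map_poly_hom_mult) simp_all

lemma map_poly_ac_add: "map_poly ac (p + r) = map_poly ac p + map_poly ac r"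
  by (simp add: poly_eq_iff coeff_map_poly)

lemma evc_pCons [simp]: "evc \<beta> (pCons a p) = ac a + \<beta> * evc \<beta> p"
  by (cases "a = 0 \<and> p = 0") (auto simp: evc_def map_poly_pCons)

lemma evc_0 [simp]: "evc \<beta> 0 = 0" by (simp add: evc_def)

lemma evc_1 [simp]: "evc \<beta> 1 = 1" by (simp add: evc_def)

lemma evc_mult [simp]: "evc \<beta> (p * r) = evc \<beta> p * evc \<beta> r"
  by (simp add: evc_def map_poly_ac_mult)

lemma evc_add [simp]: "evc \<beta> (p + r) = evc \<beta> p + evc \<beta> r"
  by (simp add: evc_def map_poly_ac_add)

lemma evc_uminus [simp]: "evc \<beta> (- p) = - evc \<beta> p"
  by (induction p) simp_all

lemma evc_diff [simp]: "evc \<beta> (p - r) = evc \<beta> p - evc \<beta> r"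
  using evc_add[of \<beta> p "- r"] by simp

lemma evc_prod: "evc \<beta> (prod p A) = (\<Prod>a\<in>A. evc \<beta> (p a))"
  by (induction A rule: infinite_finite_induct) simp_all

lemma evc_pcompose: "evc \<beta> (pcompose p r) = evc (evc \<beta> r) p"
  by (induction p) (simp_all add: pcompose_pCons)

lemma evc_monom [simp]: "evc \<beta> (monom c n) = ac c * \<beta> ^ n"
  by (induction n) (simp_all add: monom_0 monom_Suc algebra_simps)

lemma evc_emb: "evc \<beta> (map_poly emb p) = poly (map_poly (\<lambda>c. ac (emb c)) p) \<beta>"
  by (simp add: evc_def map_poly_map_poly o_def)

lemma evc_zero_if_many_roots:
  assumes "finite R" "degree p < card R" "\<And>\<beta>. \<beta> \<in> R \<Longrightarrow> evc \<beta> p = 0"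
  shows "p = 0"
proof (rule ccontr)
  assume "p \<noteq> 0"
  then have p0: "map_poly ac p \<noteq> 0" by (simp add: map_poly_eq_0_iff)
  have "card R \<le> card {\<beta>. poly (map_poly ac p) \<beta> = 0}"
    using assms(3) by (intro card_mono poly_roots_finite[OF p0]) (auto simp: evc_def)
  also have "\<dots> \<le> degree (map_poly ac p)" by (rule card_poly_roots_bound[OF p0])
  also have "\<dots> = degree p" by (rule degree_map_poly) simp
  finally show False using assms(2) by simp
qed

lemma evc_Frobenius:
  assumes "\<And>i. coeff p i ^ (q ^ k) = coeff p i"
  shows "evc \<beta> p ^ (q ^ k) = evc (\<beta> ^ (q ^ k)) p"
  using assms
proof (induction p)
  case (pCons a p)
  have a: "a ^ (q ^ k) = a" using pCons.prems[of 0] by simp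
  have "coeff p i ^ (q ^ k) = coeff p i" for i using pCons.prems[of "Suc i"] by simp
  then have IH: "evc \<beta> p ^ (q ^ k) = evc (\<beta> ^ (q ^ k)) p" by (rule pCons.IH)
  have "(ac a + \<beta> * evc \<beta> p) ^ (q ^ k) = ac a ^ (q ^ k) + (\<beta> * evc \<beta> p) ^ (q ^ k)"
    using eC.Frobenius_pow_add by simp
  also have "ac a ^ (q ^ k) = ac a" using a by (metis to_ac_power)
  finally show ?case by (simp add: power_mult_distrib IH)
qed (use q_ge_2 in \<open>simp add: power_0_left\<close>)

lemma ev_Frobenius: "ev x p ^ (q ^ k) = ev (x ^ (q ^ k)) p"
proof (induction p)
  case (pCons a p)
  have "emb a ^ (q ^ k) = emb a"
  proof (induction k)
    case (Suc k)
    then show ?case using eK.e_power_CARD[of a] by (simp add: power_mult)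
  qed simp
  then show ?case using eK.Frobenius_pow_add pCons.IH by (simp add: power_mult_distrib)
qed (use q_ge_2 in \<open>simp add: power_0_left\<close>)

text \<open>An element of the field with \<open>q ^ l\<close> elements outside the constants; for
  prime \<open>l\<close> it generates that field.\<close>

definition generic :: "nat \<Rightarrow> 'k alg_closure \<Rightarrow> bool" where
  "generic l \<beta> \<longleftrightarrow> \<beta> ^ (q ^ l) = \<beta> \<and> \<beta> ^ q \<noteq> \<beta>"

text \<open>A repetition would give a Frobenius period \<open>t < l\<close>. It is coprime to the
  prime \<open>l\<close>, so by Bezout the Frobenius itself would fix
  \<open>\<beta>\<close>.\<close>

lemma generic_inj:
  assumes l: "prime l" and \<beta>: "generic l \<beta>"
  shows "inj_on (\<lambda>k. \<beta> ^ (q ^ k)) {..<l}"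
proof -
  have per: "\<beta> ^ (q ^ (m * t)) = \<beta>" if "\<beta> ^ (q ^ t) = \<beta>" for m t
    using that by (induction m) (simp_all add: power_add power_mult)
  have Ql: "\<beta> ^ (q ^ l) = \<beta>" using \<beta> by (simp add: generic_def)
  have "\<beta> ^ (q ^ i) \<noteq> \<beta> ^ (q ^ j)" if ij: "i < j" "j < l" for i j
  proof
    assume eq: "\<beta> ^ (q ^ i) = \<beta> ^ (q ^ j)"
    define t where "t = j - i"
    have "(\<beta> ^ (q ^ i)) ^ (q ^ (l - i)) = \<beta>"
      using Ql ij by (simp flip: power_mult power_add)
    moreover have e: "j + (l - i) = l + t" using ij by (simp add: t_def)
    have "(\<beta> ^ (q ^ j)) ^ (q ^ (l - i)) = (\<beta> ^ (q ^ l)) ^ (q ^ t)"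
      unfolding power_mult[symmetric] power_add[symmetric] e ..
    ultimately have bt: "\<beta> ^ (q ^ t) = \<beta>" using eq Ql by simp
    have "0 < t" "t < l" using ij by (auto simp: t_def)
    then have "coprime t l" using l by (metis coprime_commute nat_dvd_not_less prime_imp_coprime)
    then obtain a b where ab: "t * a = l * b + 1"
      using coprime_bezout_strong[of t l] l by (metis not_prime_1)
    have "\<beta> = \<beta> ^ (q ^ (t * a))" using per[OF bt, of a] by (simp add: mult.commute)
    also have "\<dots> = (\<beta> ^ (q ^ (b * l))) ^ q"
    proof -
      have "q ^ (t * a) = q ^ (b * l) * q" unfolding ab by (simp add: mult.commute)
      then show ?thesis by (simp only: power_mult)
    qed
    also have "\<dots> = \<beta> ^ q" using per[OF Ql, of b] by simp
    finally show False using \<beta> by (simp add: generic_def)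
  qed
  then show ?thesis by (intro inj_onI) (metis lessThan_iff linorder_neqE_nat)
qed

lemma generic_power: "generic l \<beta> \<Longrightarrow> 0 < l \<Longrightarrow> generic l (\<beta> ^ (q ^ k))"
proof (induction k)
  case (Suc k)
  define \<gamma> where "\<gamma> = \<beta> ^ (q ^ k)"
  have \<gamma>: "\<gamma> ^ (q ^ l) = \<gamma>" "\<gamma> ^ q \<noteq> \<gamma>" using Suc by (auto simp: generic_def \<gamma>_def)
  have "\<beta> ^ (q ^ Suc k) = \<gamma> ^ q" by (simp add: \<gamma>_def flip: power_mult) (simp add: mult.commute)
  moreover have "generic l (\<gamma> ^ q)"
    unfolding generic_def
  proof
    have "(\<gamma> ^ q) ^ (q ^ l) = (\<gamma> ^ (q ^ l)) ^ q" by (simp add: mult.commute flip: power_mult)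
    then show "(\<gamma> ^ q) ^ (q ^ l) = \<gamma> ^ q" using \<gamma> by simp
    show "(\<gamma> ^ q) ^ q \<noteq> \<gamma> ^ q"
    proof
      assume eq: "(\<gamma> ^ q) ^ q = \<gamma> ^ q"
      have "(\<gamma> ^ q) ^ (q ^ m) = \<gamma> ^ q" for m by (induction m) (simp_all add: eq power_mult)
      from this[of "l - 1"] have "\<gamma> ^ (q ^ l) = \<gamma> ^ q"
        using Suc.prems(2) by (simp flip: power_mult power_Suc)
      then show False using \<gamma> by simp
    qed
  qed
  ultimately show ?case by simp
qed simp

text \<open>The polynomial \<open>X ^ (q ^ l) - X\<close> has derivative \<open>-1\<close>, hence
  \<open>q ^ l\<close> distinct roots, of which only \<open>q\<close> are constants.\<close>

lemma exists_generic:
  assumes l: "1 < l"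
  shows "\<exists>\<beta>. generic l \<beta>"
proof (rule ccontr)
  assume "\<not> ?thesis"
  then have all: "\<beta> ^ q = \<beta>" if "\<beta> ^ (q ^ l) = \<beta>" for \<beta> :: "'k alg_closure" using that by (auto simp: generic_def)
  let ?Q = "q ^ l"
  have "q ^ 1 < q ^ l" using q_ge_2 l by (intro power_strict_increasing) auto
  then have Q: "q < ?Q" by simp
  let ?p = "monom 1 ?Q - monom (1 :: 'k alg_closure) 1"
  have Q1: "1 < ?Q" using Q q_ge_2 by linarith
  have c: "coeff ?p ?Q = 1" using Q1 by simp
  then have p0: "?p \<noteq> 0" by (metis coeff_0 zero_neq_one)
  have dle: "degree ?p \<le> ?Q" using Q1 by (intro degree_diff_le) (auto intro: order_trans[OF degree_monom_le])
  then have dp: "degree ?p = ?Q" using c by (metis le_antisym le_degree zero_neq_one)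
  have "of_nat ?Q = (0 :: 'k alg_closure)"
    using eC.of_nat_CARD l by (simp add: power_0_left)
  then have pd: "pderiv ?p = - 1" using Q1 by (simp add: pderiv_diff pderiv_monom monom_0 one_pCons del: of_nat_power)
  have ord: "\<not> [:- a, 1:] ^ 2 dvd ?p" for a
  proof
    assume "[:- a, 1:] ^ 2 dvd ?p"
    then obtain s where s: "?p = [:- a, 1:] ^ 2 * s" by (elim dvdE)
    have "poly (pderiv ([:- a, 1:] ^ 2 * s)) a = 0" unfolding power2_eq_square pderiv_mult by simp
    then show False unfolding s[symmetric] pd by simp
  qed
  obtain A where A: "size A = degree ?p" "?p = smult (lead_coeff ?p) (\<Prod>x\<in>#A. [:- x, 1:])"
    using alg_closed_imp_factorization[OF p0] by blast
  have "count A x \<le> 1" for x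
  proof -
    have "[:- x, 1:] ^ count A x dvd (\<Prod>x\<in>#A. [:- x, 1:])"
    proof -
      have "replicate_mset (count A x) x \<subseteq># A" by (simp add: mset_subset_eqI)
      then have "image_mset (\<lambda>x. [:- x, 1:]) (replicate_mset (count A x) x) \<subseteq># image_mset (\<lambda>x. [:- x, 1:]) A"
        by (rule image_mset_subseteq_mono)
      then have "prod_mset (image_mset (\<lambda>x. [:- x, 1:]) (replicate_mset (count A x) x)) dvd (\<Prod>x\<in>#A. [:- x, 1:])"
        by (rule prod_mset_subset_imp_dvd)
      then show ?thesis by simp
    qed
    then have d: "[:- x, 1:] ^ count A x dvd ?p" by (subst A(2)) (rule dvd_smult)
    show ?thesis
    proof (rule ccontr)
      assume "\<not> count A x \<le> 1"
      then have "[:- x, 1:] ^ 2 dvd [:- x, 1:] ^ count A x" by (intro le_imp_power_dvd) simp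
      then show False using d ord[of x] dvd_trans by blast
    qed
  qed
  then have "count A x = 1" if "x \<in># A" for x
    using that count_greater_zero_iff[of A x] by (metis le_antisym Suc_leI One_nat_def)
  then have "card (set_mset A) = size A" by (simp add: size_multiset_overloaded_eq)
  moreover have "set_mset A \<subseteq> {\<beta>. \<beta> ^ q = \<beta>}"
  proof
    fix x assume "x \<in># A"
    then have "poly (\<Prod>x\<in>#A. [:- x, 1:]) x = 0"
      by (metis (mono_tags, lifting) dvd_prod_mset image_eqI poly_eq_0_iff_dvd set_image_mset)
    then have "poly ?p x = 0" by (subst A(2)) simp
    then have "x ^ ?Q = x" by (simp add: poly_monom)
    then show "x \<in> {\<beta>. \<beta> ^ q = \<beta>}" using all by simp
  qed
  moreover have "card {\<beta> :: 'k alg_closure. \<beta> ^ q = \<beta>} = q" "finite {\<beta> :: 'k alg_closure. \<beta> ^ q = \<beta>}"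
    using eC.card_roots_Frobenius card_image[OF eC.inj_e] by simp_all
  ultimately have "?Q \<le> q" using A(1) dp card_mono by metis
  then show False using Q by simp
qed

text \<open>The minimal polynomial of \<open>\<beta>\<close> over \<open>K\<close> still has degree
  \<open>l\<close>. Raising its coefficients to the power \<open>q ^ l\<close> gives another monic
  polynomial killing \<open>\<beta>\<close>, so they are fixed by this power, algebraic, and by
  \<open>constants_closed\<close> constant. Then all \<open>l\<close> conjugates of
  \<open>\<beta>\<close> are roots.\<close>

lemma evc_generic_nonzero:
  assumes l: "prime l" and \<beta>: "generic l \<beta>" and p: "p \<noteq> 0" "degree p < l"
  shows "evc \<beta> p \<noteq> 0"
proof
  assume "evc \<beta> p = 0"
  then obtain r where r: "r \<noteq> 0" "evc \<beta> r = 0" and min: "\<And>s. s \<noteq> 0 \<Longrightarrow> evc \<beta> s = 0 \<Longrightarrow> degree r \<le> degree s"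
    using ex_has_least_nat[of "\<lambda>r. r \<noteq> 0 \<and> evc \<beta> r = 0" p degree] p by blast
  define m where "m = smult (inverse (lead_coeff r)) r"
  have mr: "m = [:inverse (lead_coeff r):] * r" by (simp add: m_def)
  have m: "m \<noteq> 0" "evc \<beta> m = 0" "degree m = degree r" "lead_coeff m = 1"
    using r unfolding mr evc_mult by (simp_all add: m_def)
  let ?Q = "q ^ l"
  have Q0: "0 < ?Q" using q_ge_2 by simp
  have Fr: "(x + y) ^ ?Q = x ^ ?Q + y ^ ?Q" for x y :: 'k using eK.Frobenius_pow_add by simp
  define m' where "m' = map_poly (\<lambda>c. c ^ ?Q) m"
  have cm': "coeff m' i = coeff m i ^ ?Q" for i
    using Q0 by (simp add: m'_def coeff_map_poly)
  have "evc \<beta> (map_poly (\<lambda>c. c ^ ?Q) s) = evc \<beta> s ^ ?Q" for s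
  proof (induction s)
    case (pCons a s)
    have "map_poly (\<lambda>c. c ^ ?Q) (pCons a s) = pCons (a ^ ?Q) (map_poly (\<lambda>c. c ^ ?Q) s)"
      using Q0 by (simp add: poly_eq_iff coeff_map_poly coeff_pCons split: nat.split)
    then have "evc \<beta> (map_poly (\<lambda>c. c ^ ?Q) (pCons a s)) = ac a ^ ?Q + \<beta> * evc \<beta> s ^ ?Q"
      using pCons.IH by simp
    also have "\<dots> = ac a ^ ?Q + (\<beta> * evc \<beta> s) ^ ?Q" using \<beta> by (simp add: generic_def power_mult_distrib)
    also have "\<dots> = (ac a + \<beta> * evc \<beta> s) ^ ?Q" using eC.Frobenius_pow_add by simp
    finally show ?case by simp
  qed (use Q0 in \<open>simp add: power_0_left\<close>)
  then have "evc \<beta> m' = 0" unfolding m'_def m(2) using Q0 by (simp add: power_0_left m(2))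
  have "m' = m"
  proof (rule ccontr)
    assume "m' \<noteq> m"
    then have d: "m' - m \<noteq> 0" by simp
    have "coeff (m' - m) i = 0" if "degree m \<le> i" for i
      using that m(4) coeff_eq_0[of m i] Q0 by (cases "i = degree m") (auto simp: cm' power_0_left)
    then have "degree (m' - m) < degree m" using d by (metis leading_coeff_0_iff not_le)
    moreover have "degree r \<le> degree (m' - m)" using d m(2) \<open>evc \<beta> m' = 0\<close> by (intro min) simp_all
    ultimately show False using m(3) by simp
  qed
  then have cQ: "coeff m i ^ ?Q = coeff m i" for i using cm' by metis
  have cR: "coeff m i \<in> range emb" for i
  proof (rule constants_closed)
    let ?t = "monom 1 ?Q - monom 1 1 :: 'f poly"
    have "1 < ?Q" using q_ge_2 prime_gt_0_nat[OF l] by (intro one_less_power) auto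
    then have "coeff ?t ?Q = 1" by simp
    then have "?t \<noteq> 0" by (metis coeff_0 zero_neq_one)
    moreover have "ev (coeff m i) ?t = 0" using cQ by simp
    ultimately show "algebraic_over emb (coeff m i)" unfolding algebraic_iff by blast
  qed
  have cq: "coeff m i ^ q = coeff m i" for i
  proof -
    obtain c where "coeff m i = emb c" using cR[of i] by blast
    then show ?thesis using eK.e_power_CARD[of c] by simp
  qed
  have "evc (\<beta> ^ (q ^ k)) m = 0" for k
  proof -
    have "coeff m i ^ (q ^ k) = coeff m i" for i by (induction k) (simp_all add: power_mult cq)
    from evc_Frobenius[OF this, where \<beta> = \<beta>] show ?thesis using m(2) q_ge_2 by (simp add: power_0_left)
  qed
  moreover have "card ((\<lambda>k. \<beta> ^ (q ^ k)) ` {..<l}) = l" using card_image[OF generic_inj[OF l \<beta>]] by simp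
  moreover have "degree m < l" using min[OF p(1) \<open>evc \<beta> p = 0\<close>] m(3) p(2) by simp
  ultimately have "m = 0" by (intro evc_zero_if_many_roots[of "(\<lambda>k. \<beta> ^ (q ^ k)) ` {..<l}"]) auto
  then show False using m(1) by simp
qed

text \<open>Shifting the exponent permutes the Frobenius orbit cyclically.\<close>

lemma generic_shift:
  fixes h :: "'k alg_closure \<Rightarrow> 'a::comm_monoid_mult"
  assumes \<beta>: "generic l \<beta>" and l: "0 < l"
  shows "(\<Prod>k<l. h (\<beta> ^ (q ^ (i + k)))) = (\<Prod>k<l. h (\<beta> ^ (q ^ k)))"
proof (induction i)
  case (Suc i)
  obtain l' where l': "l = Suc l'" using l by (cases l) auto
  have "\<beta> ^ (q ^ (i + l)) = \<beta> ^ (q ^ i)"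
    using \<beta> by (simp add: generic_def power_add power_mult mult.commute[of "q ^ i"])
  then have "(\<Prod>k<l. h (\<beta> ^ (q ^ (Suc i + k)))) = (\<Prod>k<l'. h (\<beta> ^ (q ^ (Suc i + k)))) * h (\<beta> ^ (q ^ i))"
    unfolding l' by simp
  also have "\<dots> = h (\<beta> ^ (q ^ (i + 0))) * (\<Prod>k<l'. h (\<beta> ^ (q ^ (i + Suc k))))" by (simp add: mult.commute)
  also have "\<dots> = (\<Prod>k<l. h (\<beta> ^ (q ^ (i + k))))" unfolding l' by (rule prod.lessThan_Suc_shift[symmetric])
  finally show ?case using Suc by simp
qed simp

text \<open>The product over the Frobenius orbit of \<open>\<beta>\<close> is unchanged when its
  coefficients are raised to the power \<open>q\<close>, so they are constants by
  \<open>card_roots_Frobenius\<close>.\<close>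

lemma exists_generic_poly:
  assumes l: "prime l" and \<beta>: "generic l \<beta>"
  shows "\<exists>P :: 'f poly. degree P = l \<and> (\<forall>k. evc (\<beta> ^ (q ^ k)) (map_poly emb P) = 0)"
proof -
  define R where "R = (\<Prod>k<l. [:- (\<beta> ^ (q ^ k)), 1:])"
  note l0 = prime_gt_0_nat[OF l]
  have dR: "degree R = l" unfolding R_def by (subst degree_prod_eq_sum_degree) auto
  let ?F = "map_poly (\<lambda>c :: 'k alg_closure. c ^ q)"
  have q0: "0 < q" using q_ge_2 by simp
  have Fm: "?F (p * r) = ?F p * ?F r" for p r
    using q0 eC.Frobenius_add by (intro map_poly_hom_mult) (simp_all add: power_mult_distrib)
  have Fp: "?F (prod h A) = (\<Prod>a\<in>A. ?F (h a))" for h and A :: "nat set"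
    by (induction A rule: infinite_finite_induct) (simp_all add: Fm map_poly_1)
  have lin: "?F [:- c, 1:] = [:- (c ^ q), 1:]" for c
  proof -
    have "(- c) ^ q = - (c ^ q)" using eC.Frobenius_add[of "- c" c] q0 by (simp add: power_0_left eq_neg_iff_add_eq_0)
    then show ?thesis using q0 by (simp add: map_poly_pCons)
  qed
  have "?F R = (\<Prod>k<l. [:- (\<beta> ^ (q ^ (1 + k))), 1:])"
    unfolding R_def Fp lin by (simp add: power_mult mult.commute flip: power_mult)
  also have "\<dots> = R" unfolding R_def by (rule generic_shift[OF \<beta> l0, of "\<lambda>c. [:- c, 1:]"])
  finally have FR: "?F R = R" .
  have "coeff R i \<in> range (\<lambda>c. ac (emb c))" for i
  proof -
    have "coeff (?F R) i = coeff R i ^ q" using q0 by (simp add: coeff_map_poly)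
    then have "coeff R i ^ CARD('f) = coeff R i" using FR by simp
    then show ?thesis using eC.card_roots_Frobenius by blast
  qed
  then have "\<forall>i. \<exists>c. coeff R i = ac (emb c)" by blast
  then obtain c where c: "\<And>i. coeff R i = ac (emb (c i))" by metis
  define P where "P = Poly (map c [0..<Suc l])"
  have cP: "coeff P i = c i" for i
  proof -
    have "c i = 0" if "l < i"
    proof -
      have "coeff R i = 0" using that dR by (intro coeff_eq_0) simp
      then show ?thesis using c[of i] by simp
    qed
    then show ?thesis by (auto simp: P_def nth_default_def simp del: upt_Suc)
  qed
  have PR: "map_poly (\<lambda>c. ac (emb c)) P = R"
    by (simp add: poly_eq_iff coeff_map_poly cP c)
  have dP: "degree P = l" using degree_map_poly[of "\<lambda>c. ac (emb c)" P] PR dR by simp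
  moreover have "evc (\<beta> ^ (q ^ k)) (map_poly emb P) = 0" for k
  proof -
    have "poly R (\<beta> ^ (q ^ k)) = (\<Prod>j<l. \<beta> ^ (q ^ k) - \<beta> ^ (q ^ j))"
      unfolding R_def poly_prod by simp
    also have "\<dots> = 0"
    proof -
      have "\<beta> ^ (q ^ k) = \<beta> ^ (q ^ (k mod l))"
      proof -
        have per: "\<beta> ^ (q ^ (l * m)) = \<beta>" for m
          using \<beta> by (induction m) (simp_all add: generic_def power_add power_mult)
        have "q ^ k = q ^ (l * (k div l)) * q ^ (k mod l)" by (simp flip: power_add)
        then show ?thesis using per[of "k div l"] by (simp add: power_mult)
      qed
      then show ?thesis using l0 by (intro prod_zero) (auto intro!: bexI[of _ "k mod l"])
    qed
    finally show ?thesis unfolding evc_emb PR .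
  qed
  ultimately show ?thesis by blast
qed

text \<open>\<open>N\<close> is the norm of \<open>f(\<beta>)\<close>. The polynomial
  \<open>F\<close> takes the value of the norm at all \<open>l\<close> conjugates, so its remainder
  modulo \<open>P\<close>, of degree less than \<open>l\<close>, is this constant; it is nonzero by
  \<open>evc_generic_nonzero\<close>. \<open>S\<close> is the quotient of the division.\<close>

lemma exists_norm:
  assumes l: "prime l" and \<beta>: "generic l \<beta>"
    and P: "degree P = l" "\<And>k. evc (\<beta> ^ (q ^ k)) (map_poly emb P) = 0"
    and f: "f \<noteq> 0" "degree f < l"
  shows "\<exists>N S. N \<noteq> 0 \<and> (\<forall>a. (\<Prod>k<l. poly f (a ^ (q ^ k))) = poly S a * ev a P + N)"
proof -
  note l0 = prime_gt_0_nat[OF l]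
  define F where "F = (\<Prod>k<l. pcompose f (monom 1 (q ^ k)))"
  define P' where "P' = map_poly emb P"
  have dP': "degree P' = l" unfolding P'_def using degree_map_poly[of emb P] P(1) by simp
  then have P'0: "P' \<noteq> 0" using l0 by auto
  define G where "G = F mod P'"
  have FG: "F = F div P' * P' + G" by (simp add: G_def)
  have dG: "degree G < l" using degree_mod_less[OF P'0, of F] l0 dP' unfolding G_def by auto
  define \<nu> where "\<nu> = (\<Prod>k<l. evc (\<beta> ^ (q ^ k)) f)"
  have evF: "evc (\<beta> ^ (q ^ i)) F = \<nu>" for i
  proof -
    have "evc (\<beta> ^ (q ^ i)) F = (\<Prod>k<l. evc (\<beta> ^ (q ^ (i + k))) f)"
      by (simp add: F_def evc_prod evc_pcompose power_add power_mult)
    also have "\<dots> = \<nu>" unfolding \<nu>_def by (rule generic_shift[OF \<beta> l0])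
    finally show ?thesis .
  qed
  have evG: "evc (\<beta> ^ (q ^ i)) G = \<nu>" for i
  proof -
    have "evc (\<beta> ^ (q ^ i)) F = evc (\<beta> ^ (q ^ i)) (F div P' * P' + G)" using FG by (rule arg_cong)
    then show ?thesis unfolding evF using P(2)[of i] by (simp add: P'_def)
  qed
  let ?p = "map_poly ac G - [:\<nu>:]"
  have "?p = 0"
  proof (rule ccontr)
    assume p0: "?p \<noteq> 0"
    have "card ((\<lambda>k. \<beta> ^ (q ^ k)) ` {..<l}) = l" using card_image[OF generic_inj[OF l \<beta>]] by simp
    moreover have "(\<lambda>k. \<beta> ^ (q ^ k)) ` {..<l} \<subseteq> {x. poly ?p x = 0}" using evG by (auto simp: evc_def)
    ultimately have "l \<le> card {x. poly ?p x = 0}" using card_mono[OF poly_roots_finite[OF p0]] by metis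
    also have "\<dots> \<le> degree ?p" by (rule card_poly_roots_bound[OF p0])
    also have "degree ?p < l"
      using dG l0 degree_map_poly[of ac G] by (intro degree_diff_less) auto
    finally show False by simp
  qed
  then have co: "ac (coeff G i) = (if i = 0 then \<nu> else 0)" for i
    by (simp add: poly_eq_iff coeff_map_poly coeff_pCons split: nat.splits)
  have "G = [:coeff G 0:]"
    using co by (auto simp: poly_eq_iff coeff_pCons split: nat.splits) (metis nat.distinct(1) to_ac_eq_0_iff)
  moreover have "\<nu> \<noteq> 0"
    unfolding \<nu>_def using evc_generic_nonzero[OF l generic_power[OF \<beta> l0] f] by simp
  then have "coeff G 0 \<noteq> 0" using co[of 0] by auto
  moreover have "(\<Prod>k<l. poly f (a ^ (q ^ k))) = poly (F div P') a * ev a P + coeff G 0" for a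
  proof -
    have "(\<Prod>k<l. poly f (a ^ (q ^ k))) = poly F a"
      by (simp add: F_def poly_prod poly_pcompose poly_monom)
    also have "\<dots> = poly (F div P' * P' + G) a" using FG by simp
    also have "\<dots> = poly (F div P') a * ev a P + poly G a" by (simp add: P'_def ev_def)
    also have "poly G a = coeff G 0" by (subst \<open>G = [:coeff G 0:]\<close>) simp
    finally show ?thesis .
  qed
  ultimately show ?thesis by blast
qed

section \<open>Residue fields and approximate roots at one place\<close>

context
  fixes v assumes v: "v \<in> places emb"
begin

lemma pw_prime:
  assumes "x \<in> pw v 0" "y \<in> pw v 0" "x * y \<in> pw v 1"
  shows "x \<in> pw v 1 \<or> y \<in> pw v 1"
  using assms place_mult[OF v, of x y] by (cases "x = 0 \<or> y = 0") (auto simp: pw_iff)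

lemma pw_prod: "(\<And>r. r \<in> A \<Longrightarrow> u r \<in> pw v 0) \<Longrightarrow> prod u A \<in> pw v 0"
  by (induction A rule: infinite_finite_induct) (auto intro: pw_mult_0[OF v] pw_1[OF v])

lemma pw_prod_unit:
  "finite A \<Longrightarrow> (\<And>r. r \<in> A \<Longrightarrow> u r \<in> pw v 0 \<and> u r \<notin> pw v 1) \<Longrightarrow> prod u A \<notin> pw v 1"
proof (induction A rule: finite_induct)
  case (insert a A)
  then show ?case using pw_prime[of "u a" "prod u A"] pw_prod[of A u] by auto
qed (simp add: pw_iff place_1[OF v])

lemma pw_prod_cong:
  assumes "\<And>r. r \<in> A \<Longrightarrow> f r \<in> pw v 0" "\<And>r. r \<in> A \<Longrightarrow> k r \<in> pw v 0" "\<And>r. r \<in> A \<Longrightarrow> f r - k r \<in> pw v 1"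
  shows "prod f A - prod k A \<in> pw v 1"
  using assms
proof (induction A rule: infinite_finite_induct)
  case (insert a A)
  have "f a * (prod f A - prod k A) + (f a - k a) * prod k A \<in> pw v 1"
  proof (rule pw_add[OF v])
    show "f a * (prod f A - prod k A) \<in> pw v 1" using insert by (intro pw_mult_0[OF v]) auto
    have "prod k A * (f a - k a) \<in> pw v 1" using insert by (intro pw_mult_0[OF v] pw_prod) auto
    then show "(f a - k a) * prod k A \<in> pw v 1" by (simp add: mult.commute)
  qed
  then show ?case using insert by (simp add: algebra_simps)
qed simp_all

lemma residue_reps:
  "\<exists>T\<subseteq>pw v 0. finite T \<and> card T = q ^ pdeg v \<and> (\<forall>x\<in>pw v 0. \<exists>r\<in>T. x - r \<in> pw v 1) \<and>
     (\<forall>r\<in>T. \<forall>s\<in>T. r - s \<in> pw v 1 \<longrightarrow> r = s)"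
proof -
  have cs: "finite (cosets (pw v 0) (pw v 1))" "card (cosets (pw v 0) (pw v 1)) = q ^ pdeg v"
    using cosets_pw[OF v, of 0 1] by auto
  let ?c = "\<lambda>x. (+) x ` pw v 1"
  have "\<exists>T\<subseteq>pw v 0. inj_on ?c T \<and> cosets (pw v 0) (pw v 1) = ?c ` T"
    unfolding cosets_def by (rule subset_image_inj[THEN iffD1, OF subset_refl])
  then obtain T where T: "T \<subseteq> pw v 0" "inj_on ?c T" "cosets (pw v 0) (pw v 1) = ?c ` T" by blast
  have "finite T" using cs(1) unfolding T(3) by (rule finite_imageD) (rule T(2))
  moreover have "card T = q ^ pdeg v" using cs(2) card_image[OF T(2)] unfolding T(3) by simp
  moreover have "\<exists>r\<in>T. x - r \<in> pw v 1" if "x \<in> pw v 0" for x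
  proof -
    have "?c x \<in> ?c ` T" unfolding T(3)[symmetric] using that by (auto simp: cosets_def)
    then obtain r where "r \<in> T" "?c x = ?c r" by blast
    then show ?thesis unfolding coset_eq_iff[OF pw_subgroup[OF v]] by blast
  qed
  moreover have "r = s" if "r \<in> T" "s \<in> T" "r - s \<in> pw v 1" for r s
    using inj_onD[OF T(2), of r s] that unfolding coset_eq_iff[OF pw_subgroup[OF v]] by blast
  ultimately show ?thesis using T(1) by (intro exI[of _ T]) simp
qed

text \<open>Multiplication by a unit \<open>y\<close> permutes the nonzero residue classes;
  comparing the products of all representatives and cancelling gives \<open>y ^ (N - 1) = 1\<close>
  modulo \<open>v\<close>.\<close>

lemma residue_Fermat:
  assumes y: "y \<in> pw v 0"
  shows "y ^ (q ^ pdeg v) - y \<in> pw v 1"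
proof -
  define N where "N = q ^ pdeg v"
  have N: "0 < N" using q_ge_2 by (simp add: N_def)
  show ?thesis
  proof (cases "y \<in> pw v 1")
    case True
    have "y ^ N = y ^ (N - 1) * y" using N by (simp flip: power_Suc2)
    then have "y ^ N \<in> pw v 1" using pw_power[OF v y, of "N - 1"] True by (simp add: pw_mult_0[OF v])
    then show ?thesis using True unfolding N_def by (rule pw_diff[OF v])
  next
    case False
    obtain T where T: "T \<subseteq> pw v 0" "finite T" "card T = N" "\<And>x. x \<in> pw v 0 \<Longrightarrow> \<exists>r\<in>T. x - r \<in> pw v 1"
      "\<And>r s. r \<in> T \<Longrightarrow> s \<in> T \<Longrightarrow> r - s \<in> pw v 1 \<Longrightarrow> r = s"
      using residue_reps unfolding N_def by auto
    define T' where "T' = {r \<in> T. r \<notin> pw v 1}"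
    have T': "finite T'" "T' \<subseteq> T" using T(2) by (auto simp: T'_def)
    obtain r0 where r0: "r0 \<in> T" "0 - r0 \<in> pw v 1" using T(4)[of 0] by auto
    have "T = insert r0 T'"
    proof -
      have "r = r0" if "r \<in> T" "r \<in> pw v 1" for r
      proof (rule T(5)[OF that(1) r0(1)])
        have "r0 \<in> pw v 1" using r0(2) pw_uminus[OF v] by simp
        then show "r - r0 \<in> pw v 1" using that(2) by (intro pw_diff[OF v])
      qed
      then show ?thesis using r0(1) by (auto simp: T'_def)
    qed
    moreover have "r0 \<notin> T'" using r0 pw_uminus[OF v] by (simp add: T'_def)
    ultimately have cT': "card T' = N - 1" using T(3) T'(1) by simp
    have "\<forall>r\<in>T'. \<exists>s\<in>T. y * r - s \<in> pw v 1"
      using T(1,4) T'(2) pw_mult_0[OF v y] by (meson subsetD)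
    then obtain \<sigma> where \<sigma>: "\<And>r. r \<in> T' \<Longrightarrow> \<sigma> r \<in> T \<and> y * r - \<sigma> r \<in> pw v 1" by metis
    have \<sigma>T': "\<sigma> ` T' \<subseteq> T'"
    proof clarify
      fix r assume r: "r \<in> T'"
      have "\<sigma> r \<notin> pw v 1"
      proof
        assume "\<sigma> r \<in> pw v 1"
        then have "(y * r - \<sigma> r) + \<sigma> r \<in> pw v 1" using \<sigma>[OF r] by (intro pw_add[OF v]) auto
        then have "y * r \<in> pw v 1" by simp
        moreover have "r \<in> pw v 0" "r \<notin> pw v 1" using r T(1) by (auto simp: T'_def)
        ultimately show False using pw_prime[OF y] False by blast
      qed
      then show "\<sigma> r \<in> T'" using \<sigma>[OF r] by (simp add: T'_def)
    qed
    have inj: "inj_on \<sigma> T'"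
    proof (rule inj_onI)
      fix r s assume r: "r \<in> T'" and s: "s \<in> T'" and eq: "\<sigma> r = \<sigma> s"
      have "(y * r - \<sigma> r) - (y * s - \<sigma> s) \<in> pw v 1" by (rule pw_diff[OF v conjunct2[OF \<sigma>[OF r]] conjunct2[OF \<sigma>[OF s]]])
      then have "y * (r - s) \<in> pw v 1" using eq by (simp add: algebra_simps)
      moreover have "r - s \<in> pw v 0" using r s T(1) T'(2) by (intro pw_diff[OF v]) auto
      ultimately have "r - s \<in> pw v 1" using pw_prime[OF y] False by blast
      then show "r = s" using T(5) r s T'(2) by blast
    qed
    have "\<sigma> ` T' = T'" by (rule endo_inj_surj[OF T'(1) \<sigma>T' inj])
    then have "prod \<sigma> T' = prod (\<lambda>r. r) T'" using prod.reindex[OF inj, of "\<lambda>r. r"] by simp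
    moreover have "(\<Prod>r\<in>T'. y * r) - prod \<sigma> T' \<in> pw v 1"
    proof (rule pw_prod_cong)
      fix r assume r: "r \<in> T'"
      show "y * r \<in> pw v 0" using r T(1) T'(2) by (intro pw_mult_0[OF v y]) auto
      show "\<sigma> r \<in> pw v 0" "y * r - \<sigma> r \<in> pw v 1" using \<sigma>[OF r] T(1) by auto
    qed
    ultimately have "y ^ (N - 1) * prod (\<lambda>r. r) T' - prod (\<lambda>r. r) T' \<in> pw v 1"
      by (simp add: prod.distrib cT')
    then have "(y ^ (N - 1) - 1) * prod (\<lambda>r. r) T' \<in> pw v 1" by (simp add: left_diff_distrib)
    moreover have "y ^ (N - 1) - 1 \<in> pw v 0"
      using pw_power[OF v y, of "N - 1"] pw_1[OF v] by (intro pw_diff[OF v]) auto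
    moreover have "prod (\<lambda>r. r) T' \<in> pw v 0" using T(1) T'(2) by (intro pw_prod) auto
    moreover have "prod (\<lambda>r. r) T' \<notin> pw v 1"
      using T(1) by (intro pw_prod_unit[OF T'(1)]) (auto simp: T'_def)
    ultimately have "y ^ (N - 1) - 1 \<in> pw v 1" using pw_prime by blast
    then have "y * (y ^ (N - 1) - 1) \<in> pw v 1" by (rule pw_mult_0[OF v y])
    moreover have "y * (y ^ (N - 1) - 1) = y ^ N - y"
      using N by (simp add: right_diff_distrib flip: power_Suc)
    ultimately show ?thesis unfolding N_def by simp
  qed
qed

lemma pw_poly: "(\<And>i. coeff p i \<in> pw v m) \<Longrightarrow> a \<in> pw v 0 \<Longrightarrow> poly p a \<in> pw v m"
proof (induction p)
  case (pCons c p)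
  have "coeff p i \<in> pw v m" for i using pCons.prems(1)[of "Suc i"] by simp
  then have "poly p a \<in> pw v m" using pCons.IH pCons.prems(2) by blast
  moreover have "c \<in> pw v m" using pCons.prems(1)[of 0] by simp
  ultimately show ?case using pCons.prems(2) by (simp add: pw_add[OF v] pw_mult_0[OF v])
qed simp

lemma coeff_synthetic_div_pw:
  "(\<And>i. coeff p i \<in> pw v 0) \<Longrightarrow> a \<in> pw v 0 \<Longrightarrow> coeff (synthetic_div p a) i \<in> pw v 0"
proof (induction p arbitrary: i)
  case (pCons c p)
  have c: "coeff p i \<in> pw v 0" for i using pCons.prems(1)[of "Suc i"] by simp
  then show ?case using pCons.IH[OF c pCons.prems(2)] pw_poly[OF c pCons.prems(2)] pCons.prems(2)
    by (simp add: coeff_pCons split: nat.split)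
qed simp

text \<open>Roots in the residue field are counted through pairwise incongruent representatives:
  synthetic division splits off a root with integral coefficients, and \<open>pw_prime\<close> plays
  the part of the absence of zero divisors.\<close>

lemma residue_roots_bound:
  assumes "\<And>i. coeff p i \<in> pw v 0" "lead_coeff p \<notin> pw v 1" "finite Y" "Y \<subseteq> pw v 0"
    "\<And>r s. r \<in> Y \<Longrightarrow> s \<in> Y \<Longrightarrow> r - s \<in> pw v 1 \<Longrightarrow> r = s" "\<And>y. y \<in> Y \<Longrightarrow> poly p y \<in> pw v 1"
  shows "card Y \<le> degree p"
  using assms
proof (induction "degree p" arbitrary: p Y)
  case 0
  have "y \<notin> Y" for y
  proof
    assume y: "y \<in> Y"
    have "poly p y = lead_coeff p" using 0(1) by (metis degree_eq_zeroE poly_pCons mult_zero_right add.right_neutral poly_0 coeff_pCons_0)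
    then show False using 0(7)[OF y] 0(3) by simp
  qed
  then have "Y = {}" by blast
  then show ?case by simp
next
  case (Suc d)
  show ?case
  proof (cases "Y = {}")
    case False
    then obtain y0 where y0: "y0 \<in> Y" by blast
    then have y0R: "y0 \<in> pw v 0" using Suc.prems(4) by blast
    define s where "s = synthetic_div p y0"
    have ps: "p + smult y0 s = pCons (poly p y0) s" unfolding s_def by (rule synthetic_div_correct)
    have ds: "degree s = d" using Suc.hyps(2) by (simp add: s_def degree_synthetic_div)
    have "coeff (p + smult y0 s) (Suc d) = coeff (pCons (poly p y0) s) (Suc d)" using ps by (rule arg_cong)
    then have lc: "lead_coeff s = lead_coeff p" using ds Suc.hyps(2)[symmetric] coeff_eq_0[of s "Suc d"] by simp
    have "card (Y - {y0}) \<le> degree s"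
    proof (rule Suc.hyps(1))
      show "d = degree s" using ds by simp
      show "coeff s i \<in> pw v 0" for i unfolding s_def by (rule coeff_synthetic_div_pw[OF Suc.prems(1) y0R])
      show "lead_coeff s \<notin> pw v 1" using lc Suc.prems(2) by simp
      show "finite (Y - {y0})" "Y - {y0} \<subseteq> pw v 0" using Suc.prems(3,4) by auto
      show "r = t" if "r \<in> Y - {y0}" "t \<in> Y - {y0}" "r - t \<in> pw v 1" for r t
        using Suc.prems(5)[of r t] that by blast
      show "poly s y \<in> pw v 1" if y: "y \<in> Y - {y0}" for y
      proof -
        have yR: "y \<in> pw v 0" using y Suc.prems(4) by blast
        have "poly (p + smult y0 s) y = poly (pCons (poly p y0) s) y" using ps by simp
        then have "(y - y0) * poly s y = poly p y - poly p y0" by (simp add: algebra_simps)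
        also have "\<dots> \<in> pw v 1" using Suc.prems(6)[OF y0] Suc.prems(6)[of y] y by (intro pw_diff[OF v]) auto
        finally have "(y - y0) * poly s y \<in> pw v 1" .
        moreover have "y - y0 \<in> pw v 0" by (rule pw_diff[OF v yR y0R])
        moreover have "y - y0 \<notin> pw v 1" using Suc.prems(5)[of y y0] y y0 by blast
        moreover have "poly s y \<in> pw v 0"
          unfolding s_def by (rule pw_poly[OF coeff_synthetic_div_pw[OF Suc.prems(1) y0R] yR])
        ultimately show ?thesis using pw_prime by blast
      qed
    qed
    then show ?thesis using y0 Suc.prems(3) ds Suc.hyps(2) by (simp add: card_Diff_singleton)
  qed simp
qed

text \<open>As \<open>l\<close> divides the degree of \<open>v\<close>, the conjugates of
  \<open>\<beta>\<close> are roots of \<open>X ^ N - X\<close>, which is therefore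
  \<open>T * P\<close> with \<open>degree T = N - l\<close>. All \<open>N\<close> residues are roots
  of the product, too many for \<open>T\<close> alone.\<close>

lemma exists_residue_root:
  assumes l: "prime l" "l dvd pdeg v" and \<beta>: "generic l \<beta>"
    and P: "degree P = l" "\<And>k. evc (\<beta> ^ (q ^ k)) (map_poly emb P) = 0"
  shows "\<exists>a\<in>pw v 0. ev a P \<in> pw v 1"
proof (rule ccontr)
  assume no: "\<not> ?thesis"
  note l0 = prime_gt_0_nat[OF l(1)]
  define N where "N = q ^ pdeg v"
  have "pdeg v < 2 ^ pdeg v" by (rule less_exp)
  also have "2 ^ pdeg v \<le> N" unfolding N_def using q_ge_2 by (rule power_mono) simp
  finally have N1: "1 < N" using place_degree_pos[OF v] by linarith
  have mh: "map_poly emb (p * r) = map_poly emb p * map_poly emb r" for p r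
    by (rule map_poly_hom_mult) (simp_all add: emb_add emb_mult)
  have ma: "map_poly emb (p + r) = map_poly emb p + map_poly emb r" for p r
    by (simp add: poly_eq_iff coeff_map_poly emb_add)
  define t where "t = monom 1 N - monom (1 :: 'f) 1"
  have ct: "coeff t N = 1" using N1 by (simp add: t_def)
  then have t0: "t \<noteq> 0" by (metis coeff_0 zero_neq_one)
  have "degree t \<le> N" unfolding t_def using N1 by (intro degree_diff_le) (auto intro: order_trans[OF degree_monom_le])
  then have dt: "degree t = N" using ct by (metis le_antisym le_degree zero_neq_one)
  have P0: "P \<noteq> 0" using P(1) l0 by auto
  define T where "T = t div P"
  define r where "r = t mod P"
  have tT: "t = T * P + r" by (simp add: T_def r_def)
  have "map_poly emb r = 0"
  proof (rule evc_zero_if_many_roots)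
    show "finite ((\<lambda>k. \<beta> ^ (q ^ k)) ` {..<l})" by simp
    have "degree r < l" using degree_mod_less[OF P0, of t] l0 P(1) unfolding r_def by auto
    then show "degree (map_poly emb r) < card ((\<lambda>k. \<beta> ^ (q ^ k)) ` {..<l})"
      using card_image[OF generic_inj[OF l(1) \<beta>]] degree_map_poly[of emb r] by simp
    fix \<gamma> assume "\<gamma> \<in> (\<lambda>k. \<beta> ^ (q ^ k)) ` {..<l}"
    then obtain k where k: "\<gamma> = \<beta> ^ (q ^ k)" by blast
    obtain m where m: "pdeg v = l * m" using l(2) by (elim dvdE)
    have "\<gamma> ^ (q ^ l) = \<gamma>" using generic_power[OF \<beta> l0, of k] k by (simp add: generic_def)
    then have "\<gamma> ^ (q ^ (l * m)) = \<gamma>" by (induction m) (simp_all add: power_add power_mult)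
    then have "\<gamma> ^ N = \<gamma>" unfolding N_def m .
    moreover have "map_poly emb t = monom 1 N - monom 1 1"
      by (simp add: t_def poly_eq_iff coeff_map_poly emb_diff)
    ultimately have "evc \<gamma> (map_poly emb t) = 0" by simp
    then have "evc \<gamma> (map_poly emb T * map_poly emb P + map_poly emb r) = 0" using tT mh ma by metis
    then show "evc \<gamma> (map_poly emb r) = 0" using P(2)[of k] k by simp
  qed
  then have "r = 0" by (simp add: poly_eq_iff coeff_map_poly)
  then have tT: "t = T * P" using tT by simp
  then have T0: "T \<noteq> 0" using t0 by auto
  then have dT: "degree T + l = N" using dt P(1) P0 degree_mult_eq[of T P] tT by simp
  obtain Y where Y: "Y \<subseteq> pw v 0" "finite Y" "card Y = N"
    "\<And>r s. r \<in> Y \<Longrightarrow> s \<in> Y \<Longrightarrow> r - s \<in> pw v 1 \<Longrightarrow> r = s"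
    using residue_reps unfolding N_def by auto
  have "card Y \<le> degree (map_poly emb T)"
  proof (rule residue_roots_bound)
    show "coeff (map_poly emb T) i \<in> pw v 0" for i by (simp add: coeff_map_poly pw_emb[OF v])
    show "lead_coeff (map_poly emb T) \<notin> pw v 1"
      using T0 degree_map_poly[of emb T] place_emb[OF v] by (simp add: coeff_map_poly pw_iff)
    show "poly (map_poly emb T) y \<in> pw v 1" if y: "y \<in> Y" for y
    proof -
      have yR: "y \<in> pw v 0" using y Y(1) by blast
      have "ev y t = y ^ N - y" by (simp add: t_def)
      then have "ev y T * ev y P \<in> pw v 1" using residue_Fermat[OF yR] unfolding N_def[symmetric] tT by simp
      moreover have "ev y P \<notin> pw v 1" using no yR by blast
      ultimately have "ev y T \<in> pw v 1" using pw_prime[OF pw_ev[OF v yR] pw_ev[OF v yR]] by blast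
      then show ?thesis by (simp add: ev_def)
    qed
  qed (use Y in auto)
  then show False using Y(3) dT l0 degree_map_poly[of emb T] by simp
qed

text \<open>The Frobenius takes the place of Hensel lifting: \<open>P\<close> has constant
  coefficients, so replacing \<open>a0\<close> by \<open>a0 ^ (q ^ M)\<close> raises the value of
  \<open>P\<close> to the same power and makes it highly divisible.\<close>

lemma exists_approximate_root:
  assumes l: "prime l" "l dvd pdeg v" and \<beta>: "generic l \<beta>"
    and P: "degree P = l" "\<And>k. evc (\<beta> ^ (q ^ k)) (map_poly emb P) = 0"
    and V: "finite V"
  shows "\<exists>a\<in>pw v 0. \<forall>f\<in>V. poly (S f) a * ev a P \<in> pw v (v (N f) + 1)"
proof -
  obtain a0 where a0: "a0 \<in> pw v 0" "ev a0 P \<in> pw v 1"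
    using exists_residue_root[OF l \<beta> P] by blast
  define s where "s f = (\<Sum>i\<le>degree (S f). \<bar>v (coeff (S f) i)\<bar>)" for f
  have cs: "coeff (S f) i \<in> pw v (- s f)" for f i
  proof (cases "i \<le> degree (S f)")
    case True
    then have "\<bar>v (coeff (S f) i)\<bar> \<le> s f" unfolding s_def by (intro member_le_sum) auto
    then show ?thesis by (auto simp: pw_def)
  qed (simp add: coeff_eq_0)
  \<comment> \<open>Large enough, for all \<open>f\<close> in \<open>V\<close> at once, to offset
    the poles of the coefficients of \<open>S f\<close> and to exceed the valuation of
    \<open>N f\<close>.\<close>
  define M where "M = (\<Sum>f\<in>V. nat (\<bar>v (N f)\<bar> + 1 + \<bar>s f\<bar>))"
  define a where "a = a0 ^ (q ^ M)"
  have aR: "a \<in> pw v 0" using pw_power[OF v a0(1), of "q ^ M"] by (simp add: a_def)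
  have "ev a P = ev a0 P ^ (q ^ M)" unfolding a_def by (rule ev_Frobenius[symmetric])
  then have eP: "ev a P \<in> pw v (int (q ^ M))" using pw_power[OF v a0(2), of "q ^ M"] by simp
  have "M < 2 ^ M" by (rule less_exp)
  also have "2 ^ M \<le> q ^ M" using q_ge_2 by (rule power_mono) simp
  finally have MqM: "int M \<le> int (q ^ M)" by (simp only: of_nat_le_iff)
  have "poly (S f) a * ev a P \<in> pw v (v (N f) + 1)" if f: "f \<in> V" for f
  proof -
    have "nat (\<bar>v (N f)\<bar> + 1 + \<bar>s f\<bar>) \<le> M"
      unfolding M_def using V f by (intro member_le_sum[of f V "\<lambda>f. nat (\<bar>v (N f)\<bar> + 1 + \<bar>s f\<bar>)"]) auto
    then have "v (N f) + 1 \<le> - s f + int (q ^ M)" using MqM by linarith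
    moreover have "poly (S f) a * ev a P \<in> pw v (- s f + int (q ^ M))"
      by (rule pw_mult[OF v pw_poly[OF cs aR] eP])
    ultimately show ?thesis by (rule pw_mono[rotated])
  qed
  then show ?thesis using aR by blast
qed

lemma place_prod: "finite A \<Longrightarrow> (\<And>i. i \<in> A \<Longrightarrow> u i \<noteq> 0) \<Longrightarrow> v (prod u A) = (\<Sum>i\<in>A. v (u i))"
  by (induction A rule: finite_induct) (simp_all add: place_1[OF v] place_mult[OF v])

end

text \<open>Prescribing \<open>m\<close> more zeros at \<open>v\<close> cuts a space down by a
  factor of at most \<open>q ^ (m * pdeg v)\<close>. The maps \<open>h v\<close> may differ from
  place to place because they will be evaluations at different approximate roots.\<close>

lemma card_le_linear_conditions:
  fixes h :: "('k \<Rightarrow> int) \<Rightarrow> 'b::ab_group_add \<Rightarrow> 'k"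
  assumes G: "add_subgroup G" "finite G"
    and h: "\<And>v x y. v \<in> places emb \<Longrightarrow> h v (x - y) = h v x - h v y"
      "\<And>v x. v \<in> places emb \<Longrightarrow> x \<in> G \<Longrightarrow> h v x \<in> pw v (- D v)"
    and A: "A \<in> Eff"
  shows "add_subgroup {x \<in> G. \<forall>v\<in>places emb. h v x \<in> pw v (A v - D v)}"
    and "card G \<le> q ^ nat (deg A) * card {x \<in> G. \<forall>v\<in>places emb. h v x \<in> pw v (A v - D v)}"
proof -
  have h0: "h v 0 = 0" if "v \<in> places emb" for v using h(1)[OF that, of 0 0] by simp
  have sub: "add_subgroup {x \<in> G. \<forall>v\<in>places emb. h v x \<in> pw v (A v - D v)}" for A
    unfolding add_subgroup_def using G(1) h0 h(1) pw_diff by (auto simp: add_subgroup_def)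
  then show "add_subgroup {x \<in> G. \<forall>v\<in>places emb. h v x \<in> pw v (A v - D v)}" .
  show "card G \<le> q ^ nat (deg A) * card {x \<in> G. \<forall>v\<in>places emb. h v x \<in> pw v (A v - D v)}"
    using A
  proof (induction rule: Eff_induct)
    case zero
    have "{x \<in> G. \<forall>v\<in>places emb. h v x \<in> pw v (0 - D v)} = G" using h(2) by auto
    then show ?case by simp
  next
    case (upd A v m)
    let ?G = "\<lambda>A. {x \<in> G. \<forall>v\<in>places emb. h v x \<in> pw v (A v - D v)}"
    let ?A' = "A(v := int m)"
    have eq: "{x \<in> ?G A. h v x \<in> pw v (- D v + int m)} = ?G ?A'"
    proof (intro equalityI subsetI)
      fix x assume x: "x \<in> {x \<in> ?G A. h v x \<in> pw v (- D v + int m)}"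
      have "h w x \<in> pw w (?A' w - D w)" if "w \<in> places emb" for w
        using x that by (cases "w = v") (auto simp: add.commute)
      then show "x \<in> ?G ?A'" using x by blast
    next
      fix x assume x: "x \<in> ?G ?A'"
      then have v': "h v x \<in> pw v (int m - D v)" using upd(2) by (auto dest!: bspec[of _ _ v])
      have "h w x \<in> pw w (A w - D w)" if "w \<in> places emb" for w
      proof (cases "w = v")
        case True
        then show ?thesis using pw_mono[OF v', of "A w - D w"] upd(3) by simp
      next
        case False
        then show ?thesis using x that by (auto dest!: bspec[of _ _ w])
      qed
      then show "x \<in> {x \<in> ?G A. h v x \<in> pw v (- D v + int m)}" using x v' by (simp add: add.commute)
    qed
    have "card (?G A) \<le> card (cosets (pw v (- D v)) (pw v (- D v + int m))) * card {x \<in> ?G A. h v x \<in> pw v (- D v + int m)}"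
    proof (rule card_le_cosets_kernel(2)[OF pw_subgroup[OF upd(2)] sub])
      show "h v ` ?G A \<subseteq> pw v (- D v)" using h(2)[OF upd(2)] by blast
      show "finite (cosets (pw v (- D v)) (pw v (- D v + int m)))" by (rule cosets_pw[OF upd(2)])
      show "finite {x \<in> ?G A. h v x \<in> pw v (- D v + int m)}" using G(2) by simp
    qed (rule h(1)[OF upd(2)])
    then have "card (?G A) \<le> q ^ (m * pdeg v) * card (?G ?A')"
      unfolding eq cosets_pw(2)[OF upd(2)] .
    then have "q ^ nat (deg A) * card (?G A) \<le> q ^ nat (deg A) * (q ^ (m * pdeg v) * card (?G ?A'))"
      by (rule mult_le_mono2)
    also have "\<dots> = q ^ (nat (deg A) + m * pdeg v) * card (?G ?A')" by (simp only: power_add mult.assoc)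
    also have "nat (deg A) + m * pdeg v = nat (deg ?A')"
    proof -
      have "deg ?A' = deg A + int (m * pdeg v)" using deg_upd[OF EffD(1)[OF upd(1)] upd(2)] upd(3) by simp
      then show ?thesis using deg_Eff[OF upd(1)] by linarith
    qed
    finally show ?case using upd(4) by (rule order_trans[rotated])
  qed
qed

section \<open>Pairs of effective divisors as divisors of the constant extension\<close>

lemma Div_single: "w \<in> places emb \<Longrightarrow> (\<lambda>_. 0)(w := k) \<in> Div"
  by (rule Div_upd[OF Div_0])

lemma deg_single: "w \<in> places emb \<Longrightarrow> deg ((\<lambda>_. 0)(w := k)) = int (pdeg w) * k"
  using deg_upd[OF Div_0] by simp

lemma Eff_single: "w \<in> places emb \<Longrightarrow> 0 \<le> k \<Longrightarrow> (\<lambda>_. 0)(w := k) \<in> Eff"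
  by (rule EffI[OF Div_single]) simp_all

text \<open>The Riemann-Roch space of \<open>D\<close> over the constant extension, its elements
  written as polynomials in \<open>\<beta>\<close> of degree less than \<open>l\<close>.\<close>

definition bounded_polys :: "nat \<Rightarrow> 'k divisor \<Rightarrow> 'k poly set" where
  "bounded_polys l D = {f. \<forall>i. coeff f i \<in> L D \<and> (l \<le> i \<longrightarrow> coeff f i = 0)}"

lemma bounded_polys_subgroup: "add_subgroup (bounded_polys l D)"
  unfolding add_subgroup_def bounded_polys_def using add_subgroupD(2)[OF L_subgroup] by simp

lemma card_bounded_polys:
  assumes D: "D \<in> Div"
  shows "finite (bounded_polys l D)" and "card (bounded_polys l D) = q ^ (l * ldim D)"
proof -
  let ?T = "{..<l} \<rightarrow>\<^sub>E L D"
  have c: "coeff (\<Sum>i<l. monom (c i) i) j = (if j < l then c j else 0)" for c and j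
    by (simp add: coeff_sum)
  have "bij_betw (\<lambda>f. restrict (coeff f) {..<l}) (bounded_polys l D) ?T"
  proof (rule bij_betw_byWitness[where f' = "\<lambda>c. \<Sum>i<l. monom (c i) i"])
    show "\<forall>f\<in>bounded_polys l D. (\<Sum>i<l. monom (restrict (coeff f) {..<l} i) i) = f"
      unfolding poly_eq_iff c by (auto simp: bounded_polys_def)
    show "\<forall>c\<in>?T. restrict (coeff (\<Sum>i<l. monom (c i) i)) {..<l} = c"
    proof
      fix c assume "c \<in> ?T"
      then show "restrict (coeff (\<Sum>i<l. monom (c i) i)) {..<l} = c"
        unfolding fun_eq_iff restrict_def c using PiE_arb[of c "{..<l}" "\<lambda>_. L D"] by simp
    qed
    show "(\<lambda>f. restrict (coeff f) {..<l}) ` bounded_polys l D \<subseteq> ?T"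
      by (rule image_subsetI) (simp add: bounded_polys_def restrict_PiE_iff)
    show "(\<lambda>c. \<Sum>i<l. monom (c i) i) ` ?T \<subseteq> bounded_polys l D"
    proof (rule image_subsetI)
      fix c assume "c \<in> ?T"
      then have "c i \<in> L D" if "i < l" for i using PiE_mem[of c "{..<l}" "\<lambda>_. L D" i] that by simp
      then show "(\<Sum>i<l. monom (c i) i) \<in> bounded_polys l D"
        unfolding bounded_polys_def mem_Collect_eq c by simp
    qed
  qed
  moreover have "finite ?T" by (intro finite_PiE finite_L[OF D]) auto
  moreover have "card ?T = q ^ (l * ldim D)"
    by (simp add: card_PiE card_L[OF D] power_mult mult.commute[of l])
  ultimately show "finite (bounded_polys l D)" "card (bounded_polys l D) = q ^ (l * ldim D)"
    using bij_betw_finite[of _ "bounded_polys l D" ?T] bij_betw_same_card[of _ "bounded_polys l D" ?T] by auto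
qed

text \<open>If \<open>l\<close> divides all degrees, then every place splits completely in the constant extension of
  degree \<open>l\<close>, whose functions are the polynomials of degree less than \<open>l\<close> in a generator.  Evaluating
  such a polynomial at approximate roots of the minimal polynomial gives its values at the places
  above \<open>v\<close>, so a pair of divisors becomes one divisor of the extension, and the number of the latter
  is bounded as in \<open>num_Eff_le\<close>.\<close>

lemma card_Eff_pairs_le:
  assumes l: "prime l" and dvd: "\<And>v. v \<in> places emb \<Longrightarrow> l dvd pdeg v"
  shows "\<exists>C. \<forall>N. finite {(A, B). A \<in> Eff \<and> B \<in> Eff \<and> deg A + deg B = int N} \<and>
    card {(A, B). A \<in> Eff \<and> B \<in> Eff \<and> deg A + deg B = int N} \<le> C * q ^ N"
proof -
  have l1: "1 < l" using l by (rule prime_gt_1_nat)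
  obtain \<beta> where \<beta>: "generic l \<beta>" using exists_generic[OF l1] by blast
  obtain P :: "'f poly" where P: "degree P = l" "\<And>k. evc (\<beta> ^ (q ^ k)) (map_poly emb P) = 0"
    using exists_generic_poly[OF l \<beta>] by blast
  have "\<forall>f. \<exists>N S. f \<noteq> 0 \<and> degree f < l \<longrightarrow>
      N \<noteq> 0 \<and> (\<forall>a. (\<Prod>k<l. poly f (a ^ (q ^ k))) = poly S a * ev a P + N)"
    using exists_norm[OF l \<beta> P] by blast
  then obtain Nm S where Nm: "\<And>f. f \<noteq> 0 \<Longrightarrow> degree f < l \<Longrightarrow> Nm f \<noteq> 0"
    "\<And>f a. f \<noteq> 0 \<Longrightarrow> degree f < l \<Longrightarrow> (\<Prod>k<l. poly f (a ^ (q ^ k))) = poly (S f) a * ev a P + Nm f"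
    by metis
  obtain w where w: "w \<in> places emb" using exists_place by blast
  define d0 where "d0 = pdeg w"
  have d0: "0 < d0" using place_degree_pos[OF w] by (simp add: d0_def)
  define G where "G = nat \<bar>g\<bar>"
  \<comment> \<open>Slack independent of \<open>N\<close>: \<open>l * G\<close> absorbs the genus,
    \<open>l * d0\<close> the rounding to a multiple of \<open>l * d0\<close>.\<close>
  define c where "c = l * G + l * d0"
  define Rs where "Rs = (\<Union>d\<le>c. Eff_of_deg d)"
  have finRs: "finite Rs" unfolding Rs_def using finite_Eff_of_deg by blast
  define T where "T N = {(A, B). A \<in> Eff \<and> B \<in> Eff \<and> deg A + deg B = int N}" for N
  have "finite (T N) \<and> card (T N) \<le> (q ^ (c + l) * (card Rs * card Rs)) * q ^ N" for N
  proof -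
    \<comment> \<open>The multiple \<open>D\<close> of the place \<open>w\<close> has degree just
      above \<open>N / l + G\<close>, so that \<open>l * ldim D\<close> exceeds \<open>N\<close>, by
      at most \<open>c + l\<close>.\<close>
    define j where "j = (N + l * G) div (l * d0) + 1"
    have j: "N + l * G < l * d0 * j" "l * d0 * j \<le> N + c"
    proof -
      have pos: "0 < l * d0" using l1 d0 by simp
      have "N + l * G = l * d0 * ((N + l * G) div (l * d0)) + (N + l * G) mod (l * d0)" by simp
      moreover have "(N + l * G) mod (l * d0) < l * d0" using pos by simp
      moreover have "l * d0 * j = l * d0 * ((N + l * G) div (l * d0)) + l * d0" by (simp add: j_def)
      ultimately show "N + l * G < l * d0 * j" "l * d0 * j \<le> N + c" unfolding c_def by linarith+
    qed
    define D where "D = (\<lambda>_. 0)(w := int j)"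
    have D: "D \<in> Eff" "D \<in> Div" "deg D = int (d0 * j)"
      unfolding D_def d0_def using Eff_single[OF w, of "int j"] Div_single[OF w] deg_single[OF w, of "int j"] by simp_all
    have ld: "N < l * ldim D" "l * ldim D \<le> N + c + l"
    proof -
      have gG: "g \<le> int G" by (simp add: G_def)
      have "int (d0 * j) + 1 - int G \<le> int (ldim D)" using riemann_inequality[OF D(2)] D(3) gG by linarith
      then have "int l * (int (d0 * j) - int G) \<le> int l * int (ldim D)" by (intro mult_left_mono) auto
      then have "int (l * d0 * j) - int (l * G) \<le> int (l * ldim D)" by (simp add: right_diff_distrib)
      then show "N < l * ldim D" using j(1) by linarith
      have "int (ldim D) \<le> int (d0 * j) + 1" using ldim_le[OF D(2)] D(3) by simp
      then have "ldim D \<le> d0 * j + 1" by linarith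
      then have "l * ldim D \<le> l * (d0 * j + 1)" by (rule mult_le_mono2)
      then show "l * ldim D \<le> N + c + l" using j(2) by (simp add: algebra_simps)
    qed
    define V where "V = bounded_polys l D"
    have V: "finite V" "card V = q ^ (l * ldim D)" "add_subgroup V"
      unfolding V_def by (rule card_bounded_polys[OF D(2)] bounded_polys_subgroup)+
    have Vdeg: "degree f < l" if "f \<in> V" "f \<noteq> 0" for f
    proof (rule ccontr)
      assume "\<not> degree f < l"
      then have "lead_coeff f = 0" using that(1) by (simp add: V_def bounded_polys_def)
      then show False using that(2) by simp
    qed
    have "\<forall>v\<in>places emb. \<exists>a. a \<in> pw v 0 \<and> (\<forall>f\<in>V. poly (S f) a * ev a P \<in> pw v (v (Nm f) + 1))"
      using exists_approximate_root[OF _ l dvd \<beta> P V(1), of _ S Nm] by blast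
    then obtain a where a: "\<And>v. v \<in> places emb \<Longrightarrow> a v \<in> pw v 0"
      "\<And>v f. v \<in> places emb \<Longrightarrow> f \<in> V \<Longrightarrow> poly (S f) (a v) * ev (a v) P \<in> pw v (v (Nm f) + 1)"
      by metis
    \<comment> \<open>The substitute for the value of \<open>f\<close> at the \<open>k\<close>-th
      place above \<open>v\<close>; the conjugate roots are Frobenius powers of
      \<open>a v\<close>.\<close>
    define u where "u k v f = poly f (a v ^ (q ^ k))" for k v f
    have uD: "u k v f \<in> pw v (- D v)" if v: "v \<in> places emb" and f: "f \<in> V" for k v f
    proof -
      have "coeff f i \<in> pw v (- D v)" for i
        using f v unfolding V_def bounded_polys_def L_pw by (metis (mono_tags, lifting) mem_Collect_eq pw_0)
      moreover have "a v ^ (q ^ k) \<in> pw v 0" using pw_power[OF v a(1)[OF v], of "q ^ k"] by simp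
      ultimately show ?thesis unfolding u_def by (rule pw_poly[OF v])
    qed
    \<comment> \<open>The term with \<open>ev (a v) P\<close> has larger valuation than the norm, so
      the product of the values has exactly the valuation of \<open>Nm f\<close>. In particular no
      value is zero.\<close>
    have unz: "u k v f \<noteq> 0" and usum: "(\<Sum>k<l. v (u k v f)) = v (Nm f)"
      if v: "v \<in> places emb" and f: "f \<in> V" "f \<noteq> 0" and k: "k < l" for k v f
    proof -
      note N' = Nm(1)[OF f(2) Vdeg[OF f]]
      have "(\<Prod>k<l. u k v f) = Nm f + poly (S f) (a v) * ev (a v) P"
        unfolding u_def using Nm(2)[OF f(2) Vdeg[OF f], of "a v"] by (simp add: add.commute)
      then have p: "(\<Prod>k<l. u k v f) \<noteq> 0" "v (\<Prod>k<l. u k v f) = v (Nm f)"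
        using place_add_eq[OF v N' a(2)[OF v f(1)]] by simp_all
      then have nz: "u k v f \<noteq> 0" if "k < l" for k using that by auto
      then show "u k v f \<noteq> 0" using k by blast
      show "(\<Sum>k<l. v (u k v f)) = v (Nm f)" using place_prod[OF v, of "{..<l}" "\<lambda>k. u k v f"] nz p(2) by simp
    qed
    \<comment> \<open>The part of the divisor of \<open>f\<close> plus \<open>D\<close> on the
      \<open>k\<close>-th sheet; summed over the sheets it is
      \<open>pdiv (Nm f) + l * D\<close>.\<close>
    define E where "E k f v = (if v \<in> places emb then v (u k v f) + D v else 0)" for k f v
    have E0: "0 \<le> E k f v" if "f \<in> V" "f \<noteq> 0" "k < l" for k f v
    proof (cases "v \<in> places emb")
      case True
      then have "- D v \<le> v (u k v f)" using uD[of v f k] unz[of v f k] that by (simp add: pw_iff)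
      then show ?thesis by (simp add: E_def)
    qed (simp add: E_def)
    have Dout: "D v = 0" if "v \<notin> places emb" for v using DivD(2)[OF D(2), of v] that by blast
    have Esum: "(\<Sum>k<l. E k f v) = pdiv (Nm f) v + int l * D v" if "f \<in> V" "f \<noteq> 0" for f v
      using usum[of v f 0] that l1 Dout[of v]
      by (simp add: E_def principal_divisor_def sum.distrib)
    have NmD: "(\<lambda>v. pdiv (Nm f) v + int l * D v) \<in> Div"
      and Nmdeg: "deg (\<lambda>v. pdiv (Nm f) v + int l * D v) = int (l * d0 * j)" if f: "f \<in> V" "f \<noteq> 0" for f
    proof -
      note N' = Nm(1)[OF f(2) Vdeg[OF f]]
      show "(\<lambda>v. pdiv (Nm f) v + int l * D v) \<in> Div" by (rule Div_add[OF pdiv_Div[OF N'] Div_scale[OF D(2)]])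
      show "deg (\<lambda>v. pdiv (Nm f) v + int l * D v) = int (l * d0 * j)"
        using deg_add[OF pdiv_Div[OF N'] Div_scale[OF D(2)], of "int l"] deg_pdiv[OF N'] deg_scale[OF D(2)] D(3) by simp
    qed
    have E_Eff: "E k f \<in> Eff" if f: "f \<in> V" "f \<noteq> 0" and k: "k < l" for k f
    proof (rule EffI[OF _ E0[OF f k]])
      \<comment> \<open>All sheets are nonnegative, so each is supported where their sum is, which
        is a divisor.\<close>
      have s: "{v. E k f v \<noteq> 0} \<subseteq> {v. pdiv (Nm f) v + int l * D v \<noteq> 0}"
      proof clarify
        fix v assume "E k f v \<noteq> 0" "pdiv (Nm f) v + int l * D v = 0"
        then have "(\<Sum>k<l. E k f v) = 0" using Esum[OF f] by simp
        then have "E k f v = 0" using sum_nonneg_eq_0_iff[of "{..<l}" "\<lambda>k. E k f v"] E0[OF f] k by auto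
        then show False using \<open>E k f v \<noteq> 0\<close> by simp
      qed
      have "finite {v. E k f v \<noteq> 0}" by (rule finite_subset[OF s DivD(1)[OF NmD[OF f]]])
      then show "E k f \<in> Div" by (auto simp: divisors_def E_def split: if_splits)
    qed
    have Edeg: "deg (E 0 f) + deg (E 1 f) \<le> int (N + c)" if f: "f \<in> V" "f \<noteq> 0" for f
    proof -
      have e: "E 0 f \<in> Div" "E 1 f \<in> Div" using E_Eff[OF f] l1 EffD(1) by auto
      have "E 0 f v + E 1 f v \<le> pdiv (Nm f) v + int l * D v" for v
      proof -
        have "(\<Sum>k\<in>{0, 1}. E k f v) \<le> (\<Sum>k<l. E k f v)"
          using l1 E0[OF f] by (intro sum_mono2) auto
        then show ?thesis using Esum[OF f] by simp
      qed
      then have "deg (\<lambda>v. E 0 f v + E 1 f v) \<le> int (l * d0 * j)"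
        using deg_mono[OF Div_add[OF e] NmD[OF f]] Nmdeg[OF f] by simp
      then show ?thesis using deg_add[OF e] j(2) by linarith
    qed
    \<comment> \<open>A pair is recovered from some \<open>f\<close> and two remainders of degree at
      most \<open>c\<close>, which range over a finite set \<open>Rs\<close> independent of
      \<open>N\<close>.\<close>
    have "T N \<subseteq> (\<lambda>(f, R1, R2). (\<lambda>v. E 0 f v - R1 v, \<lambda>v. E 1 f v - R2 v)) ` (V \<times> Rs \<times> Rs)"
    proof
      fix AB assume "AB \<in> T N"
      then obtain A B where AB: "AB = (A, B)" "A \<in> Eff" "B \<in> Eff" "deg A + deg B = int N"
        unfolding T_def by blast
      \<comment> \<open>Zeros of order \<open>A\<close> on sheet 0 and of order \<open>B\<close> on
        sheet 1 impose at most \<open>N\<close> conditions on a space of dimension greater than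
        \<open>N\<close>, so a nonzero \<open>f\<close> remains.\<close>
      define G1 where "G1 = {f \<in> V. \<forall>v\<in>places emb. u 0 v f \<in> pw v (A v - D v)}"
      define G2 where "G2 = {f \<in> G1. \<forall>v\<in>places emb. u 1 v f \<in> pw v (B v - D v)}"
      have ud: "u k v (x - y) = u k v x - u k v y" for k v x y by (simp add: u_def)
      have G1: "add_subgroup G1" "card V \<le> q ^ nat (deg A) * card G1"
        unfolding G1_def
        by (rule card_le_linear_conditions[where h = "u 0" and D = D, OF V(3,1) _ _ AB(2)]; use ud uD in simp)+
      have finG1: "finite G1" "G1 \<subseteq> V" using V(1) by (auto simp: G1_def)
      have G2: "card G1 \<le> q ^ nat (deg B) * card G2"
        unfolding G2_def
        by (rule card_le_linear_conditions(2)[where h = "u 1" and D = D, OF G1(1) finG1(1) _ _ AB(3)]; use ud uD finG1(2) in blast)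
      have "card V \<le> q ^ nat (deg A) * (q ^ nat (deg B) * card G2)"
        using G1(2) mult_le_mono2[OF G2] by (rule order_trans)
      also have "\<dots> = q ^ N * card G2"
      proof -
        have "nat (deg A) + nat (deg B) = N" using AB(4) deg_Eff[OF AB(2)] deg_Eff[OF AB(3)] by linarith
        then show ?thesis by (metis power_add mult.assoc)
      qed
      finally have cV: "q ^ (l * ldim D) \<le> q ^ N * card G2" unfolding V(2) .
      have "\<exists>f\<in>G2. f \<noteq> 0"
      proof (rule ccontr)
        assume "\<not> ?thesis"
        then have "card G2 \<le> card {0 :: 'k poly}" by (intro card_mono) auto
        then have "q ^ N * card G2 \<le> q ^ N * 1" by (intro mult_le_mono2) simp
        with cV have "q ^ (l * ldim D) \<le> q ^ N * 1" by (rule order_trans)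
        then have "q ^ (l * ldim D) \<le> q ^ N" by (simp only: mult_1_right)
        then show False using ld(1) unfolding q_power_le_iff by simp
      qed
      then obtain f where f: "f \<in> G2" "f \<noteq> 0" by blast
      then have fV: "f \<in> V" using finG1(2) by (auto simp: G2_def)
      note e = E_Eff[OF fV f(2)]
      have l01: "0 < l" "1 < l" using l1 by simp_all
      have A_le: "A v \<le> E 0 f v" for v
      proof (cases "v \<in> places emb")
        case True
        then have "u 0 v f \<in> pw v (A v - D v)" using f(1) by (simp add: G2_def G1_def)
        then show ?thesis using unz[OF True fV f(2) l01(1)] True by (simp add: pw_iff E_def)
      next
        case False
        then have "A v = 0" using DivD(2)[OF EffD(1)[OF AB(2)], of v] by blast
        then show ?thesis using False by (simp add: E_def)
      qed
      have B_le: "B v \<le> E 1 f v" for v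
      proof (cases "v \<in> places emb")
        case True
        then have "u 1 v f \<in> pw v (B v - D v)" using f(1) by (simp add: G2_def)
        then show ?thesis using unz[OF True fV f(2) l01(2)] True by (simp add: pw_iff E_def)
      next
        case False
        then have "B v = 0" using DivD(2)[OF EffD(1)[OF AB(3)], of v] by blast
        then show ?thesis using False by (simp add: E_def)
      qed
      define R1 where "R1 v = E 0 f v - A v" for v
      define R2 where "R2 v = E 1 f v - B v" for v
      have eD: "E 0 f \<in> Div" "E 1 f \<in> Div" using e l01 EffD(1) by blast+
      have R1: "R1 \<in> Eff" "deg R1 = deg (E 0 f) - deg A"
        unfolding R1_def using A_le Div_diff[OF eD(1) EffD(1)[OF AB(2)]] deg_diff[OF eD(1) EffD(1)[OF AB(2)]]
        by (auto intro: EffI)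
      have R2: "R2 \<in> Eff" "deg R2 = deg (E 1 f) - deg B"
        unfolding R2_def using B_le Div_diff[OF eD(2) EffD(1)[OF AB(3)]] deg_diff[OF eD(2) EffD(1)[OF AB(3)]]
        by (auto intro: EffI)
      have "deg R1 + deg R2 \<le> int c" using R1(2) R2(2) Edeg[OF fV f(2)] AB(4) by simp
      then have "nat (deg R1) \<le> c" "nat (deg R2) \<le> c" using deg_Eff[OF R1(1)] deg_Eff[OF R2(1)] by linarith+
      moreover have "R \<in> Rs" if "R \<in> Eff" "nat (deg R) \<le> c" for R
        unfolding Rs_def Eff_of_deg_def using that deg_Eff[OF that(1)] by (intro UN_I[of "nat (deg R)"]) auto
      ultimately have "R1 \<in> Rs" "R2 \<in> Rs" using R1(1) R2(1) by blast+
      moreover have "AB = (\<lambda>v. E 0 f v - R1 v, \<lambda>v. E 1 f v - R2 v)" unfolding AB(1) by (simp add: R1_def R2_def)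
      ultimately show "AB \<in> (\<lambda>(f, R1, R2). (\<lambda>v. E 0 f v - R1 v, \<lambda>v. E 1 f v - R2 v)) ` (V \<times> Rs \<times> Rs)"
        using fV by (intro image_eqI[of _ _ "(f, R1, R2)"]) auto
    qed
    moreover have fin: "finite (V \<times> Rs \<times> Rs)" using V(1) finRs by simp
    ultimately have c1: "finite (T N)" "card (T N) \<le> card (V \<times> Rs \<times> Rs)"
      using finite_surj surj_card_le by blast+
    have c2: "card (V \<times> Rs \<times> Rs) = q ^ (l * ldim D) * (card Rs * card Rs)"
      by (simp add: card_cartesian_product V(2))
    have c3: "q ^ (l * ldim D) * (card Rs * card Rs) \<le> q ^ (N + c + l) * (card Rs * card Rs)"
      using ld(2) unfolding q_power_le_iff[symmetric, of "l * ldim D"] by (rule mult_le_mono1)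
    have "q ^ (N + c + l) * (card Rs * card Rs) = (q ^ (c + l) * (card Rs * card Rs)) * q ^ N"
      by (simp add: power_add mult_ac)
    then have "card (T N) \<le> (q ^ (c + l) * (card Rs * card Rs)) * q ^ N" using c1(2) c2 c3 by linarith
    then show ?thesis using c1(1) by blast
  qed
  then show ?thesis unfolding T_def by blast
qed

text \<open>By Riemann's inequality there are at least \<open>q ^ (i * d0) / q ^ G\<close> effective
  divisors of degree \<open>i * d0\<close>. Each of \<open>m + 1\<close> splittings of
  \<open>N\<close> then gives at least \<open>q ^ N / q ^ (2 * G)\<close> pairs, more than
  \<open>C * q ^ N\<close> in total for large \<open>m\<close>.\<close>

lemma not_all_degrees_divisible:
  assumes l: "prime l" shows "\<exists>v\<in>places emb. \<not> l dvd pdeg v"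
proof (rule ccontr)
  assume "\<not> ?thesis"
  then have "l dvd pdeg v" if "v \<in> places emb" for v using that by blast
  from card_Eff_pairs_le[OF l this] obtain C where
    C: "\<And>N. finite {(A, B). A \<in> Eff \<and> B \<in> Eff \<and> deg A + deg B = int N}"
       "\<And>N. card {(A, B). A \<in> Eff \<and> B \<in> Eff \<and> deg A + deg B = int N} \<le> C * q ^ N" by blast
  obtain w where w: "w \<in> places emb" using exists_place by blast
  define d0 where "d0 = pdeg w"
  have d0: "0 < d0" using place_degree_pos[OF w] by (simp add: d0_def)
  define G where "G = nat \<bar>g\<bar>"
  have lower: "q ^ (i * d0) \<le> q ^ G * num_Eff (i * d0)" if "G \<le> i" for i
  proof -
    let ?M = "(\<lambda>_. 0)(w := int i)"
    have M: "?M \<in> Div" "deg ?M = int (i * d0)" using Div_single[OF w] deg_single[OF w] by (simp_all add: d0_def)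
    have gG: "g \<le> int G" by (simp add: G_def)
    have "i * 1 \<le> i * d0" using d0 by (intro mult_le_mono2) simp
    then have "int G \<le> int (i * d0)" using \<open>G \<le> i\<close> by linarith
    moreover have "int (i * d0) + 1 - g \<le> int (ldim ?M)" using riemann_inequality[OF M(1)] M(2) by simp
    ultimately have ld: "0 < ldim ?M" "i * d0 + 1 \<le> G + ldim ?M" using gG by linarith+
    have "q * q ^ (i * d0) \<le> q ^ (G + ldim ?M)"
      using ld(2) unfolding q_power_le_iff[symmetric, of "i * d0 + 1"] by simp
    also have "\<dots> \<le> q ^ G * (q * num_Eff (i * d0))"
      unfolding power_add using num_Eff_ge[OF M ld(1)] by (rule mult_le_mono2)
    finally have "q * q ^ (i * d0) \<le> q * (q ^ G * num_Eff (i * d0))" by (simp add: mult_ac)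
    then show ?thesis using q_ge_2 by simp
  qed
  have "m + 1 \<le> q ^ (2 * G) * C" for m
  proof -
    \<comment> \<open>Leaves room for \<open>m + 1\<close> splittings in which both factors of
      \<open>d0\<close> are at least \<open>G\<close>, as \<open>lower\<close> demands.\<close>
    define N where "N = (2 * G + m) * d0"
    let ?P = "\<lambda>i. Eff_of_deg (i * d0) \<times> Eff_of_deg ((2 * G + m - i) * d0)"
    let ?I = "{G..G + m}"
    have sub: "(\<Union>i\<in>?I. ?P i) \<subseteq> {(A, B). A \<in> Eff \<and> B \<in> Eff \<and> deg A + deg B = int N}"
    proof clarify
      fix i A B assume i: "i \<in> ?I" and A: "A \<in> Eff_of_deg (i * d0)" and B: "B \<in> Eff_of_deg ((2 * G + m - i) * d0)"
      have "i * d0 + (2 * G + m - i) * d0 = N" using i unfolding N_def add_mult_distrib[symmetric] by simp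
      then have "int (i * d0) + int ((2 * G + m - i) * d0) = int N" by linarith
      then show "A \<in> Eff \<and> B \<in> Eff \<and> deg A + deg B = int N" using A B by (simp add: Eff_of_deg_def)
    qed
    have "card (\<Union>i\<in>?I. ?P i) = (\<Sum>i\<in>?I. card (?P i))"
    proof (rule card_UN_disjoint)
      show "\<forall>i\<in>?I. finite (?P i)" using finite_Eff_of_deg by blast
      show "\<forall>i\<in>?I. \<forall>j\<in>?I. i \<noteq> j \<longrightarrow> ?P i \<inter> ?P j = {}"
      proof (intro ballI impI)
        fix i j :: nat assume "i \<noteq> j"
        then have "i * d0 \<noteq> j * d0" using d0 by simp
        then show "?P i \<inter> ?P j = {}" by (auto simp: Eff_of_deg_def simp del: of_nat_mult)
      qed
    qed simp
    then have up: "(\<Sum>i\<in>?I. card (?P i)) \<le> C * q ^ N"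
      using card_mono[OF C(1) sub] C(2)[of N] by simp
    have "q ^ N \<le> q ^ (2 * G) * card (?P i)" if i: "i \<in> ?I" for i
    proof -
      have "q ^ (i * d0) * q ^ ((2 * G + m - i) * d0) \<le> (q ^ G * num_Eff (i * d0)) * (q ^ G * num_Eff ((2 * G + m - i) * d0))"
        using i by (intro mult_le_mono lower) auto
      moreover have "q ^ (i * d0) * q ^ ((2 * G + m - i) * d0) = q ^ N"
        using i unfolding N_def power_add[symmetric] add_mult_distrib[symmetric] by simp
      moreover have "q ^ (2 * G) = q ^ G * q ^ G" by (simp add: mult_2 power_add)
      ultimately show ?thesis by (simp add: card_cartesian_product mult_ac)
    qed
    then have "(\<Sum>i\<in>?I. q ^ N) \<le> (\<Sum>i\<in>?I. q ^ (2 * G) * card (?P i))" by (rule sum_mono)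
    then have "(m + 1) * q ^ N \<le> q ^ (2 * G) * (\<Sum>i\<in>?I. card (?P i))" by (simp add: sum_distrib_left)
    also have "\<dots> \<le> q ^ (2 * G) * (C * q ^ N)" using up by (rule mult_le_mono2)
    finally have "(m + 1) * q ^ N \<le> (q ^ (2 * G) * C) * q ^ N" by (simp add: mult.assoc)
    then show ?thesis using q_ge_2 unfolding mult_le_cancel2 by simp
  qed
  from this[of "q ^ (2 * G) * C"] show False by simp
qed

text \<open>The least positive degree \<open>\<delta>\<close> divides all degrees of places, since
  remainders modulo \<open>\<delta>\<close> are again degrees of divisors; a prime factor of
  \<open>\<delta>\<close> would contradict \<open>not_all_degrees_divisible\<close>.\<close>

theorem exists_degree_one: "\<exists>D\<in>Div. deg D = 1"
proof -
  obtain w where w: "w \<in> places emb" using exists_place by blast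
  let ?Q = "\<lambda>n :: nat. 0 < n \<and> (\<exists>D\<in>Div. deg D = int n)"
  define \<delta> where "\<delta> = (LEAST n. ?Q n)"
  have "?Q (pdeg w)"
    using place_degree_pos[OF w] Div_single[OF w, of 1] deg_single[OF w, of 1] by (auto intro!: bexI[of _ "(\<lambda>_. 0)(w := 1)"])
  then have \<delta>: "?Q \<delta>" unfolding \<delta>_def by (rule LeastI)
  then obtain D where D: "D \<in> Div" "deg D = int \<delta>" by blast
  have dvd: "\<delta> dvd pdeg v" if v: "v \<in> places emb" for v
  proof (rule ccontr)
    assume nd: "\<not> \<delta> dvd pdeg v"
    let ?k = "pdeg v div \<delta>"
    let ?E = "\<lambda>x. ((\<lambda>_. 0)(v := 1)) x - int ?k * D x"
    have "?E \<in> Div" by (rule Div_diff[OF Div_single[OF v] Div_scale[OF D(1)]])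
    moreover have "deg ?E = int (pdeg v mod \<delta>)"
    proof -
      have "deg ?E = int (pdeg v) * 1 - int ?k * int \<delta>"
        unfolding deg_diff[OF Div_single[OF v] Div_scale[OF D(1)]] deg_single[OF v] deg_scale[OF D(1)] D(2) ..
      moreover have "int (pdeg v) = int (?k * \<delta> + pdeg v mod \<delta>)" by simp
      ultimately show ?thesis unfolding of_nat_add of_nat_mult by linarith
    qed
    ultimately have "?Q (pdeg v mod \<delta>)" using nd by (auto simp: dvd_eq_mod_eq_0)
    then have "\<delta> \<le> pdeg v mod \<delta>" unfolding \<delta>_def by (rule Least_le)
    then show False using \<delta> mod_less_divisor[of \<delta> "pdeg v"] by linarith
  qed
  have "\<delta> = 1"
  proof (rule ccontr)
    assume "\<delta> \<noteq> 1"
    then obtain l where l: "prime l" "l dvd \<delta>" using prime_factor_nat by blast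
    then show False using not_all_degrees_divisible[OF l(1)] dvd dvd_trans[OF l(2)] by blast
  qed
  then show ?thesis using D by auto
qed

end

section \<open>Points and divisors\<close>

lemma sum_alternating_Pow:
  assumes "finite U"
  shows "(\<Sum>S\<in>Pow U. (- 1) ^ card S) = (if U = {} then 1 else (0 :: 'a::comm_ring_1))"
  using assms
proof (induction U rule: finite_induct)
  case (insert a U)
  have fin: "finite S" if "S \<in> Pow U" for S using that insert(1) finite_subset by blast
  have "(\<Sum>S\<in>Pow (insert a U). (- 1) ^ card S) = (\<Sum>S\<in>Pow U. (- 1) ^ card S) + (\<Sum>S\<in>insert a ` Pow U. (- 1 :: 'a) ^ card S)"
    unfolding Pow_insert using insert by (intro sum.union_disjoint) auto
  also have "(\<Sum>S\<in>insert a ` Pow U. (- 1 :: 'a) ^ card S) = (\<Sum>S\<in>Pow U. (- 1) ^ card (insert a S))"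
    using insert(2) by (intro sum.reindex_cong[of "insert a"]) (auto simp: inj_on_def)
  also have "\<dots> = (\<Sum>S\<in>Pow U. - ((- 1) ^ card S))"
  proof (rule sum.cong[OF refl])
    fix S assume S: "S \<in> Pow U"
    then have "a \<notin> S" using insert(2) by blast
    then show "(- 1 :: 'a) ^ card (insert a S) = - ((- 1) ^ card S)" using fin[OF S] by simp
  qed
  finally show ?case by (simp add: sum_negf)
qed simp

context function_field
begin

abbreviation cv :: "nat \<Rightarrow> (nat \<Rightarrow> 'k) set" where "cv \<equiv> coordinate_vectors"

text \<open>The divisor \<open>- inf (div (x i))\<close>, whose degree is the height of the point with coordinates \<open>x\<close>.\<close>

definition hdiv :: "nat \<Rightarrow> (nat \<Rightarrow> 'k) \<Rightarrow> 'k divisor" where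
  "hdiv n x v = (if v \<in> places emb then - min_valuation n v x else 0)"

lemma min_valuation_set: "{v (x i) | i. i \<le> n \<and> x i \<noteq> 0} = (\<lambda>i. v (x i)) ` {i. i \<le> n \<and> x i \<noteq> 0}"
  by blast

lemma le_min_valuation_iff:
  assumes "x \<in> cv n"
  shows "k \<le> min_valuation n v x \<longleftrightarrow> (\<forall>i\<le>n. x i \<in> pw v k)"
proof -
  have "finite {i. i \<le> n \<and> x i \<noteq> 0}" "{i. i \<le> n \<and> x i \<noteq> 0} \<noteq> {}"
    using assms by (auto simp: coordinate_vectors_def)
  then show ?thesis
    unfolding min_valuation_def min_valuation_set by (subst Min_ge_iff) (auto simp: pw_def)
qed

lemma hdiv_Div:
  assumes x: "x \<in> cv n" shows "hdiv n x \<in> Div"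
proof -
  let ?I = "{i. i \<le> n \<and> x i \<noteq> 0}"
  have I: "finite ?I" "?I \<noteq> {}" using x by (auto simp: coordinate_vectors_def)
  have s: "{v. hdiv n x v \<noteq> 0} \<subseteq> (\<Union>i\<in>?I. {v \<in> places emb. v (x i) \<noteq> 0})"
  proof
    fix v assume "v \<in> {v. hdiv n x v \<noteq> 0}"
    then have v: "v \<in> places emb" "min_valuation n v x \<noteq> 0" by (auto simp: hdiv_def split: if_splits)
    have "min_valuation n v x \<in> (\<lambda>i. v (x i)) ` ?I"
      unfolding min_valuation_def min_valuation_set using I by (intro Min_in) auto
    then show "v \<in> (\<Union>i\<in>?I. {v \<in> places emb. v (x i) \<noteq> 0})" using v by auto
  qed
  have "finite (\<Union>i\<in>?I. {v \<in> places emb. v (x i) \<noteq> 0})"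
    using I(1) finite_places_nonzero by (intro finite_UN_I) auto
  then have "finite {v. hdiv n x v \<noteq> 0}" by (rule finite_subset[OF s])
  then show ?thesis by (auto simp: divisors_def hdiv_def split: if_splits)
qed

lemma vector_height_eq: "vector_height emb n x = deg (hdiv n x)"
proof -
  have "{v. hdiv n x v \<noteq> 0} = {v. v \<in> places emb \<and> min_valuation n v x \<noteq> 0}" by (auto simp: hdiv_def)
  then show ?thesis
    unfolding vector_height_def divisor_degree_def by (simp add: sum_negf[symmetric] hdiv_def cong: sum.cong_simp)
qed

lemma hdiv_le_iff:
  assumes x: "x \<in> cv n" and D: "D \<in> Div"
  shows "(\<forall>v. hdiv n x v \<le> D v) \<longleftrightarrow> (\<forall>i\<le>n. x i \<in> L D)"
proof -
  have "hdiv n x v \<le> D v \<longleftrightarrow> (v \<in> places emb \<longrightarrow> (\<forall>i\<le>n. x i \<in> pw v (- D v)))" for v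
  proof (cases "v \<in> places emb")
    case True
    then show ?thesis using le_min_valuation_iff[OF x, of "- D v" v] by (auto simp: hdiv_def)
  next
    case False
    then have "D v = 0" using DivD(2)[OF D, of v] by blast
    then show ?thesis using False by (simp add: hdiv_def)
  qed
  then show ?thesis unfolding L_pw by auto
qed

text \<open>Adding the divisor of a nonzero coordinate makes \<open>hdiv n x\<close> effective and
  keeps its degree. This confines the later inclusion and exclusion to sets of degree at most
  \<open>r\<close>.\<close>

lemma deg_hdiv_nonneg:
  assumes x: "x \<in> cv n" shows "0 \<le> deg (hdiv n x)"
proof -
  obtain i where i: "i \<le> n" "x i \<noteq> 0" using x by (auto simp: coordinate_vectors_def)
  have "x i \<in> L (hdiv n x)" using hdiv_le_iff[OF x hdiv_Div[OF x]] i(1) by blast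
  then have "(\<lambda>v. hdiv n x v + pdiv (x i) v) \<in> Eff" using L_add_pdiv_Eff[OF hdiv_Div[OF x] i(2)] by blast
  from deg_Eff[OF this] show ?thesis using deg_add_pdiv[OF hdiv_Div[OF x] i(2)] by simp
qed

lemma hdiv_scale:
  assumes x: "x \<in> cv n" and y: "y \<in> cv n" and c: "c \<noteq> 0" "\<forall>i\<le>n. y i = c * x i"
  shows "hdiv n y v = hdiv n x v - pdiv c v"
proof (cases "v \<in> places emb")
  case v: True
  have "k \<le> min_valuation n v y \<longleftrightarrow> k - v c \<le> min_valuation n v x" for k
  proof -
    have "c * x i \<in> pw v k \<longleftrightarrow> x i \<in> pw v (k - v c)" for i
      using place_mult[OF v c(1), of "x i"] c(1) by (cases "x i = 0") (auto simp: pw_iff)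
    then show ?thesis unfolding le_min_valuation_iff[OF x] le_min_valuation_iff[OF y] using c(2) by simp
  qed
  from this[of "min_valuation n v y"] this[of "min_valuation n v x + v c"]
  have "min_valuation n v y = min_valuation n v x + v c" by simp
  then show ?thesis using v by (simp add: hdiv_def pdiv_apply)
qed (simp add: hdiv_def principal_divisor_def)

section \<open>Counting coordinate vectors with bounded divisor\<close>

definition vectors_le :: "nat \<Rightarrow> 'k divisor \<Rightarrow> (nat \<Rightarrow> 'k) set" where
  "vectors_le n D = {x \<in> cv n. \<forall>v. hdiv n x v \<le> D v}"

definition vectors_eq :: "nat \<Rightarrow> 'k divisor \<Rightarrow> (nat \<Rightarrow> 'k) set" where
  "vectors_eq n D = {x \<in> cv n. hdiv n x = D}"

text \<open>These are the nonzero vectors with all coordinates in \<open>L D\<close>; the added 1 is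
  the zero vector.\<close>

lemma card_vectors_le:
  assumes D: "D \<in> Div"
  shows "finite (vectors_le n D)" and "card (vectors_le n D) + 1 = q ^ ((n + 1) * ldim D)"
proof -
  let ?T = "{..n} \<rightarrow>\<^sub>E L D"
  let ?z = "restrict (\<lambda>_. 0) {..n} :: nat \<Rightarrow> 'k"
  have z: "?z \<in> ?T" by (simp add: restrict_PiE_iff)
  have "vectors_le n D = ?T - {?z}"
  proof (intro equalityI subsetI)
    fix x assume x: "x \<in> vectors_le n D"
    then have xc: "x \<in> cv n" "\<forall>i\<le>n. x i \<in> L D" using hdiv_le_iff[OF _ D] by (auto simp: vectors_le_def)
    then have "x \<in> ?T" "x \<noteq> ?z" by (auto simp: coordinate_vectors_def PiE_iff)
    then show "x \<in> ?T - {?z}" by blast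
  next
    fix x assume x: "x \<in> ?T - {?z}"
    have "\<exists>i\<le>n. x i \<noteq> 0"
    proof (rule ccontr)
      assume "\<not> ?thesis"
      then have "x = ?z" using x z by (intro PiE_ext[of x "{..n}" "\<lambda>_. L D"]) auto
      then show False using x by blast
    qed
    then have "x \<in> cv n" using x by (auto simp: coordinate_vectors_def PiE_iff)
    then show "x \<in> vectors_le n D" using x hdiv_le_iff[OF _ D] by (auto simp: vectors_le_def PiE_iff)
  qed
  moreover have fin: "finite ?T" by (intro finite_PiE finite_L[OF D]) auto
  moreover have "card ?T = q ^ ((n + 1) * ldim D)"
    using power_mult[of q "ldim D" "n + 1"] by (simp add: card_PiE card_L[OF D] mult.commute)
  moreover have "card ?T \<noteq> 0" using fin z unfolding card_eq_0_iff by blast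
  ultimately show "finite (vectors_le n D)" "card (vectors_le n D) + 1 = q ^ ((n + 1) * ldim D)"
    using z by simp_all
qed

text \<open>Finite sets of places encode the squarefree effective divisors, on which the Moebius
  function is \<open>(- 1) ^ card S\<close>.\<close>

definition set_div :: "('k \<Rightarrow> int) set \<Rightarrow> 'k divisor" where
  "set_div S v = (if v \<in> S then 1 else 0)"

definition set_deg :: "('k \<Rightarrow> int) set \<Rightarrow> nat" where
  "set_deg S = (\<Sum>v\<in>S. pdeg v)"

definition place_sets :: "nat \<Rightarrow> ('k \<Rightarrow> int) set set" where
  "place_sets d = {S. finite S \<and> S \<subseteq> places emb \<and> set_deg S = d}"

lemma set_div_Eff:
  assumes "finite S" "S \<subseteq> places emb"
  shows "set_div S \<in> Eff" and "deg (set_div S) = int (set_deg S)"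
proof -
  have s: "{v. set_div S v \<noteq> 0} = S" by (auto simp: set_div_def)
  then have "set_div S \<in> Div" using assms by (simp add: divisors_def)
  then show "set_div S \<in> Eff" by (rule EffI) (simp add: set_div_def)
  show "deg (set_div S) = int (set_deg S)"
    unfolding divisor_degree_def s by (simp add: set_div_def set_deg_def)
qed

lemma inj_set_div: "inj set_div"
proof (rule injI)
  fix S T :: "('k \<Rightarrow> int) set" assume eq: "set_div S = set_div T"
  have "v \<in> S \<longleftrightarrow> v \<in> T" for v using fun_cong[OF eq, of v] by (auto simp: set_div_def split: if_splits)
  then show "S = T" by blast
qed

lemma card_place_sets: "finite (place_sets d)" "card (place_sets d) \<le> num_Eff d"
proof -
  have i: "inj_on set_div (place_sets d)" using inj_set_div inj_on_subset by blast
  have "set_div ` place_sets d \<subseteq> Eff_of_deg d"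
    using set_div_Eff by (auto simp: place_sets_def Eff_of_deg_def)
  then show "finite (place_sets d)" "card (place_sets d) \<le> num_Eff d"
    using i finite_Eff_of_deg inj_on_finite card_inj_on_le by blast+
qed

lemma finite_support_diff: "D \<in> Div \<Longrightarrow> E \<in> Div \<Longrightarrow> finite {v. E v < D v} \<and> {v. E v < D v} \<subseteq> places emb"
proof -
  assume "D \<in> Div" "E \<in> Div"
  then have F: "(\<lambda>v. D v - E v) \<in> Div" by (rule Div_diff)
  have s: "{v. E v < D v} \<subseteq> {v. D v - E v \<noteq> 0}" by auto
  then show ?thesis using DivD[OF F] finite_subset[OF s] by blast
qed

text \<open>Inclusion and exclusion over the places at which \<open>hdiv n x\<close> is smaller than \<open>D\<close>.\<close>

lemma card_vectors_eq:
  assumes D: "D \<in> Div" "deg D = int r"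
  shows "int (card (vectors_eq n D)) =
    (\<Sum>S\<in>(\<Union>d\<le>r. place_sets d). (- 1) ^ card S * int (card (vectors_le n (\<lambda>v. D v - set_div S v))))"
proof -
  let ?A = "\<Union>d\<le>r. place_sets d"
  let ?Xs = "vectors_le n D"
  define U where "U x = {v. hdiv n x v < D v}" for x
  have finA: "finite ?A" using card_place_sets(1) by blast
  have finX: "finite ?Xs" by (rule card_vectors_le[OF D(1)])
  have sub: "{x \<in> ?Xs. S \<subseteq> U x} = vectors_le n (\<lambda>v. D v - set_div S v)" for S
  proof -
    have "(\<forall>v. hdiv n x v \<le> D v) \<and> S \<subseteq> U x \<longleftrightarrow> (\<forall>v. hdiv n x v \<le> D v - set_div S v)" for x
    proof (intro iffI conjI allI subsetI)
      fix v assume a: "(\<forall>v. hdiv n x v \<le> D v) \<and> S \<subseteq> U x"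
      then have "hdiv n x v \<le> D v" by blast
      then show "hdiv n x v \<le> D v - set_div S v" using a by (auto simp: set_div_def U_def)
    next
      fix v assume "\<forall>v. hdiv n x v \<le> D v - set_div S v"
      then have b: "hdiv n x v \<le> D v - set_div S v" by blast
      then show "hdiv n x v \<le> D v" by (auto simp: set_div_def split: if_splits)
      show "v \<in> U x" if "v \<in> S" using b that by (auto simp: set_div_def U_def)
    qed
    then show ?thesis unfolding vectors_le_def by blast
  qed
  have "(\<Sum>S\<in>?A. (- 1) ^ card S * int (card (vectors_le n (\<lambda>v. D v - set_div S v))))
      = (\<Sum>S\<in>?A. \<Sum>x\<in>?Xs. if S \<subseteq> U x then (- 1) ^ card S else 0)"
  proof (rule sum.cong[OF refl])
    fix S
    have "(\<Sum>x\<in>?Xs. if S \<subseteq> U x then (- 1) ^ card S else 0) = (\<Sum>x\<in>{x \<in> ?Xs. S \<subseteq> U x}. (- 1 :: int) ^ card S)"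
      using finX by (rule sum.inter_filter[symmetric])
    then show "(- 1) ^ card S * int (card (vectors_le n (\<lambda>v. D v - set_div S v)))
        = (\<Sum>x\<in>?Xs. if S \<subseteq> U x then (- 1) ^ card S else 0)"
      unfolding sub by simp
  qed
  also have "\<dots> = (\<Sum>x\<in>?Xs. \<Sum>S\<in>?A. if S \<subseteq> U x then (- 1) ^ card S else 0)" by (rule sum.swap)
  also have "\<dots> = (\<Sum>x\<in>?Xs. if hdiv n x = D then 1 else 0)"
  proof (rule sum.cong[OF refl])
    fix x assume "x \<in> ?Xs"
    then have x: "x \<in> cv n" "\<And>v. hdiv n x v \<le> D v" by (auto simp: vectors_le_def)
    have U: "finite (U x)" "U x \<subseteq> places emb" unfolding U_def using finite_support_diff[OF D(1) hdiv_Div[OF x(1)]] by auto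
    have "{S \<in> ?A. S \<subseteq> U x} = Pow (U x)"
    proof (intro equalityI subsetI)
      fix S assume "S \<in> Pow (U x)"
      then have S: "S \<subseteq> U x" "finite S" "S \<subseteq> places emb" using U finite_subset by auto
      \<comment> \<open>The difference \<open>D - hdiv n x\<close> has degree at most
        \<open>r\<close>, so no subset of \<open>U x\<close> is lost by the restriction to sets of
        degree at most \<open>r\<close>.\<close>
      have "deg (set_div S) \<le> deg (\<lambda>v. D v - hdiv n x v)"
      proof (rule deg_mono[OF EffD(1)[OF set_div_Eff(1)[OF S(2,3)]] Div_diff[OF D(1) hdiv_Div[OF x(1)]]])
        show "set_div S v \<le> D v - hdiv n x v" for v using x(2)[of v] S(1) by (auto simp: set_div_def U_def)
      qed
      then have "set_deg S \<le> r"
        using deg_diff[OF D(1) hdiv_Div[OF x(1)]] D(2) deg_hdiv_nonneg[OF x(1)] set_div_Eff(2)[OF S(2,3)] by simp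
      then show "S \<in> {S \<in> ?A. S \<subseteq> U x}" using S by (auto simp: place_sets_def)
    qed auto
    then have "(\<Sum>S\<in>?A. if S \<subseteq> U x then (- 1) ^ card S else 0) = (\<Sum>S\<in>Pow (U x). (- 1 :: int) ^ card S)"
      using sum.inter_filter[OF finA, of "\<lambda>S. (- 1 :: int) ^ card S" "\<lambda>S. S \<subseteq> U x"] by simp
    also have "\<dots> = (if U x = {} then 1 else 0)" by (rule sum_alternating_Pow[OF U(1)])
    also have "U x = {} \<longleftrightarrow> hdiv n x = D"
    proof
      assume "U x = {}"
      then have "\<not> hdiv n x v < D v" for v unfolding U_def by blast
      then show "hdiv n x = D" using x(2) by (intro ext) (simp add: order.antisym not_less)
    qed (simp add: U_def)
    finally show "(\<Sum>S\<in>?A. if S \<subseteq> U x then (- 1) ^ card S else 0) = (if hdiv n x = D then 1 else (0 :: int))" .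
  qed
  also have "\<dots> = int (card {x \<in> ?Xs. hdiv n x = D})"
    using finX by (simp add: sum.If_cases Int_def)
  also have "{x \<in> ?Xs. hdiv n x = D} = vectors_eq n D" by (auto simp: vectors_le_def vectors_eq_def)
  finally show ?thesis by simp
qed

text \<open>The coefficient of \<open>t ^ d\<close> in \<open>1 / Z\<close>, the product of the
  factors \<open>1 - t ^ pdeg v\<close> over all places.\<close>

definition moebius_sum :: "nat \<Rightarrow> int" where
  "moebius_sum d = (\<Sum>S\<in>place_sets d. (- 1) ^ card S)"

lemma abs_moebius_sum_le: "\<bar>moebius_sum d\<bar> \<le> int (num_Eff d)"
proof -
  have "\<bar>moebius_sum d\<bar> \<le> (\<Sum>S\<in>place_sets d. \<bar>(- 1) ^ card S\<bar>)" unfolding moebius_sum_def by (rule sum_abs)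
  also have "\<dots> = int (card (place_sets d))" by (simp add: power_abs)
  finally show ?thesis using card_place_sets(2)[of d] by simp
qed

lemma sum_place_sets: "(\<Sum>S\<in>(\<Union>d\<le>r. place_sets d). u S) = (\<Sum>d\<le>r. \<Sum>S\<in>place_sets d. u S)"
  by (rule sum.UNION_disjoint) (auto simp: card_place_sets(1), auto simp: place_sets_def)

text \<open>Coefficientwise \<open>(1 / Z) * Z = 1\<close>: both sides count, with sign, effective
  divisors \<open>F\<close> of degree \<open>d\<close> together with a subset of their support, and
  the signs cancel unless the support is empty.\<close>

lemma moebius_convolution:
  "(\<Sum>i\<le>d. moebius_sum i * int (num_Eff (d - i))) = (if d = 0 then 1 else 0)"
proof -
  let ?A = "\<Union>i\<le>d. place_sets i"
  let ?U = "\<lambda>F :: 'k divisor. {v. F v \<noteq> 0}"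
  have finA: "finite ?A" using card_place_sets(1) by blast
  have cnt: "card {F \<in> Eff_of_deg d. S \<subseteq> ?U F} = num_Eff (d - i)" if S: "S \<in> place_sets i" "i \<le> d" for S i
  proof -
    have S': "finite S" "S \<subseteq> places emb" "set_deg S = i" using S(1) by (auto simp: place_sets_def)
    note sd = set_div_Eff[OF S'(1,2)]
    have "bij_betw (\<lambda>E v. E v + set_div S v) (Eff_of_deg (d - i)) {F \<in> Eff_of_deg d. S \<subseteq> ?U F}"
    proof (rule bij_betw_byWitness[where f' = "\<lambda>F v. F v - set_div S v"])
      show "(\<lambda>E v. E v + set_div S v) ` Eff_of_deg (d - i) \<subseteq> {F \<in> Eff_of_deg d. S \<subseteq> ?U F}"
      proof (rule image_subsetI)
        fix E assume "E \<in> Eff_of_deg (d - i)"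
        then have E: "E \<in> Eff" "deg E = int (d - i)" by (auto simp: Eff_of_deg_def)
        have "deg (\<lambda>v. E v + set_div S v) = int d"
          using deg_add[OF EffD(1)[OF E(1)] EffD(1)[OF sd(1)]] E(2) sd(2) S'(3) S(2) by simp
        moreover have "E v + set_div S v \<noteq> 0" if "v \<in> S" for v
          using EffD(2)[OF E(1), of v] that by (simp add: set_div_def)
        ultimately show "(\<lambda>v. E v + set_div S v) \<in> {F \<in> Eff_of_deg d. S \<subseteq> ?U F}"
          using Eff_add[OF E(1) sd(1)] by (auto simp: Eff_of_deg_def)
      qed
      show "(\<lambda>F v. F v - set_div S v) ` {F \<in> Eff_of_deg d. S \<subseteq> ?U F} \<subseteq> Eff_of_deg (d - i)"
      proof (rule image_subsetI)
        fix F assume "F \<in> {F \<in> Eff_of_deg d. S \<subseteq> ?U F}"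
        then have F: "F \<in> Eff" "deg F = int d" "S \<subseteq> ?U F" by (auto simp: Eff_of_deg_def)
        have "0 \<le> F v - set_div S v" for v
        proof (cases "v \<in> S")
          case True
          then have "F v \<noteq> 0" using F(3) by blast
          then show ?thesis using EffD(2)[OF F(1), of v] True by (simp add: set_div_def)
        qed (use EffD(2)[OF F(1), of v] in \<open>simp add: set_div_def\<close>)
        then have "(\<lambda>v. F v - set_div S v) \<in> Eff" by (intro EffI Div_diff EffD(1)[OF F(1)] EffD(1)[OF sd(1)])
        moreover have "deg (\<lambda>v. F v - set_div S v) = int (d - i)"
          using deg_diff[OF EffD(1)[OF F(1)] EffD(1)[OF sd(1)]] F(2) sd(2) S'(3) S(2) by simp
        ultimately show "(\<lambda>v. F v - set_div S v) \<in> Eff_of_deg (d - i)" by (simp add: Eff_of_deg_def)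
      qed
    qed auto
    then show ?thesis by (rule bij_betw_same_card[symmetric])
  qed
  have "(\<Sum>i\<le>d. moebius_sum i * int (num_Eff (d - i)))
      = (\<Sum>i\<le>d. \<Sum>S\<in>place_sets i. \<Sum>F\<in>Eff_of_deg d. if S \<subseteq> ?U F then (- 1) ^ card S else 0)"
  proof (rule sum.cong[OF refl])
    fix i assume i: "i \<in> {..d}"
    have "(\<Sum>F\<in>Eff_of_deg d. if S \<subseteq> ?U F then (- 1) ^ card S else 0) = (- 1) ^ card S * int (num_Eff (d - i))"
      if S: "S \<in> place_sets i" for S
    proof -
      have "(\<Sum>F\<in>Eff_of_deg d. if S \<subseteq> ?U F then (- 1) ^ card S else 0)
          = (\<Sum>F\<in>{F \<in> Eff_of_deg d. S \<subseteq> ?U F}. (- 1 :: int) ^ card S)"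
        using finite_Eff_of_deg by (rule sum.inter_filter[symmetric])
      then show ?thesis using cnt[OF S] i by simp
    qed
    then show "moebius_sum i * int (num_Eff (d - i))
        = (\<Sum>S\<in>place_sets i. \<Sum>F\<in>Eff_of_deg d. if S \<subseteq> ?U F then (- 1) ^ card S else 0)"
      unfolding moebius_sum_def sum_distrib_right by (intro sum.cong[OF refl]) simp
  qed
  also have "\<dots> = (\<Sum>S\<in>?A. \<Sum>F\<in>Eff_of_deg d. if S \<subseteq> ?U F then (- 1) ^ card S else 0)"
    by (rule sum_place_sets[symmetric])
  also have "\<dots> = (\<Sum>F\<in>Eff_of_deg d. \<Sum>S\<in>?A. if S \<subseteq> ?U F then (- 1) ^ card S else 0)" by (rule sum.swap)
  also have "\<dots> = (\<Sum>F\<in>Eff_of_deg d. if d = 0 then 1 else 0)"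
  proof (rule sum.cong[OF refl])
    fix F assume "F \<in> Eff_of_deg d"
    then have F: "F \<in> Eff" "deg F = int d" by (auto simp: Eff_of_deg_def)
    have U: "finite (?U F)" "?U F \<subseteq> places emb" using DivD[OF EffD(1)[OF F(1)]] by auto
    have "{S \<in> ?A. S \<subseteq> ?U F} = Pow (?U F)"
    proof (intro equalityI subsetI)
      fix S assume "S \<in> Pow (?U F)"
      then have S: "S \<subseteq> ?U F" "finite S" "S \<subseteq> places emb" using U finite_subset by auto
      have "deg (set_div S) \<le> deg F"
      proof (rule deg_mono[OF EffD(1)[OF set_div_Eff(1)[OF S(2,3)]] EffD(1)[OF F(1)]])
        fix v
        have "F v \<noteq> 0" if "v \<in> S" using that S(1) by blast
        then show "set_div S v \<le> F v" using EffD(2)[OF F(1), of v] by (auto simp: set_div_def)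
      qed
      then have "set_deg S \<le> d" using F(2) set_div_Eff(2)[OF S(2,3)] by simp
      then show "S \<in> {S \<in> ?A. S \<subseteq> ?U F}" using S by (auto simp: place_sets_def)
    qed auto
    then have "(\<Sum>S\<in>?A. if S \<subseteq> ?U F then (- 1) ^ card S else 0) = (\<Sum>S\<in>Pow (?U F). (- 1 :: int) ^ card S)"
      using sum.inter_filter[OF finA, of "\<lambda>S. (- 1 :: int) ^ card S" "\<lambda>S. S \<subseteq> ?U F"] by simp
    also have "\<dots> = (if ?U F = {} then 1 else 0)" by (rule sum_alternating_Pow[OF U(1)])
    also have "?U F = {} \<longleftrightarrow> d = 0"
    proof
      assume "?U F = {}"
      then have "F = (\<lambda>_. 0)" by auto
      then show "d = 0" using F(2) by simp
    next
      assume "d = 0"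
      then show "?U F = {}" using Eff_deg_0[OF F(1)] F(2) by simp
    qed
    finally show "(\<Sum>S\<in>?A. if S \<subseteq> ?U F then (- 1) ^ card S else 0) = (if d = 0 then 1 else (0 :: int))" .
  qed
  also have "\<dots> = (if d = 0 then 1 else 0)"
  proof (cases "d = 0")
    case True
    have "Eff_of_deg 0 = {\<lambda>_. 0}" using Eff_deg_0 by (auto simp: Eff_of_deg_def)
    then show ?thesis using True by simp
  qed simp
  finally show ?thesis .
qed

text \<open>Translation by \<open>r\<close> times a divisor of degree one carries the classes of
  degree zero to those of degree \<open>r\<close>.\<close>

lemma exists_reps_of_degree:
  "\<exists>T\<subseteq>Div. finite T \<and> card T = h \<and> (\<forall>D\<in>T. deg D = int r) \<and>
     (\<forall>D\<in>Div. deg D = int r \<longrightarrow> (\<exists>E\<in>T. D \<sim> E)) \<and> (\<forall>D\<in>T. \<forall>E\<in>T. D \<sim> E \<longrightarrow> D = E)"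
proof -
  obtain D1 where D1: "D1 \<in> Div" "deg D1 = 1" using exists_degree_one by blast
  define M where "M = (\<lambda>v. int r * D1 v)"
  have M: "M \<in> Div" "deg M = int r" unfolding M_def using Div_scale[OF D1(1)] deg_scale[OF D1(1)] D1(2) by simp_all
  define T where "T = (\<lambda>D v. D v + M v) ` class_reps"
  have cr: "D \<in> Div" "deg D = 0" if "D \<in> class_reps" for D
    using class_reps(1) that by (auto simp: divisors_degree_zero_def)
  have sub: "(\<lambda>v. D v + M v) \<sim> (\<lambda>v. E v + M v) \<longleftrightarrow> D \<sim> E" for D E
    unfolding lequiv_iff by (simp add: fun_eq_iff)
  have "inj_on (\<lambda>D v. D v + M v) class_reps"
  proof (rule inj_onI)
    fix D E assume eq: "(\<lambda>v. D v + M v) = (\<lambda>v. E v + M v)"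
    show "D = E"
    proof
      show "D v = E v" for v using fun_cong[OF eq, of v] by simp
    qed
  qed
  then have "card T = h" unfolding T_def using class_reps(3) by (simp add: card_image)
  moreover have "T \<subseteq> Div" unfolding T_def using cr Div_add[OF _ M(1)] by blast
  moreover have "finite T" unfolding T_def using class_reps(2) by simp
  moreover have "\<forall>D\<in>T. deg D = int r" unfolding T_def using cr deg_add[OF _ M(1)] M(2) by simp
  moreover have "\<exists>E\<in>T. D \<sim> E" if D: "D \<in> Div" "deg D = int r" for D
  proof -
    have "(\<lambda>v. D v - M v) \<in> Div0"
      using Div_diff[OF D(1) M(1)] deg_diff[OF D(1) M(1)] D(2) M(2) by (simp add: divisors_degree_zero_def)
    then obtain E where E: "E \<in> class_reps" "(\<lambda>v. D v - M v) \<sim> E" using class_reps(4) by blast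
    from lequiv_add[OF E(2), of M] have "D \<sim> (\<lambda>v. E v + M v)" by simp
    then show ?thesis unfolding T_def using E(1) by blast
  qed
  moreover have "\<forall>D\<in>T. \<forall>E\<in>T. D \<sim> E \<longrightarrow> D = E"
    unfolding T_def using class_reps(5) sub by auto
  ultimately show ?thesis by (intro exI[of _ T]) simp
qed

section \<open>From coordinate vectors to projective points\<close>

abbreviation points :: "nat \<Rightarrow> nat \<Rightarrow> (nat \<Rightarrow> 'k) set set" where "points n r \<equiv> {P \<in> projective_space n. height emb n P = int r}"

lemma proportional_equiv: "equiv (cv n) (proportional n)"
proof (rule equivI)
  let ?R = "proportional n :: ((nat \<Rightarrow> 'k) \<times> (nat \<Rightarrow> 'k)) set"
  show "refl_on (cv n) ?R" "?R \<subseteq> cv n \<times> cv n"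
    by (auto simp: refl_on_def proportional_def intro: exI[of _ 1])
  show "sym ?R"
  proof (rule symI)
    fix x y :: "nat \<Rightarrow> 'k" assume "(x, y) \<in> proportional n"
    then obtain c where c: "x \<in> cv n" "y \<in> cv n" "c \<noteq> 0" "\<forall>i\<le>n. y i = c * x i" by (auto simp: proportional_def)
    have "\<forall>i\<le>n. x i = inverse c * y i" using c(3,4) by simp
    then show "(y, x) \<in> proportional n" using c unfolding proportional_def
      by (auto intro!: exI[of _ "inverse c"])
  qed
  show "trans ?R"
  proof (rule transI)
    fix x y z :: "nat \<Rightarrow> 'k" assume "(x, y) \<in> proportional n" "(y, z) \<in> proportional n"
    then obtain c d where c: "x \<in> cv n" "z \<in> cv n" "c \<noteq> 0" "\<forall>i\<le>n. y i = c * x i" "d \<noteq> 0" "\<forall>i\<le>n. z i = d * y i"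
      by (auto simp: proportional_def)
    then have "\<forall>i\<le>n. z i = (d * c) * x i" by simp
    then show "(x, z) \<in> proportional n" using c unfolding proportional_def by (auto intro!: exI[of _ "d * c"])
  qed
qed

lemma scale_vector:
  assumes x: "x \<in> cv n" and c: "c \<noteq> 0"
  shows "(x, restrict (\<lambda>i. c * x i) {..n}) \<in> proportional n"
  using x c by (auto simp: proportional_def coordinate_vectors_def intro!: exI[of _ c])

text \<open>A point of height \<open>r\<close> can be scaled so that its divisor is one of the
  representatives, and only one. The scalar is then determined up to functions with trivial divisor,
  that is up to the \<open>q - 1\<close> nonzero constants.\<close>

lemma card_points:
  assumes T: "T \<subseteq> Div" "finite T" "\<And>D. D \<in> T \<Longrightarrow> deg D = int r"
    "\<And>D. D \<in> Div \<Longrightarrow> deg D = int r \<Longrightarrow> \<exists>E\<in>T. D \<sim> E"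
    "\<And>D E. D \<in> T \<Longrightarrow> E \<in> T \<Longrightarrow> D \<sim> E \<Longrightarrow> D = E"
  shows "(q - 1) * card (points n r) = (\<Sum>D\<in>T. card (vectors_eq n D))"
proof -
  define Z where "Z = (\<Union>D\<in>T. vectors_eq n D)"
  have fe: "finite (vectors_eq n D)" if "D \<in> T" for D
  proof (rule finite_subset)
    show "vectors_eq n D \<subseteq> vectors_le n D" by (auto simp: vectors_eq_def vectors_le_def)
    show "finite (vectors_le n D)" using card_vectors_le(1) that T(1) by blast
  qed
  have finZ: "finite Z" unfolding Z_def using T(2) fe by blast
  have cZ: "card Z = (\<Sum>D\<in>T. card (vectors_eq n D))"
    unfolding Z_def using T(2) fe by (intro card_UN_disjoint) (auto simp: vectors_eq_def)
  have fib: "card (P \<inter> Z) = q - 1" if P: "P \<in> points n r" for P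
  proof -
    obtain x0 where x0: "x0 \<in> cv n" "P = proportional n `` {x0}"
      using P by (auto simp: projective_space_def elim: quotientE)
    have x0P: "x0 \<in> P" using x0 equiv_class_self[OF proportional_equiv] by blast
    define y where "y = (SOME x. x \<in> P)"
    have "y \<in> P" unfolding y_def by (rule someI[of "\<lambda>x. x \<in> P", OF x0P])
    then have "(x0, y) \<in> proportional n" using x0 by blast
    then obtain c where c: "y \<in> cv n" "c \<noteq> 0" "\<forall>i\<le>n. y i = c * x0 i" by (auto simp: proportional_def)
    have "hdiv n y = (\<lambda>v. hdiv n x0 v - pdiv c v)" using hdiv_scale[OF x0(1) c] by blast
    then have "deg (hdiv n y) = deg (hdiv n x0)"
      using deg_diff[OF hdiv_Div[OF x0(1)] pdiv_Div[OF c(2)]] deg_pdiv[OF c(2)] by simp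
    moreover have "deg (hdiv n y) = int r"
    proof -
      have "height emb n P = int r" using P by blast
      then show ?thesis unfolding height_def y_def[symmetric] vector_height_eq .
    qed
    ultimately obtain D where D: "D \<in> T" "hdiv n x0 \<sim> D" using T(4)[OF hdiv_Div[OF x0(1)]] by auto
    then obtain f where f: "f \<noteq> 0" "hdiv n x0 = (\<lambda>v. D v + pdiv f v)" unfolding lequiv_iff by blast
    \<comment> \<open>Scaling by \<open>f\<close> moves the divisor of the vector within its class
      to the representative \<open>D\<close>.\<close>
    define z where "z = restrict (\<lambda>i. f * x0 i) {..n}"
    have xz: "(x0, z) \<in> proportional n" unfolding z_def by (rule scale_vector[OF x0(1) f(1)])
    then have zc: "z \<in> cv n" "z \<in> P" using x0(2) by (auto simp: proportional_def)
    have hz: "hdiv n z = D"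
    proof
      fix v
      have "hdiv n z v = hdiv n x0 v - pdiv f v"
        by (rule hdiv_scale[OF x0(1) zc(1) f(1)]) (simp add: z_def)
      then show "hdiv n z v = D v" using fun_cong[OF f(2), of v] by simp
    qed
    have Pz: "P = proportional n `` {z}"
      unfolding x0(2) using equiv_class_eq[OF proportional_equiv xz] .
    let ?s = "\<lambda>c. restrict (\<lambda>i. emb c * z i) {..n}"
    have "P \<inter> Z = ?s ` (UNIV - {0})"
    proof (intro equalityI subsetI)
      fix w assume w: "w \<in> P \<inter> Z"
      then obtain E where E: "E \<in> T" "w \<in> vectors_eq n E" unfolding Z_def by blast
      then have wc: "w \<in> cv n" "hdiv n w = E" by (auto simp: vectors_eq_def)
      obtain c where c: "c \<noteq> 0" "\<forall>i\<le>n. w i = c * z i" using w unfolding Pz by (auto simp: proportional_def)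
      have hw: "hdiv n w v = D v - pdiv c v" for v using hdiv_scale[OF zc(1) wc(1) c] hz by simp
      then have DE: "D = (\<lambda>v. E v + pdiv c v)" using wc(2) by (intro ext) simp
      then have "D \<sim> E" unfolding lequiv_iff using c(1) by blast
      then have "D = E" by (rule T(5)[OF D(1) E(1)])
      then have "\<forall>v. pdiv c v = 0" using fun_cong[OF DE] by simp
      then obtain e where e: "c = emb e" using pdiv_eq_0_iff[OF c(1)] by blast
      have "w = ?s e"
      proof
        fix i
        show "w i = ?s e i"
        proof (cases "i \<le> n")
          case False
          have "w \<in> {..n} \<rightarrow>\<^sub>E UNIV" using wc(1) by (simp add: coordinate_vectors_def)
          then show ?thesis using PiE_arb[of w "{..n}" "\<lambda>_. UNIV" i] False by simp
        qed (use c(2) e in simp)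
      qed
      moreover have "e \<noteq> 0" using c(1) e by auto
      ultimately show "w \<in> ?s ` (UNIV - {0})" by blast
    next
      fix w assume "w \<in> ?s ` (UNIV - {0})"
      then obtain e where e: "e \<noteq> 0" "w = ?s e" by blast
      then have ne: "emb e \<noteq> 0" by simp
      have zw: "(z, w) \<in> proportional n" unfolding e(2) by (rule scale_vector[OF zc(1) ne])
      then have wP: "w \<in> P" "w \<in> cv n" unfolding Pz by (auto simp: proportional_def)
      have "pdiv (emb e) v = 0" for v using pdiv_eq_0_iff[OF ne] by blast
      then have "hdiv n w v = D v" for v
        using hdiv_scale[OF zc(1) wP(2) ne, of v] hz e(2) by simp
      then have "w \<in> vectors_eq n D" using wP(2) by (auto simp: vectors_eq_def)
      then show "w \<in> P \<inter> Z" using wP D(1) unfolding Z_def by blast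
    qed
    moreover have "inj_on ?s (UNIV - {0})"
    proof (rule inj_onI)
      fix a b assume eq: "?s a = ?s b"
      obtain i where i: "i \<le> n" "z i \<noteq> 0" using zc(1) by (auto simp: coordinate_vectors_def)
      then have "emb a * z i = emb b * z i" using fun_cong[OF eq, of i] by simp
      then show "a = b" using i(2) by simp
    qed
    ultimately show ?thesis by (simp add: card_image card_Diff_subset)
  qed
  have "q - 1 \<noteq> 0" using q_ge_2 by simp
  have ZP: "Z = (\<Union>P\<in>points n r. P \<inter> Z)"
  proof -
    have "\<exists>P\<in>points n r. x \<in> P" if x: "x \<in> Z" for x
    proof -
      obtain D where D: "D \<in> T" "x \<in> cv n" "hdiv n x = D" using x by (auto simp: Z_def vectors_eq_def)
      let ?P = "proportional n `` {x}"
      have xP: "x \<in> ?P" using D(2) equiv_class_self[OF proportional_equiv] by blast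
      define y where "y = (SOME x. x \<in> ?P)"
      have "y \<in> ?P" unfolding y_def by (rule someI[of "\<lambda>x. x \<in> ?P", OF xP])
      then obtain c where c: "y \<in> cv n" "c \<noteq> 0" "\<forall>i\<le>n. y i = c * x i" by (auto simp: proportional_def)
      have "hdiv n y = (\<lambda>v. hdiv n x v - pdiv c v)" using hdiv_scale[OF D(2) c] by blast
      then have "deg (hdiv n y) = deg (hdiv n x)"
        using deg_diff[OF hdiv_Div[OF D(2)] pdiv_Div[OF c(2)]] deg_pdiv[OF c(2)] by simp
      then have "height emb n ?P = int r"
        using T(3)[OF D(1)] D(3) unfolding height_def y_def[symmetric] vector_height_eq by simp
      moreover have "?P \<in> projective_space n" unfolding projective_space_def using D(2) by (rule quotientI)
      ultimately show ?thesis using xP by blast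
    qed
    then show ?thesis by blast
  qed
  have disj: "P \<inter> Q = {}" if "P \<in> points n r" "Q \<in> points n r" "P \<noteq> Q" for P Q
    using quotient_disj[OF proportional_equiv, of P n Q] that by (auto simp: projective_space_def)
  have finP: "finite (points n r)"
  proof (rule inj_on_finite)
    show "inj_on (\<lambda>P. P \<inter> Z) (points n r)"
    proof (rule inj_onI)
      fix P Q assume P: "P \<in> points n r" and Q: "Q \<in> points n r" and eq: "P \<inter> Z = Q \<inter> Z"
      have "P \<inter> Z \<noteq> {}" using fib[OF P] \<open>q - 1 \<noteq> 0\<close> by auto
      then show "P = Q" using disj[OF P Q] eq by blast
    qed
    show "(\<lambda>P. P \<inter> Z) ` points n r \<subseteq> Pow Z" by blast
    show "finite (Pow Z)" using finZ by simp
  qed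
  have "card Z = card (\<Union>P\<in>points n r. P \<inter> Z)" by (rule arg_cong[OF ZP])
  also have "\<dots> = (\<Sum>P\<in>points n r. card (P \<inter> Z))"
    using finP finZ disj by (intro card_UN_disjoint) blast+
  also have "\<dots> = (\<Sum>P\<in>points n r. q - 1)" by (rule sum.cong[OF refl fib])
  finally show ?thesis using cZ by (simp add: mult.commute)
qed

end

section \<open>Asymptotics\<close>

lemma sum_powers_le: "2 \<le> (a :: real) \<Longrightarrow> (\<Sum>d\<le>r. a ^ d) \<le> a ^ (r + 1)"
proof (induction r)
  case (Suc r)
  then have "(\<Sum>d\<le>Suc r. a ^ d) \<le> 2 * a ^ (r + 1)" by simp
  also have "\<dots> \<le> a * a ^ (r + 1)" using Suc.prems by (intro mult_right_mono) auto
  finally show ?case by simp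
qed simp

context function_field
begin

section \<open>Summation over sets of places\<close>

lemma num_Eff_le_real: "real (num_Eff d) \<le> real h * real q * real q ^ d"
proof -
  have "real (num_Eff d) \<le> real (h * q ^ (d + 1))" by (rule of_nat_mono[OF num_Eff_le])
  then show ?thesis by (simp add: mult_ac)
qed

text \<open>For each set of places of degree \<open>d\<close> the number of vectors, summed over the
  \<open>h\<close> classes, differs from its expected value by a bounded amount. There are
  \<open>O(q ^ d)\<close> such sets, and the geometric sum over \<open>d \<le> r\<close> is of order
  \<open>q ^ r\<close>.\<close>

lemma card_points_approx:
  "\<exists>C. \<forall>r. \<bar>real (q - 1) * real (card (points n r)) -
      real h * real q powi ((int n + 1) * (1 - g)) * (\<Sum>d\<le>r. real_of_int (moebius_sum d) * real q ^ ((n + 1) * (r - d)))\<bar>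
    \<le> C * real q ^ r"
proof -
  obtain c0 where c0: "0 \<le> c0" "\<And>D. D \<in> Div \<Longrightarrow> c0 \<le> deg D \<Longrightarrow> int (ldim D) = deg D + 1 - g"
    using riemann_equality by blast
  define c where "c = nat c0"
  have c: "int c = c0" using c0(1) by (simp add: c_def)
  define a where "a = real q"
  have a: "2 \<le> a" using q_ge_2 by (simp add: a_def)
  define C0 where "C0 = real h * a powi ((int n + 1) * (1 - g))"
  have C0: "0 \<le> C0" using a by (simp add: C0_def)
  \<comment> \<open>\<open>real h\<close> accounts for the zero vector of each class when Riemann's
    equality holds; the other two terms bound the count and the expected value when the remaining
    degree is below \<open>c\<close>.\<close>
  define K where "K = real h + real h * a ^ ((n + 1) * (c + 1)) + C0 * a ^ ((n + 1) * c)"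
  have K: "0 \<le> K" unfolding K_def using C0 a by (intro add_nonneg_nonneg mult_nonneg_nonneg) auto
  have "\<bar>real (q - 1) * real (card (points n r)) - C0 * (\<Sum>d\<le>r. real_of_int (moebius_sum d) * a ^ ((n + 1) * (r - d)))\<bar>
      \<le> (K * real h * a * a) * a ^ r" for r
  proof -
    obtain T where T: "T \<subseteq> Div" "finite T" "card T = h" "\<And>D. D \<in> T \<Longrightarrow> deg D = int r"
      "\<And>D. D \<in> Div \<Longrightarrow> deg D = int r \<Longrightarrow> \<exists>E\<in>T. D \<sim> E"
      "\<And>D E. D \<in> T \<Longrightarrow> E \<in> T \<Longrightarrow> D \<sim> E \<Longrightarrow> D = E"
      using exists_reps_of_degree[of r] by auto
    let ?A = "\<Union>d\<le>r. place_sets d"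
    define w where "w S = (\<Sum>D\<in>T. a ^ ((n + 1) * ldim (\<lambda>v. D v - set_div S v)) - 1)" for S
    have DS: "(\<lambda>v. D v - set_div S v) \<in> Div" "deg (\<lambda>v. D v - set_div S v) = int (r - d)"
      if "D \<in> T" "d \<le> r" "S \<in> place_sets d" for D S d
    proof -
      have S: "finite S" "S \<subseteq> places emb" "set_deg S = d" using that(3) by (auto simp: place_sets_def)
      note sd = set_div_Eff[OF S(1,2)]
      have D: "D \<in> Div" using T(1) that(1) by blast
      show "(\<lambda>v. D v - set_div S v) \<in> Div" by (rule Div_diff[OF D EffD(1)[OF sd(1)]])
      show "deg (\<lambda>v. D v - set_div S v) = int (r - d)"
        using deg_diff[OF D EffD(1)[OF sd(1)]] T(4)[OF that(1)] sd(2) S(3) that(2) by simp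
    qed
    have "int ((q - 1) * card (points n r)) = (\<Sum>D\<in>T. int (card (vectors_eq n D)))"
      by (simp only: card_points[OF T(1,2,4,5,6)] of_nat_sum)
    also have "\<dots> = (\<Sum>D\<in>T. \<Sum>S\<in>?A. (- 1) ^ card S * int (card (vectors_le n (\<lambda>v. D v - set_div S v))))"
    proof (rule sum.cong[OF refl])
      fix D assume D: "D \<in> T"
      then have "D \<in> Div" using T(1) by blast
      then show "int (card (vectors_eq n D))
          = (\<Sum>S\<in>?A. (- 1) ^ card S * int (card (vectors_le n (\<lambda>v. D v - set_div S v))))"
        using T(4)[OF D] by (rule card_vectors_eq)
    qed
    also have "\<dots> = (\<Sum>S\<in>?A. \<Sum>D\<in>T. (- 1) ^ card S * int (card (vectors_le n (\<lambda>v. D v - set_div S v))))"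
      by (rule sum.swap)
    finally have I: "int ((q - 1) * card (points n r))
        = (\<Sum>S\<in>?A. \<Sum>D\<in>T. (- 1) ^ card S * int (card (vectors_le n (\<lambda>v. D v - set_div S v))))" .
    have "real (q - 1) * real (card (points n r)) = real_of_int (int ((q - 1) * card (points n r)))" by simp
    also have "\<dots> = (\<Sum>S\<in>?A. \<Sum>D\<in>T. (- 1) ^ card S * real (card (vectors_le n (\<lambda>v. D v - set_div S v))))"
      unfolding I by simp
    also have "\<dots> = (\<Sum>S\<in>?A. (- 1) ^ card S * w S)"
    proof (rule sum.cong[OF refl])
      fix S assume "S \<in> ?A"
      then obtain d where d: "d \<le> r" "S \<in> place_sets d" by blast
      have "real (card (vectors_le n (\<lambda>v. D v - set_div S v))) = a ^ ((n + 1) * ldim (\<lambda>v. D v - set_div S v)) - 1"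
        if D: "D \<in> T" for D
      proof -
        have "real (card (vectors_le n (\<lambda>v. D v - set_div S v)) + 1) = real (q ^ ((n + 1) * ldim (\<lambda>v. D v - set_div S v)))"
          using card_vectors_le(2)[OF DS(1)[OF D d], of n] by simp
        then show ?thesis unfolding a_def by simp
      qed
      then show "(\<Sum>D\<in>T. (- 1) ^ card S * real (card (vectors_le n (\<lambda>v. D v - set_div S v)))) = (- 1) ^ card S * w S"
        unfolding w_def sum_distrib_left by (intro sum.cong[OF refl]) simp
    qed
    also have "\<dots> = (\<Sum>d\<le>r. \<Sum>S\<in>place_sets d. (- 1) ^ card S * w S)" by (rule sum_place_sets)
    finally have lhs: "real (q - 1) * real (card (points n r)) = (\<Sum>d\<le>r. \<Sum>S\<in>place_sets d. (- 1) ^ card S * w S)" .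
    have wb: "\<bar>w S - C0 * a ^ ((n + 1) * (r - d))\<bar> \<le> K" if d: "d \<le> r" "S \<in> place_sets d" for S d
    proof (cases "c \<le> r - d")
      case True
      have "a ^ ((n + 1) * ldim (\<lambda>v. D v - set_div S v)) = a powi ((int n + 1) * (1 - g)) * a ^ ((n + 1) * (r - d))"
        if D: "D \<in> T" for D
      proof -
        have "int (ldim (\<lambda>v. D v - set_div S v)) = int (r - d) + 1 - g"
          using c0(2)[OF DS(1)[OF D d]] DS(2)[OF D d] True c by simp
        then have "int ((n + 1) * ldim (\<lambda>v. D v - set_div S v)) = (int n + 1) * (int (r - d) + 1 - g)"
          by (simp only: of_nat_mult of_nat_add of_nat_1)
        also have "\<dots> = (int n + 1) * (1 - g) + int ((n + 1) * (r - d))"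
          unfolding of_nat_mult of_nat_add of_nat_1 by (simp only: distrib_left right_diff_distrib)
        finally have "a powi (int ((n + 1) * ldim (\<lambda>v. D v - set_div S v)))
            = a powi ((int n + 1) * (1 - g)) * a powi (int ((n + 1) * (r - d)))"
          using a by (simp only:) (rule power_int_add, simp)
        then show ?thesis unfolding power_int_of_nat .
      qed
      then have "w S = (\<Sum>D\<in>T. a powi ((int n + 1) * (1 - g)) * a ^ ((n + 1) * (r - d)) - 1)"
        unfolding w_def by (intro sum.cong[OF refl]) simp
      then have "w S = C0 * a ^ ((n + 1) * (r - d)) - real h" using T(3) by (simp add: C0_def right_diff_distrib)
      then show ?thesis unfolding K_def using C0 a by (auto intro!: add_nonneg_nonneg mult_nonneg_nonneg)
    next
      case False
      have t: "0 \<le> a ^ ((n + 1) * ldim (\<lambda>v. D v - set_div S v)) - 1 \<and>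
          a ^ ((n + 1) * ldim (\<lambda>v. D v - set_div S v)) - 1 \<le> a ^ ((n + 1) * (c + 1))" if D: "D \<in> T" for D
      proof -
        have "int (ldim (\<lambda>v. D v - set_div S v)) \<le> int (r - d) + 1"
          using ldim_le[OF DS(1)[OF D d]] DS(2)[OF D d] by simp
        then have "ldim (\<lambda>v. D v - set_div S v) \<le> c + 1" using False by linarith
        then have "(n + 1) * ldim (\<lambda>v. D v - set_div S v) \<le> (n + 1) * (c + 1)" by (rule mult_le_mono2)
        then have "a ^ ((n + 1) * ldim (\<lambda>v. D v - set_div S v)) \<le> a ^ ((n + 1) * (c + 1))"
          using a by (intro power_increasing) auto
        moreover have "1 \<le> a ^ ((n + 1) * ldim (\<lambda>v. D v - set_div S v))" using a by (intro one_le_power) simp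
        ultimately show ?thesis by linarith
      qed
      have w0: "0 \<le> w S" unfolding w_def using t by (intro sum_nonneg) blast
      have "w S \<le> (\<Sum>D\<in>T. a ^ ((n + 1) * (c + 1)))" unfolding w_def using t by (intro sum_mono) blast
      then have w1: "w S \<le> real h * a ^ ((n + 1) * (c + 1))" using T(3) by simp
      have "(n + 1) * (r - d) \<le> (n + 1) * c" using False by (intro mult_le_mono2) simp
      then have "a ^ ((n + 1) * (r - d)) \<le> a ^ ((n + 1) * c)"
        by (rule power_increasing) (use a in simp)
      then have "C0 * a ^ ((n + 1) * (r - d)) \<le> C0 * a ^ ((n + 1) * c)"
        using C0 by (rule mult_left_mono)
      moreover have "0 \<le> C0 * a ^ ((n + 1) * (r - d))" using C0 a by simp
      ultimately show ?thesis using w0 w1 unfolding K_def by linarith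
    qed
    have "C0 * (\<Sum>d\<le>r. real_of_int (moebius_sum d) * a ^ ((n + 1) * (r - d)))
        = (\<Sum>d\<le>r. \<Sum>S\<in>place_sets d. (- 1) ^ card S * (C0 * a ^ ((n + 1) * (r - d))))"
      unfolding sum_distrib_left moebius_sum_def
      by (intro sum.cong[OF refl]) (simp add: sum_distrib_left sum_distrib_right mult_ac)
    then have "real (q - 1) * real (card (points n r)) - C0 * (\<Sum>d\<le>r. real_of_int (moebius_sum d) * a ^ ((n + 1) * (r - d)))
        = (\<Sum>d\<le>r. \<Sum>S\<in>place_sets d. (- 1) ^ card S * (w S - C0 * a ^ ((n + 1) * (r - d))))"
      unfolding lhs by (simp add: right_diff_distrib sum_subtractf)
    also have "\<bar>\<dots>\<bar> \<le> (\<Sum>d\<le>r. \<bar>\<Sum>S\<in>place_sets d. (- 1) ^ card S * (w S - C0 * a ^ ((n + 1) * (r - d)))\<bar>)"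
      by (rule sum_abs)
    also have "\<dots> \<le> (\<Sum>d\<le>r. K * (real h * a) * a ^ d)"
    proof (rule sum_mono)
      fix d assume d: "d \<in> {..r}"
      have "\<bar>\<Sum>S\<in>place_sets d. (- 1) ^ card S * (w S - C0 * a ^ ((n + 1) * (r - d)))\<bar>
          \<le> (\<Sum>S\<in>place_sets d. \<bar>(- 1) ^ card S * (w S - C0 * a ^ ((n + 1) * (r - d)))\<bar>)" by (rule sum_abs)
      also have "\<dots> \<le> (\<Sum>S\<in>place_sets d. K)"
        using wb d by (intro sum_mono) (simp add: abs_mult power_abs)
      also have "\<dots> = K * real (card (place_sets d))" by simp
      also have "\<dots> \<le> K * (real h * a * a ^ d)"
        using card_place_sets(2)[of d] num_Eff_le_real[of d] K unfolding a_def by (intro mult_left_mono) linarith+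
      finally show "\<bar>\<Sum>S\<in>place_sets d. (- 1) ^ card S * (w S - C0 * a ^ ((n + 1) * (r - d)))\<bar> \<le> K * (real h * a) * a ^ d"
        by (simp add: mult_ac)
    qed
    also have "\<dots> = K * (real h * a) * (\<Sum>d\<le>r. a ^ d)" by (simp add: sum_distrib_left)
    also have "\<dots> \<le> K * (real h * a) * a ^ (r + 1)"
      using K a sum_powers_le[OF a, of r] by (intro mult_left_mono mult_nonneg_nonneg) auto
    finally show ?thesis by (simp add: mult_ac)
  qed
  then show ?thesis unfolding C0_def a_def by blast
qed

section \<open>The zeta function as a power series\<close>

context
  fixes t :: real assumes t: "0 < t" "real q * t < 1"
begin

lemma summable_num_Eff: "summable (\<lambda>d. real (num_Eff d) * t ^ d)"
proof (rule summable_comparison_test)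
  show "\<exists>N. \<forall>d\<ge>N. norm (real (num_Eff d) * t ^ d) \<le> real h * real q * (real q * t) ^ d"
  proof (intro exI allI impI)
    fix d
    have "real (num_Eff d) * t ^ d \<le> real h * real q * real q ^ d * t ^ d"
      using num_Eff_le_real t by (intro mult_right_mono) auto
    then show "norm (real (num_Eff d) * t ^ d) \<le> real h * real q * (real q * t) ^ d"
      using t by (simp add: power_mult_distrib mult_ac)
  qed
  show "summable (\<lambda>d. real h * real q * (real q * t) ^ d)"
    using t by (intro summable_mult summable_geometric) simp
qed

lemma abs_moebius_term_le: "\<bar>real_of_int (moebius_sum d) * t ^ d\<bar> \<le> real (num_Eff d) * t ^ d"
proof -
  have "\<bar>real_of_int (moebius_sum d)\<bar> \<le> real (num_Eff d)"
    using abs_moebius_sum_le[of d] by linarith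
  then have "\<bar>real_of_int (moebius_sum d)\<bar> * t ^ d \<le> real (num_Eff d) * t ^ d"
    using t by (intro mult_right_mono) auto
  then show ?thesis using t by (simp add: abs_mult)
qed

lemma summable_abs_moebius: "summable (\<lambda>d. \<bar>real_of_int (moebius_sum d) * t ^ d\<bar>)"
  using abs_moebius_term_le by (intro summable_comparison_test[OF _ summable_num_Eff]) auto

text \<open>Cauchy product of two absolutely convergent series, with coefficients from
  \<open>moebius_convolution\<close>.\<close>

lemma moebius_inverse:
  "(\<Sum>d. real_of_int (moebius_sum d) * t ^ d) * (\<Sum>d. real (num_Eff d) * t ^ d) = 1"
proof -
  have "summable (\<lambda>d. norm (real_of_int (moebius_sum d) * t ^ d))" using summable_abs_moebius by simp
  moreover have "summable (\<lambda>d. norm (real (num_Eff d) * t ^ d))" using summable_num_Eff t by simp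
  ultimately have "(\<lambda>k. \<Sum>i\<le>k. (real_of_int (moebius_sum i) * t ^ i) * (real (num_Eff (k - i)) * t ^ (k - i)))
      sums ((\<Sum>d. real_of_int (moebius_sum d) * t ^ d) * (\<Sum>d. real (num_Eff d) * t ^ d))"
    by (rule Cauchy_product_sums)
  moreover have "(\<Sum>i\<le>k. (real_of_int (moebius_sum i) * t ^ i) * (real (num_Eff (k - i)) * t ^ (k - i)))
      = (if k = 0 then 1 else 0)" for k
  proof -
    have "(\<Sum>i\<le>k. (real_of_int (moebius_sum i) * t ^ i) * (real (num_Eff (k - i)) * t ^ (k - i)))
        = (\<Sum>i\<le>k. real_of_int (moebius_sum i * int (num_Eff (k - i))) * t ^ k)"
    proof (rule sum.cong[OF refl])
      fix i assume "i \<in> {..k}"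
      then have "t ^ k = t ^ i * t ^ (k - i)" by (simp flip: power_add)
      then show "(real_of_int (moebius_sum i) * t ^ i) * (real (num_Eff (k - i)) * t ^ (k - i))
          = real_of_int (moebius_sum i * int (num_Eff (k - i))) * t ^ k" by simp
    qed
    also have "\<dots> = real_of_int (\<Sum>i\<le>k. moebius_sum i * int (num_Eff (k - i))) * t ^ k"
      by (simp add: sum_distrib_right)
    finally show ?thesis unfolding moebius_convolution by simp
  qed
  ultimately have "(\<lambda>k. if k = 0 then 1 else 0)
      sums ((\<Sum>d. real_of_int (moebius_sum d) * t ^ d) * (\<Sum>d. real (num_Eff d) * t ^ d))" by simp
  moreover have "(\<lambda>k. if k = 0 then 1 else 0) sums (1 :: real)"
    using sums_single[of 0 "\<lambda>_. 1 :: real"] by simp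
  ultimately show ?thesis by (rule sums_unique2)
qed

text \<open>The Moebius sums are bounded by the numbers of effective divisors, hence the tail by a
  geometric series in \<open>q * t\<close>.\<close>

lemma moebius_tail:
  "\<bar>(\<Sum>d\<le>r. real_of_int (moebius_sum d) * t ^ d) - (\<Sum>d. real_of_int (moebius_sum d) * t ^ d)\<bar>
    \<le> real h * real q / (1 - real q * t) * (real q * t) ^ r"
proof -
  let ?m = "\<lambda>d. real_of_int (moebius_sum d) * t ^ d"
  have sm: "summable ?m" using summable_abs_moebius by (rule summable_rabs_cancel)
  have ss: "summable (\<lambda>d. \<bar>?m (d + Suc r)\<bar>)"
    by (rule summable_iff_shift[of "\<lambda>d. \<bar>?m d\<bar>" "Suc r", THEN iffD2, OF summable_abs_moebius])
  have "(\<Sum>d. ?m d) = (\<Sum>d. ?m (d + Suc r)) + (\<Sum>d<Suc r. ?m d)" by (rule suminf_split_initial_segment[OF sm])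
  then have "\<bar>(\<Sum>d\<le>r. ?m d) - (\<Sum>d. ?m d)\<bar> = \<bar>\<Sum>d. ?m (d + Suc r)\<bar>"
    by (simp add: lessThan_Suc_atMost)
  also have "\<dots> \<le> (\<Sum>d. \<bar>?m (d + Suc r)\<bar>)" using ss by (rule summable_rabs)
  also have "\<dots> \<le> (\<Sum>d. real h * real q * (real q * t) ^ Suc r * (real q * t) ^ d)"
  proof (rule suminf_le)
    fix d
    have "\<bar>?m (d + Suc r)\<bar> \<le> real (num_Eff (d + Suc r)) * t ^ (d + Suc r)" by (rule abs_moebius_term_le)
    also have "\<dots> \<le> real h * real q * real q ^ (d + Suc r) * t ^ (d + Suc r)"
      using num_Eff_le_real[of "d + Suc r"] t by (intro mult_right_mono) simp_all
    finally show "\<bar>?m (d + Suc r)\<bar> \<le> real h * real q * (real q * t) ^ Suc r * (real q * t) ^ d"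
      by (simp add: power_mult_distrib power_add mult_ac)
  next
    show "summable (\<lambda>d. \<bar>?m (d + Suc r)\<bar>)" by (rule ss)
    show "summable (\<lambda>d. real h * real q * (real q * t) ^ Suc r * (real q * t) ^ d)"
      using t by (intro summable_mult summable_geometric) simp
  qed
  also have "\<dots> = real h * real q * (real q * t) ^ Suc r * (1 / (1 - real q * t))"
    using t by (subst suminf_mult) (simp_all add: suminf_geometric summable_geometric)
  also have "\<dots> \<le> real h * real q * (real q * t) ^ r * (1 / (1 - real q * t))"
    using t by (intro mult_right_mono mult_left_mono power_decreasing) auto
  finally show ?thesis by simp
qed

text \<open>The unordered sum is grouped by degree, as absolute convergence permits; each group is
  finite.\<close>

lemma Z_function_eq: "Z_function emb t = (\<Sum>d. real (num_Eff d) * t ^ d)"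
proof -
  let ?f = "\<lambda>D. t ^ nat (deg D)"
  have inner: "(?f has_sum (real (num_Eff d) * t ^ d)) (Eff_of_deg d)" for d
  proof -
    have "(\<Sum>D\<in>Eff_of_deg d. ?f D) = real (num_Eff d) * t ^ d" by (simp add: Eff_of_deg_def)
    then show ?thesis using has_sum_finite[OF finite_Eff_of_deg[of d], of ?f] by simp
  qed
  have outer: "((\<lambda>d. real (num_Eff d) * t ^ d) has_sum (\<Sum>d. real (num_Eff d) * t ^ d)) UNIV"
    using summable_num_Eff t by (intro norm_summable_imp_has_sum summable_sums) simp_all
  have "((\<lambda>(d, D). ?f D) has_sum (\<Sum>d. real (num_Eff d) * t ^ d)) (Sigma UNIV Eff_of_deg)"
  proof (rule has_sum_SigmaI)
    show "((\<lambda>y. case (d, y) of (d, D) \<Rightarrow> ?f D) has_sum (real (num_Eff d) * t ^ d)) (Eff_of_deg d)" for d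
      using inner by simp
    show "(\<lambda>(d, D). ?f D) summable_on Sigma UNIV Eff_of_deg"
    proof (rule summable_on_SigmaI[where g = "\<lambda>d. real (num_Eff d) * t ^ d"])
      show "((\<lambda>y. case (d, y) of (d, D) \<Rightarrow> ?f D) has_sum (real (num_Eff d) * t ^ d)) (Eff_of_deg d)" for d
        using inner by simp
      show "(\<lambda>d. real (num_Eff d) * t ^ d) summable_on UNIV" using outer by (rule has_sum_imp_summable)
    qed (use t in auto)
  qed (rule outer)
  moreover have "bij_betw snd (Sigma UNIV Eff_of_deg) Eff"
  proof (rule bij_betw_byWitness[where f' = "\<lambda>D. (nat (deg D), D)"])
    show "(\<lambda>D. (nat (deg D), D)) ` Eff \<subseteq> Sigma UNIV Eff_of_deg" using deg_Eff by (auto simp: Eff_of_deg_def)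
  qed (auto simp: Eff_of_deg_def)
  ultimately have "(?f has_sum (\<Sum>d. real (num_Eff d) * t ^ d)) Eff"
    using has_sum_reindex_bij_betw[of snd "Sigma UNIV Eff_of_deg" Eff ?f] by (simp add: case_prod_unfold)
  then show ?thesis unfolding Z_function_def by (rule infsumI)
qed

end

text \<open>At \<open>t = 1 / q ^ (n + 1)\<close> the partial Moebius sums approach
  \<open>1 / Z\<close> up to the order \<open>(q * t) ^ r\<close>. Multiplied by the main factor
  \<open>q ^ ((n + 1) * r)\<close> this is again of order \<open>q ^ r\<close>, and
  \<open>1 \<le> n\<close> ensures \<open>q * t < 1\<close>.\<close>

theorem card_points_asymptotics:
  assumes n: "1 \<le> n"
  shows "\<exists>C. \<forall>r. \<bar>real (card (points n r)) -
      real h * real q powi ((int n + 1) * (1 - g)) / (Z_function emb (1 / real q ^ (n + 1)) * (real q - 1))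
        * real q ^ ((n + 1) * r)\<bar> \<le> C * real q ^ r"
proof -
  define a where "a = real q"
  have a: "2 \<le> a" using q_ge_2 by (simp add: a_def)
  define t where "t = 1 / a ^ (n + 1)"
  have t: "0 < t" "a * t < 1"
  proof -
    show "0 < t" using a by (simp add: t_def)
    have "a ^ 1 < a ^ (n + 1)" using a n by (intro power_strict_increasing) auto
    then show "a * t < 1" using a by (simp add: t_def)
  qed
  note t' = t[unfolded a_def]
  define C0 where "C0 = real h * a powi ((int n + 1) * (1 - g))"
  have C0: "0 \<le> C0" using a by (simp add: C0_def)
  define Z where "Z = Z_function emb t"
  define M where "M = (\<Sum>d. real_of_int (moebius_sum d) * t ^ d)"
  have MZ: "M * Z = 1" unfolding M_def Z_def Z_function_eq[OF t'] by (rule moebius_inverse[OF t'])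
  obtain C where C: "\<And>r. \<bar>real (q - 1) * real (card (points n r)) -
      C0 * (\<Sum>d\<le>r. real_of_int (moebius_sum d) * a ^ ((n + 1) * (r - d)))\<bar> \<le> C * a ^ r"
    using card_points_approx[of n] unfolding C0_def a_def by blast
  define C' where "C' = C0 * (real h * a / (1 - a * t)) + C"
  have "\<bar>real (card (points n r)) - C0 / (Z * (a - 1)) * a ^ ((n + 1) * r)\<bar> \<le> (C' / (a - 1)) * a ^ r" for r
  proof -
    let ?B = "real (card (points n r))"
    let ?M = "\<Sum>d\<le>r. real_of_int (moebius_sum d) * t ^ d"
    have "(\<Sum>d\<le>r. real_of_int (moebius_sum d) * a ^ ((n + 1) * (r - d))) = a ^ ((n + 1) * r) * ?M"
      unfolding sum_distrib_left
    proof (rule sum.cong[OF refl])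
      fix d assume d: "d \<in> {..r}"
      have e: "(n + 1) * r = (n + 1) * (r - d) + (n + 1) * d"
        unfolding add_mult_distrib2[symmetric] using d by simp
      have "a ^ ((n + 1) * r) = a ^ ((n + 1) * (r - d)) * (a ^ (n + 1)) ^ d"
        unfolding e power_add[of a "(n + 1) * (r - d)"] power_mult[of a "n + 1" d] ..
      then have "a ^ ((n + 1) * (r - d)) = a ^ ((n + 1) * r) * t ^ d"
        using a by (simp add: t_def power_divide)
      then show "real_of_int (moebius_sum d) * a ^ ((n + 1) * (r - d)) = a ^ ((n + 1) * r) * (real_of_int (moebius_sum d) * t ^ d)"
        by simp
    qed
    then have 1: "\<bar>real (q - 1) * ?B - C0 * a ^ ((n + 1) * r) * ?M\<bar> \<le> C * a ^ r" using C[of r] by (simp add: mult.assoc)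
    have "\<bar>C0 * a ^ ((n + 1) * r) * ?M - C0 * a ^ ((n + 1) * r) * M\<bar> = C0 * a ^ ((n + 1) * r) * \<bar>?M - M\<bar>"
      using C0 a by (simp add: abs_mult flip: right_diff_distrib)
    also have "\<dots> \<le> C0 * a ^ ((n + 1) * r) * (real h * a / (1 - a * t) * (a * t) ^ r)"
      using moebius_tail[OF t', of r] C0 a unfolding M_def a_def by (intro mult_left_mono) auto
    also have "\<dots> = C0 * (real h * a / (1 - a * t)) * (a ^ ((n + 1) * r) * (a * t) ^ r)"
      by (simp only: mult_ac)
    also have "a ^ ((n + 1) * r) * (a * t) ^ r = a ^ r"
    proof -
      have "a ^ (n + 1) * (a * t) = a" using a by (simp add: t_def)
      then show ?thesis unfolding power_mult[of a "n + 1" r] power_mult_distrib[symmetric] by (rule arg_cong)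
    qed
    finally have "\<bar>real (q - 1) * ?B - C0 * a ^ ((n + 1) * r) * M\<bar> \<le> C' * a ^ r"
      using 1 unfolding C'_def distrib_right by linarith
    moreover have "real (q - 1) = a - 1" using q_ge_2 by (simp add: a_def)
    moreover have "M = 1 / Z" using MZ by (metis nonzero_eq_divide_eq mult_zero_right zero_neq_one)
    ultimately have "\<bar>(a - 1) * ?B - C0 * a ^ ((n + 1) * r) / Z\<bar> \<le> C' * a ^ r" by simp
    moreover have "(a - 1) * ?B - C0 * a ^ ((n + 1) * r) / Z = (a - 1) * (?B - C0 / (Z * (a - 1)) * a ^ ((n + 1) * r))"
    proof -
      have "(a - 1) * (C0 / (Z * (a - 1)) * a ^ ((n + 1) * r)) = C0 * a ^ ((n + 1) * r) / Z"
        using a by (simp add: mult.commute[of Z])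
      then show ?thesis unfolding right_diff_distrib[of "a - 1" ?B] by (simp only:)
    qed
    ultimately have "(a - 1) * \<bar>?B - C0 / (Z * (a - 1)) * a ^ ((n + 1) * r)\<bar> \<le> C' * a ^ r"
      using a by (simp add: abs_mult)
    then show ?thesis using a by (simp add: field_simps)
  qed
  then show ?thesis unfolding C0_def Z_def t_def a_def by blast
qed

end

theorem theorem4p1:
  fixes emb :: "'f::{field,finite} \<Rightarrow> 'k::field"
    and infty :: "'k \<Rightarrow> int"
    and n d :: nat
    and g :: int
    and q \<kappa> :: real
  assumes "function_field emb"
    and "q = real CARD('f)"
    and "g = genus emb"
    and "infty \<in> places emb"
    and "d = place_degree emb infty"
    and "n \<ge> 1"
    and "\<kappa> = real (class_number emb) * q powi ((int n + 1) * (1 - g))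
              / (zeta_function emb (real n + 1) * (q - 1))"
  shows "(\<lambda>r::nat. real (card {P \<in> projective_space n. height emb n P = int r})
                     - \<kappa> * q ^ ((n + 1) * r))
           \<in> O(\<lambda>r. if n = 1 \<and> d = 1 then q ^ r * ln (q ^ r)
                    else q powr (real r * (real n + 1 - 1 / real d)))"
proof -
  interpret ff: function_field emb by (rule assms(1))
  have q: "q = real ff.q" using assms(2) by simp
  have q2: "2 \<le> q" using ff.q_ge_2 by (simp add: q)
  have "q powr (- (real n + 1)) = 1 / q ^ (n + 1)"
    unfolding powr_minus_divide using q2 powr_realpow[of q "n + 1"] by (simp add: add.commute)
  then have "zeta_function emb (real n + 1) = Z_function emb (1 / q ^ (n + 1))"
    using assms(2) by (simp add: zeta_function_def)
  then have \<kappa>: "\<kappa> = real (class_number emb) * q powi ((int n + 1) * (1 - g)) / (Z_function emb (1 / q ^ (n + 1)) * (q - 1))"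
    using assms(7) by simp
  let ?f = "\<lambda>r. real (card {P \<in> projective_space n. height emb n P = int r}) - \<kappa> * q ^ ((n + 1) * r)"
  obtain C where C: "\<bar>?f r\<bar> \<le> C * q ^ r" for r
    using ff.card_points_asymptotics[OF assms(6)] unfolding \<kappa> assms(3) q by blast
  have "0 \<le> C" using C[of 0] abs_ge_zero[of "?f 0"] by simp
  have ln2: "0 < ln (2 :: real)" by simp
  show ?thesis
  \<comment> \<open>\<open>C / ln 2\<close> serves the logarithmic bound, as
    \<open>ln (q ^ r)\<close> is at least \<open>ln 2\<close> for \<open>r \<ge> 1\<close>;
    \<open>C\<close> serves the other one.\<close>
  proof (rule bigoI[where c = "C / ln 2 + C"])
    show "\<forall>\<^sub>F r in sequentially. norm (?f r) \<le> (C / ln 2 + C) *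
        norm (if n = 1 \<and> d = 1 then q ^ r * ln (q ^ r) else q powr (real r * (real n + 1 - 1 / real d)))"
      using eventually_ge_at_top[of 1]
    proof eventually_elim
      case (elim r)
      have qr: "0 \<le> q ^ r" using q2 by simp
      show ?case
      proof (cases "n = 1 \<and> d = 1")
        case True
        have "ln 2 * 1 \<le> ln q * real r" using q2 elim by (intro mult_mono) auto
        then have l: "ln 2 \<le> ln (q ^ r)" using q2 by (simp add: ln_realpow mult.commute)
        have "norm (?f r) \<le> C / ln 2 * (q ^ r * ln 2)" using C[of r] by simp
        also have "\<dots> \<le> (C / ln 2 + C) * (q ^ r * ln (q ^ r))"
          using \<open>0 \<le> C\<close> qr l ln2 by (intro mult_mono mult_left_mono) auto
        also have "q ^ r * ln (q ^ r) = norm (q ^ r * ln (q ^ r))"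
          unfolding real_norm_def using qr l ln2 by (intro abs_of_nonneg[symmetric] mult_nonneg_nonneg) linarith+
        finally show ?thesis unfolding if_P[OF True] .
      next
        case False
        \<comment> \<open>Hence the exponent is at least \<open>r\<close>; the case
          \<open>d = 0\<close> is settled by \<open>1 / 0 = 0\<close>.\<close>
        have "1 / real d \<le> 1" by (cases "d = 0") auto
        then have "1 \<le> real n + 1 - 1 / real d" using assms(6) by linarith
        then have "real r * 1 \<le> real r * (real n + 1 - 1 / real d)" by (intro mult_left_mono) auto
        then have "q powr real r \<le> q powr (real r * (real n + 1 - 1 / real d))"
          using q2 by (intro powr_mono) auto
        then have p: "q ^ r \<le> q powr (real r * (real n + 1 - 1 / real d))"
          using q2 by (simp add: powr_realpow)
        have "norm (?f r) \<le> C * q ^ r" using C[of r] by simp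
        also have "\<dots> \<le> (C / ln 2 + C) * norm (q powr (real r * (real n + 1 - 1 / real d)))"
          unfolding real_norm_def using \<open>0 \<le> C\<close> p qr by (intro mult_mono) auto
        finally show ?thesis unfolding if_not_P[OF False] .
      qed
    qed
  qed
qed

end
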